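(* Let $k\ge0$ be an integer. For every $f\in L^2(\Omega)$ the $C^0$-conforming discrete problem: find $(\hat y_h,z_{\mathcal T_h})\in\hat V_{h,0}^k\times U_{h,0}^k$ such that $$a_h^c(\hat y_h,\hat v_h)-(z_{\mathcal T_h},v_{\mathcal T_h})+(y_{\mathcal T_h},u_{\mathcal T_h})+\kappa(\nabla z_{\mathcal T_h},\nabla u_{\mathcal T_h})=(f,u_{\mathcal T_h})\qquad\text{for all }(\hat v_h,u_{\mathcal T_h})\in\hat V_{h,0}^k\times U_{h,0}^k$$ is well-posed (has a unique solution).
   Context: $\Omega\subset\mathbb R^d$, $d\in\{2,3\}$, is an open bounded convex domain with polygonal (polyhedral) boundary, $\kappa>0$ is a constant. $(\cdot,\cdot)_S$ is the $L^2(S)$ inner product (subscript omitted if $S=\Omega$). $\mathcal T_h$ is a simplicial mesh of $\Omega$ from a shape-regular (matching) simplicial mesh sequence, with set of faces $\mathcal F_h$; $h_T$ is the diameter of $T$, $n_T$ the unit outward normal to $T$, $n_F$ a fixed unit normal to the face $F$, $\mathcal F_{\partial T}$ the set of faces of $T$. $\mathbb P^l(T)$ are polynomials of degree $\le l$, $\mathbb P^l(\mathcal F_{\partial T})=\times_{F\in\mathcal F_{\partial T}}\mathbb P^l(F)$, $\mathbb P^l(\mathcal F_h)$ the facewise polynomials, $\mathbb P_{\mathrm g}^l(\mathcal T_h)$ the continuous piecewise polynomials of degree $\le l$, $\Pi^k_{\partial T}$ the $L^2$-orthogonal projection onto $\mathbb P^k(\mathcal F_{\partial T})$. $\partial_n,\partial_{nn}$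 denote the normal and normal-normal derivatives on $\partial T$. $\hat V_T^k:=\mathbb P^{k+2}(T)\times\mathbb P^k(\mathcal F_{\partial T})$ with elements $\hat v_T=(v_T,\eta_{\partial T})$. The reconstruction $\mathcal R_T^c:\hat V_T^k\to\mathbb P^{k+2}(T)$ is defined by $(\nabla^2\mathcal R_T^c(\hat v_T),\nabla^2w)_T=(\nabla^2v_T,\nabla^2w)_T-(\partial_nv_T-\eta_{\partial T},\partial_{nn}w)_{\partial T}$ for all $w\in\mathbb P^{k+2}(T)$ and $(\mathcal R_T^c(\hat v_T),\xi)_T=(v_T,\xi)_T$ for all $\xi\in\mathbb P^1(T)$. For $\hat y_T=(y_T,\gamma_{\partial T})$, $\hat v_T=(v_T,\eta_{\partial T})$: $S_{\partial T}^c(\hat y_T,\hat v_T)=h_T^{-1}(\Pi^k_{\partial T}(\gamma_{\partial T}-\partial_ny_T),\Pi^k_{\partial T}(\eta_{\partial T}-\partial_nv_T))_{\partial T}$ and $a_h^c(\hat y_h,\hat v_h)=\sum_{T\in\mathcal T_h}[(\nabla^2\mathcal R_T^c(\hat y_T),\nabla^2\mathcal R_T^c(\hat v_T))_T+S^c_{\partial T}(\hat y_T,\hat v_T)]$. $\hat V_{h,0}^k$ is the set of $\hat v_h=(v_{\mathcal T_h},\eta_{\mathcal F_h})\in\mathbb P_{\mathrm g}^{k+2}(\mathcal T_h)\times\mathbb P^k(\mathcal F_h)$ with $v_{\mathcal T_h}\in H_0^1(\Omega)$; local components $\hat v_T=(v_T,\eta_{\partial T})$ with $v_T=v_{\mathcal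 T_h}|_T$, $\eta_{\partial T}|_F=(n_F\cdot n_T)\eta_F$. $U_{h,0}^k:=\mathbb P_{\mathrm g}^{k+1}(\mathcal T_h)\cap H_0^1(\Omega)$. *)

theory Defs
  imports "HOL-Analysis.Analysis"
begin

definition part_deriv :: "'d::finite \<Rightarrow> (real^'d \<Rightarrow> real) \<Rightarrow> real^'d \<Rightarrow> real" where
  "part_deriv i f x = frechet_derivative f (at x) (axis i 1)"

definition grad :: "(real^'d::finite \<Rightarrow> real) \<Rightarrow> real^'d \<Rightarrow> real^'d" where
  "grad f x = (\<chi> i. part_deriv i f x)"

definition hess :: "(real^'d::finite \<Rightarrow> real) \<Rightarrow> real^'d \<Rightarrow> real^'d^'d" where
  "hess f x = (\<chi> i j. part_deriv i (part_deriv j f) x)"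

text \<open>
  Polynomial functions of total degree at most \<open>l\<close> on all of \<open>\<real>\<^sup>d\<close>. As a
  \<open>d\<close>-simplex \<open>T\<close> has nonempty interior, this is also the representation of \<open>P\<^sup>l(T)\<close>
  used below: a polynomial on \<open>T\<close> is identified with its unique polynomial extension,
  so that its derivatives make sense up to and including the boundary of \<open>T\<close>.
\<close>

definition poly_space :: "nat \<Rightarrow> (real^'d::finite \<Rightarrow> real) set" where
  "poly_space l = {p. \<exists>c :: ('d \<Rightarrow> nat) \<Rightarrow> real.
     \<forall>x. p x = (\<Sum>\<alpha> | (\<Sum>i\<in>UNIV. \<alpha> i) \<le> l. c \<alpha> * (\<Prod>i\<in>UNIV. (x $ i) ^ \<alpha> i))}"

text \<open>
  For matrix-valued functions the inner product of the type \<open>real^'d^'d\<close> is the Frobenius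
  product.
\<close>

definition L2_inner :: "(real^'d::finite) set \<Rightarrow> (real^'d \<Rightarrow> 'v::euclidean_space)
    \<Rightarrow> (real^'d \<Rightarrow> 'v) \<Rightarrow> real" where
  "L2_inner S f g = (LINT x:S|lebesgue. f x \<bullet> g x)"

definition L2_space :: "(real^'d::finite) set \<Rightarrow> (real^'d \<Rightarrow> real) set" where
  "L2_space S = {f. set_borel_measurable lebesgue S f \<and>
     set_integrable lebesgue S (\<lambda>x. (f x)\<^sup>2)}"

primrec Cm_fun :: "nat \<Rightarrow> (real^'d::finite \<Rightarrow> real) \<Rightarrow> bool" where
  "Cm_fun 0 f = continuous_on UNIV f"
| "Cm_fun (Suc m) f = ((\<forall>x. f differentiable (at x)) \<and> (\<forall>i. Cm_fun m (part_deriv i f)))"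

definition test_functions :: "(real^'d::finite) set \<Rightarrow> (real^'d \<Rightarrow> real) set" where
  "test_functions \<Omega> = {\<phi>. (\<forall>m. Cm_fun m \<phi>) \<and>
     (\<exists>K. compact K \<and> K \<subseteq> \<Omega> \<and> (\<forall>x. x \<notin> K \<longrightarrow> \<phi> x = 0))}"

definition weak_gradient ::
    "(real^'d::finite) set \<Rightarrow> (real^'d \<Rightarrow> real) \<Rightarrow> (real^'d \<Rightarrow> real^'d) \<Rightarrow> bool" where
  "weak_gradient \<Omega> u g \<longleftrightarrow> (\<forall>\<phi>\<in>test_functions \<Omega>. \<forall>i.
     L2_inner \<Omega> u (part_deriv i \<phi>) = - L2_inner \<Omega> (\<lambda>x. g x $ i) \<phi>)"

text \<open>The closure of the test functions in the norm of \<open>H\<^sup>1(\<Omega>)\<close>.\<close>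

definition H1_zero :: "(real^'d::finite) set \<Rightarrow> (real^'d \<Rightarrow> real) set" where
  "H1_zero \<Omega> = {u. u \<in> L2_space \<Omega> \<and>
     (\<exists>g. (\<forall>i. (\<lambda>x. g x $ i) \<in> L2_space \<Omega>) \<and> weak_gradient \<Omega> u g \<and>
       (\<exists>\<phi> :: nat \<Rightarrow> real^'d \<Rightarrow> real. (\<forall>n. \<phi> n \<in> test_functions \<Omega>) \<and>
          (\<lambda>n. LINT x:\<Omega>|lebesgue. (\<phi> n x - u x)\<^sup>2) \<longlonglongrightarrow> 0 \<and>
          (\<lambda>n. LINT x:\<Omega>|lebesgue. (norm (grad (\<phi> n) x - g x))\<^sup>2) \<longlonglongrightarrow> 0))}"

definition polytopal_domain :: "(real^'d::finite) set \<Rightarrow> bool" where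
  "polytopal_domain \<Omega> \<longleftrightarrow>
     \<Omega> \<noteq> {} \<and> open \<Omega> \<and> bounded \<Omega> \<and> convex \<Omega> \<and> polytope (closure \<Omega>)"

text \<open>
  Mesh cells are closed nondegenerate simplices; \<open>triangulation\<close> contains finiteness and
  the matching condition (any two cells meet in a common, possibly empty, face).
\<close>

definition simplicial_mesh :: "(real^'d::finite) set \<Rightarrow> (real^'d) set set \<Rightarrow> bool" where
  "simplicial_mesh \<Omega> \<T> \<longleftrightarrow>
     triangulation \<T> \<and> (\<forall>T\<in>\<T>. int CARD('d) simplex T) \<and> \<Union>\<T> = closure \<Omega>"

definition shape_regular_mesh_sequence ::
    "(real^'d::finite) set \<Rightarrow> (nat \<Rightarrow> (real^'d) set set) \<Rightarrow> bool" where
  "shape_regular_mesh_sequence \<Omega> \<T>s \<longleftrightarrow>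
     (\<forall>n. simplicial_mesh \<Omega> (\<T>s n)) \<and>
     (\<exists>\<rho>>0. \<forall>n. \<forall>T\<in>\<T>s n. \<exists>x. cball x (\<rho> * diameter T) \<subseteq> T)"

definition mesh_faces :: "(real^'d::finite) set set \<Rightarrow> (real^'d) set set" where
  "mesh_faces \<T> = (\<Union>T\<in>\<T>. {F. F facet_of T})"

definition unit_normal :: "(real^'d::finite) set \<Rightarrow> real^'d \<Rightarrow> bool" where
  "unit_normal F n \<longleftrightarrow> norm n = 1 \<and> (\<forall>x\<in>F. \<forall>y\<in>F. n \<bullet> (y - x) = 0)"

text \<open>The unit outward normal to \<open>T\<close> on its facet \<open>F\<close>.\<close>

definition outward_normal :: "(real^'d::finite) set \<Rightarrow> (real^'d) set \<Rightarrow> real^'d" where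
  "outward_normal T F = (THE n. unit_normal F n \<and> (\<forall>x\<in>F. \<forall>y\<in>T. n \<bullet> (y - x) \<le> 0))"

text \<open>
  The \<open>(d-1)\<close>-dimensional Lebesgue measure on the hyperplane \<open>H\<close> spanned by a facet: by
  Fubini, the surface measure of a subset of \<open>H\<close> is the volume of the right cylinder of
  height 1 over it. The measure is therefore the push-forward, under the orthogonal
  projection onto \<open>H\<close>, of the volume on the slab of total thickness 1 centred at \<open>H\<close>.
\<close>

definition face_measure :: "(real^'d::finite) set \<Rightarrow> (real^'d) measure" where
  "face_measure F =
     distr (restrict_space lborel {x. infdist x (affine hull F) \<le> 1 / 2}) borel
       (closest_point (affine hull F))"

text \<open>
  A function on the boundary of \<open>T\<close> may have different limits from the various facets where
  these meet, so it is given as a family indexed by the facets.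
\<close>

definition bd_inner :: "(real^'d::finite) set \<Rightarrow> ((real^'d) set \<Rightarrow> real^'d \<Rightarrow> real)
    \<Rightarrow> ((real^'d) set \<Rightarrow> real^'d \<Rightarrow> real) \<Rightarrow> real" where
  "bd_inner T a b = (\<Sum>F | F facet_of T. LINT x:F|face_measure F. a F x * b F x)"

definition normal_deriv :: "(real^'d::finite) set \<Rightarrow> (real^'d \<Rightarrow> real)
    \<Rightarrow> (real^'d) set \<Rightarrow> real^'d \<Rightarrow> real" where
  "normal_deriv T v F x = grad v x \<bullet> outward_normal T F"

definition normal_deriv2 :: "(real^'d::finite) set \<Rightarrow> (real^'d \<Rightarrow> real)
    \<Rightarrow> (real^'d) set \<Rightarrow> real^'d \<Rightarrow> real" where
  "normal_deriv2 T v F x = outward_normal T F \<bullet> (hess v x *v outward_normal T F)"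

text \<open>
  Functions and families are made zero off their domain of definition, so that equality in
  these spaces is equality of the mathematical objects.
\<close>

definition face_poly_space :: "nat \<Rightarrow> (real^'d::finite) set \<Rightarrow> (real^'d \<Rightarrow> real) set" where
  "face_poly_space k F = {q. (\<exists>p\<in>poly_space k. \<forall>x\<in>F. q x = p x) \<and> (\<forall>x. x \<notin> F \<longrightarrow> q x = 0)}"

definition facewise_poly_space ::
    "nat \<Rightarrow> (real^'d::finite) set set \<Rightarrow> ((real^'d) set \<Rightarrow> real^'d \<Rightarrow> real) set" where
  "facewise_poly_space k \<F> = {\<eta>. (\<forall>F\<in>\<F>. \<eta> F \<in> face_poly_space k F) \<and>
     (\<forall>F. F \<notin> \<F> \<longrightarrow> \<eta> F = (\<lambda>x. 0))}"

definition cont_pw_poly_space ::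
    "nat \<Rightarrow> (real^'d::finite) set set \<Rightarrow> (real^'d \<Rightarrow> real) set" where
  "cont_pw_poly_space l \<T> = {v. continuous_on (\<Union>\<T>) v \<and>
     (\<forall>T\<in>\<T>. \<exists>p\<in>poly_space l. \<forall>x\<in>T. v x = p x) \<and> (\<forall>x. x \<notin> \<Union>\<T> \<longrightarrow> v x = 0)}"

definition V_space :: "(real^'d::finite) set \<Rightarrow> (real^'d) set set \<Rightarrow> nat
    \<Rightarrow> ((real^'d \<Rightarrow> real) \<times> ((real^'d) set \<Rightarrow> real^'d \<Rightarrow> real)) set" where
  "V_space \<Omega> \<T> k =
     (cont_pw_poly_space (k + 2) \<T> \<inter> H1_zero \<Omega>) \<times> facewise_poly_space k (mesh_faces \<T>)"

definition U_space ::
    "(real^'d::finite) set \<Rightarrow> (real^'d) set set \<Rightarrow> nat \<Rightarrow> (real^'d \<Rightarrow> real) set" where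
  "U_space \<Omega> \<T> k = cont_pw_poly_space (k + 1) \<T> \<inter> H1_zero \<Omega>"

definition bd_proj :: "nat \<Rightarrow> (real^'d::finite) set \<Rightarrow> ((real^'d) set \<Rightarrow> real^'d \<Rightarrow> real)
    \<Rightarrow> (real^'d) set \<Rightarrow> real^'d \<Rightarrow> real" where
  "bd_proj k T g = (THE q. q \<in> facewise_poly_space k {F. F facet_of T} \<and>
     (\<forall>r\<in>facewise_poly_space k {F. F facet_of T}. bd_inner T q r = bd_inner T g r))"

definition recon :: "nat \<Rightarrow> (real^'d::finite) set
    \<Rightarrow> (real^'d \<Rightarrow> real) \<times> ((real^'d) set \<Rightarrow> real^'d \<Rightarrow> real) \<Rightarrow> real^'d \<Rightarrow> real" where
  "recon k T = (\<lambda>(v, \<eta>). THE r. r \<in> poly_space (k + 2) \<and>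
     (\<forall>w\<in>poly_space (k + 2).
        L2_inner T (hess r) (hess w) =
        L2_inner T (hess v) (hess w)
        - bd_inner T (\<lambda>F x. normal_deriv T v F x - \<eta> F x) (normal_deriv2 T w)) \<and>
     (\<forall>\<xi>\<in>poly_space 1. L2_inner T r \<xi> = L2_inner T v \<xi>))"

definition stab :: "nat \<Rightarrow> (real^'d::finite) set
    \<Rightarrow> (real^'d \<Rightarrow> real) \<times> ((real^'d) set \<Rightarrow> real^'d \<Rightarrow> real)
    \<Rightarrow> (real^'d \<Rightarrow> real) \<times> ((real^'d) set \<Rightarrow> real^'d \<Rightarrow> real) \<Rightarrow> real" where
  "stab k T = (\<lambda>(y, \<gamma>) (v, \<eta>). inverse (diameter T) *
     bd_inner T (bd_proj k T (\<lambda>F x. \<gamma> F x - normal_deriv T y F x))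
                (bd_proj k T (\<lambda>F x. \<eta> F x - normal_deriv T v F x)))"

text \<open>
  The local components on \<open>T\<close> of a global element. Here \<open>\<nu>\<close> is the choice of the fixed unit
  normals to the mesh faces; the first component is the polynomial extension of the
  restriction to \<open>T\<close>.
\<close>

definition local_comp :: "((real^'d::finite) set \<Rightarrow> real^'d) \<Rightarrow> nat \<Rightarrow> (real^'d) set
    \<Rightarrow> (real^'d \<Rightarrow> real) \<times> ((real^'d) set \<Rightarrow> real^'d \<Rightarrow> real)
    \<Rightarrow> (real^'d \<Rightarrow> real) \<times> ((real^'d) set \<Rightarrow> real^'d \<Rightarrow> real)" where
  "local_comp \<nu> k T = (\<lambda>(v, \<eta>).
     (THE p. p \<in> poly_space (k + 2) \<and> (\<forall>x\<in>T. p x = v x),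
      \<lambda>F x. if F facet_of T then (\<nu> F \<bullet> outward_normal T F) * \<eta> F x else 0))"

definition a_form :: "((real^'d::finite) set \<Rightarrow> real^'d) \<Rightarrow> (real^'d) set set \<Rightarrow> nat
    \<Rightarrow> (real^'d \<Rightarrow> real) \<times> ((real^'d) set \<Rightarrow> real^'d \<Rightarrow> real)
    \<Rightarrow> (real^'d \<Rightarrow> real) \<times> ((real^'d) set \<Rightarrow> real^'d \<Rightarrow> real) \<Rightarrow> real" where
  "a_form \<nu> \<T> k yh vh = (\<Sum>T\<in>\<T>.
     L2_inner T (hess (recon k T (local_comp \<nu> k T yh))) (hess (recon k T (local_comp \<nu> k T vh)))
     + stab k T (local_comp \<nu> k T yh) (local_comp \<nu> k T vh))"

text \<open>
  In the discrete problem, \<open>grad\<close> of a continuous piecewise polynomial is the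
  classical gradient, which exists in the interior of every cell, hence almost everywhere,
  and agrees there with the weak gradient; its values on the remaining null set do not
  affect the Lebesgue integral.
\<close>

definition discrete_solution :: "(real^'d::finite) set \<Rightarrow> real
    \<Rightarrow> (real^'d) set set \<Rightarrow> ((real^'d) set \<Rightarrow> real^'d) \<Rightarrow> nat \<Rightarrow> (real^'d \<Rightarrow> real)
    \<Rightarrow> (real^'d \<Rightarrow> real) \<times> ((real^'d) set \<Rightarrow> real^'d \<Rightarrow> real) \<Rightarrow> (real^'d \<Rightarrow> real) \<Rightarrow> bool" where
  "discrete_solution \<Omega> \<kappa> \<T> \<nu> k f yh z \<longleftrightarrow>
     yh \<in> V_space \<Omega> \<T> k \<and> z \<in> U_space \<Omega> \<T> k \<and>
     (\<forall>vh\<in>V_space \<Omega> \<T> k. \<forall>u\<in>U_space \<Omega> \<T> k.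
        a_form \<nu> \<T> k yh vh - L2_inner \<Omega> z (fst vh) + L2_inner \<Omega> (fst yh) u
        + \<kappa> * L2_inner \<Omega> (grad z) (grad u) = L2_inner \<Omega> f u)"

end

theory Submission
  imports Defs "HOL-Library.Function_Algebras"
begin

text \<open>
  The problem is a square linear system on the finite-dimensional space
  \<open>V \<times> U\<close>, so it suffices that its bilinear form \<open>B\<close> is definite
  (\<open>finite_lax_milgram\<close>). Tested with the solution itself, the two coupling terms cancel and
  \<open>B ((y, z), (y, z)) = a (y, y) + \<kappa> \<parallel>\<nabla>z\<parallel>\<^sup>2\<close>; both summands are nonnegative, so
  it remains to see that each of them is definite (\<open>a_form_definite\<close>, \<open>grad_definite\<close>).

  If \<open>a (s, s) = 0\<close> for \<open>s = (v, \<eta>)\<close>, then on every cell the Hessian of the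
  reconstruction and the projected flux gap vanish. The gap is tested in the definition of the
  reconstruction only with normal-normal derivatives, which have degree \<open>k\<close>, so the reconstruction
  identity with test function \<open>v\<close> gives \<open>\<nabla>\<^sup>2v = 0\<close>: \<open>v\<close> is affine on the cell,
  its normal derivative is constant on each facet, and \<open>\<eta>\<close> equals it there
  (\<open>local_form_zero\<close>). On a facet common to two cells the normal derivatives of both affine pieces
  therefore agree with the single function \<open>\<eta>\<close>, and the tangential ones agree since
  \<open>v\<close> is continuous; the pieces coincide. Cells that do not share a facet meet in a set of
  codimension at least two, which generic segments avoid, so \<open>v\<close> is affine on the whole
  domain (\<open>affine_gluing\<close>). If \<open>\<nabla>z = 0\<close>, the same gluing, with zero gradients, shows that
  \<open>z\<close> is affine.

  An affine function in the closure of the test functions vanishes: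
  integrating by parts against products of affine functions gives
  \<open>2 a\<^sub>i (u, w) = - (\<partial>\<^sub>i w) \<parallel>u\<parallel>\<^sup>2\<close> for \<open>u = b + a \<bullet> x\<close>
  and every affine \<open>w\<close>, and a suitable \<open>w\<close> forces \<open>u = 0\<close>
  (\<open>H1_zero_affine_identity\<close>, \<open>H1_zero_affine\<close>).

  The reconstruction, the boundary projection and the polynomial extension of a cell restriction
  are definite descriptions. Their existence and uniqueness, and hence their linearity, rest on
  two facts: a polynomial that vanishes on a set with interior points is zero
  (\<open>poly_space_identity\<close>), and the volume and facet measures charge every relatively open part of a
  cell or facet (\<open>full_support_on_lebesgue\<close>, \<open>full_support_on_face_measure\<close>).
\<close>

section \<open>Linear algebra in spaces of functions\<close>

text \<open>All spaces of the problem are spaces of functions, or of families of functions. With the pointwise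
  vector space structure the notions of subspace, span and linear map apply to them directly.\<close>

instantiation "fun" :: (type, real_vector) real_vector
begin
definition scaleR_fun_def: "c *\<^sub>R f = (\<lambda>x. c *\<^sub>R f x)"
instance
  by standard (simp_all add: scaleR_fun_def fun_eq_iff scaleR_add_right scaleR_add_left)
end

lemma scaleR_fun_apply [simp]: "(c *\<^sub>R f) x = c *\<^sub>R f x"
  by (simp add: scaleR_fun_def)

text \<open>Integrals and derivatives are additive only on the functions for which they exist, so linearity
  is relative to a set.\<close>

definition lin_on :: "'a::real_vector set \<Rightarrow> ('a \<Rightarrow> 'b::real_vector) \<Rightarrow> bool" where
  "lin_on X L \<longleftrightarrow> (\<forall>x\<in>X. \<forall>y\<in>X. L (x + y) = L x + L y) \<and> (\<forall>c. \<forall>x\<in>X. L (c *\<^sub>R x) = c *\<^sub>R L x)"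

lemma lin_onI:
  assumes "\<And>x y. x \<in> X \<Longrightarrow> y \<in> X \<Longrightarrow> L (x + y) = L x + L y"
    and "\<And>c x. x \<in> X \<Longrightarrow> L (c *\<^sub>R x) = c *\<^sub>R L x"
  shows "lin_on X L"
  using assms by (auto simp: lin_on_def)

lemma lin_on_add: "lin_on X L \<Longrightarrow> x \<in> X \<Longrightarrow> y \<in> X \<Longrightarrow> L (x + y) = L x + L y"
  by (simp add: lin_on_def)

lemma lin_on_scale: "lin_on X L \<Longrightarrow> x \<in> X \<Longrightarrow> L (c *\<^sub>R x) = c *\<^sub>R L x"
  by (simp add: lin_on_def)

lemma lin_on_zero: "lin_on X L \<Longrightarrow> x \<in> X \<Longrightarrow> L 0 = 0"
  using lin_on_scale[of X L x 0] by simp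

lemma lin_on_diff:
  assumes "lin_on X L" "subspace X" "x \<in> X" "y \<in> X"
  shows "L (x - y) = L x - L y"
proof -
  have "L (x + (-1) *\<^sub>R y) = L x + (-1) *\<^sub>R L y"
    using assms by (metis lin_on_add lin_on_scale subspace_scale)
  then show ?thesis by simp
qed

lemma lin_on_subset: "lin_on X L \<Longrightarrow> Y \<subseteq> X \<Longrightarrow> lin_on Y L"
  unfolding lin_on_def by blast

lemma lin_on_compose:
  assumes "lin_on X L" "lin_on Y M" "\<And>x. x \<in> X \<Longrightarrow> L x \<in> Y"
  shows "lin_on X (\<lambda>x. M (L x))"
  using assms by (auto simp: lin_on_def)

lemma lin_on_ops:
  "lin_on X L \<Longrightarrow> lin_on X M \<Longrightarrow> lin_on X (\<lambda>x. L x + M x)"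
  "lin_on X L \<Longrightarrow> lin_on X M \<Longrightarrow> lin_on X (\<lambda>x. L x - M x)"
  "lin_on X L \<Longrightarrow> lin_on X (\<lambda>x. c *\<^sub>R L x)"
  by (auto simp: lin_on_def algebra_simps)

lemma lin_on_sum: "(\<And>i. i \<in> I \<Longrightarrow> lin_on X (L i)) \<Longrightarrow> lin_on X (\<lambda>x. \<Sum>i\<in>I. L i x)"
  by (auto simp: lin_on_def sum.distrib scaleR_sum_right)

definition bilin_on :: "'a::real_vector set \<Rightarrow> ('a \<Rightarrow> 'a \<Rightarrow> real) \<Rightarrow> bool" where
  "bilin_on X B \<longleftrightarrow> (\<forall>x\<in>X. lin_on X (B x)) \<and> (\<forall>y\<in>X. lin_on X (\<lambda>x. B x y))"

lemma bilin_onI: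
  assumes "\<And>x. x \<in> X \<Longrightarrow> lin_on X (B x)" "\<And>y. y \<in> X \<Longrightarrow> lin_on X (\<lambda>x. B x y)"
  shows "bilin_on X B"
  using assms by (auto simp: bilin_on_def)

lemma bilin_onD:
  assumes "bilin_on X B" "x \<in> X"
  shows "lin_on X (B x)" "lin_on X (\<lambda>y. B y x)"
  using assms by (auto simp: bilin_on_def)

lemma bilin_on_compose:
  assumes "bilin_on Y B" "lin_on X L" "\<And>x. x \<in> X \<Longrightarrow> L x \<in> Y"
  shows "bilin_on X (\<lambda>x y. B (L x) (L y))"
  using assms unfolding bilin_on_def
  by (intro conjI ballI) (rule lin_on_compose[OF assms(2) _ assms(3)]; blast)+

lemma bilin_on_compose2:
  assumes "bilin_on Y B" "lin_on X L" "lin_on X M" "\<And>x. x \<in> X \<Longrightarrow> L x \<in> Y" "\<And>x. x \<in> X \<Longrightarrow> M x \<in> Y"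
  shows "bilin_on X (\<lambda>x y. B (L x) (M y))"
  by (rule bilin_onI)
    (rule lin_on_compose[OF assms(3) bilin_onD(1)[OF assms(1) assms(4)] assms(5)],
     assumption+, rule lin_on_compose[OF assms(2) bilin_onD(2)[OF assms(1) assms(5)] assms(4)], assumption+)

lemma bilin_on_subset: "bilin_on X B \<Longrightarrow> Y \<subseteq> X \<Longrightarrow> bilin_on Y B"
  unfolding bilin_on_def by (meson lin_on_subset subsetD)

lemma bilin_on_ops:
  "bilin_on X A \<Longrightarrow> bilin_on X B \<Longrightarrow> bilin_on X (\<lambda>x y. A x y + B x y)"
  "bilin_on X A \<Longrightarrow> bilin_on X B \<Longrightarrow> bilin_on X (\<lambda>x y. A x y - B x y)"
  "bilin_on X A \<Longrightarrow> bilin_on X (\<lambda>x y. c * A x y)"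
  by (auto simp: bilin_on_def lin_on_def algebra_simps)

lemma bilin_on_sum:
  "(\<And>i. i \<in> I \<Longrightarrow> bilin_on X (A i)) \<Longrightarrow> bilin_on X (\<lambda>x y. \<Sum>i\<in>I. A i x y)"
  unfolding bilin_on_def by (auto intro!: lin_on_sum)

text \<open>Induction on the spanning set. The solution for the old span is corrected along one new direction,
  taken left-orthogonal to that span; its coefficient solves a scalar equation. The hypothesis on
  null vectors covers both definite forms and semidefinite symmetric ones: if the new direction is
  a null vector, the right-hand side vanishes on it and no correction is required.\<close>

lemma lax_milgram_span:
  assumes X: "subspace X" and B: "bilin_on X B"
    and null: "\<And>x y. x \<in> X \<Longrightarrow> y \<in> X \<Longrightarrow> B x x = 0 \<Longrightarrow> B x y = 0 \<and> B y x = 0"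
    and S: "finite S" "S \<subseteq> X"
  shows "lin_on X L \<Longrightarrow> (\<And>x. x \<in> X \<Longrightarrow> B x x = 0 \<Longrightarrow> L x = 0) \<Longrightarrow>
    \<exists>r\<in>span S. \<forall>w\<in>span S. B r w = L w"
  using S
proof (induction S arbitrary: L)
  case empty
  have "0 \<in> X" using X by (rule subspace_0)
  then have "B 0 0 = 0" "L 0 = 0"
    using lin_on_zero[OF bilin_onD(1)[OF B]] lin_on_zero[OF empty(1)] by auto
  then show ?case by simp
next
  case (insert b S)
  have sX: "span S \<subseteq> X" using insert.prems X by (simp add: span_minimal)
  have bX: "b \<in> X" using insert.prems by simp
  obtain r0 where r0: "r0 \<in> span S" "\<And>w. w \<in> span S \<Longrightarrow> B r0 w = L w"
    using insert.IH[of L] insert.prems by blast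
  obtain p where p: "p \<in> span S" "\<And>w. w \<in> span S \<Longrightarrow> B p w = B b w"
    using insert.IH[of "B b"] insert.prems bilin_onD(1)[OF B bX] null bX by blast
  \<comment> \<open>Gram--Schmidt: the new direction is made left-orthogonal to the old span.\<close>
  define b' where "b' = b - p"
  have b'X: "b' \<in> X" using bX p(1) sX X by (auto simp: b'_def subspace_diff)
  have orth: "B b' w = 0" if "w \<in> span S" for w
    using lin_on_diff[OF bilin_onD(2)[OF B] X bX, of w p] p that sX by (auto simp: b'_def)
  have sub: "span S \<subseteq> span (insert b S)" by (simp add: span_mono subset_insertI)
  have b'S: "b' \<in> span (insert b S)"
    unfolding b'_def using p(1) sub by (blast intro: span_diff span_base)
  define t where "t = (L b' - B r0 b') / B b' b'"
  define r where "r = r0 + t *\<^sub>R b'"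
  have rX: "r0 \<in> X" "t *\<^sub>R b' \<in> X" "r \<in> X"
    using r0(1) sX b'X X by (auto simp: r_def subspace_add subspace_scale)
  have Br: "B r w = B r0 w + t * B b' w" if "w \<in> X" for w
    using lin_on_add[OF bilin_onD(2)[OF B that] rX(1,2)] lin_on_scale[OF bilin_onD(2)[OF B that] b'X]
    by (simp add: r_def)
  have 1: "B r w = L w" if "w \<in> span S" for w
    using Br[of w] r0(2) orth that sX by auto
  have 2: "B r b' = L b'"
  proof (cases "B b' b' = 0")
    case True
    then show ?thesis using null[OF b'X rX(3)] insert.prems(2)[OF b'X] by simp
  next
    case False
    then show ?thesis using Br[OF b'X] by (simp add: t_def)
  qed
  show ?case
  proof (intro bexI ballI)
    show "r \<in> span (insert b S)"
      using r0(1) sub b'S by (auto simp: r_def intro: span_add span_scale)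
    fix w assume "w \<in> span (insert b S)"
    then obtain c where c: "w - c *\<^sub>R b \<in> span S" by (auto simp: span_breakdown_eq)
    define s where "s = w - c *\<^sub>R b'"
    have s: "s \<in> span S"
    proof -
      have "s = (w - c *\<^sub>R b) + c *\<^sub>R p" by (simp add: s_def b'_def algebra_simps)
      then show ?thesis using c p(1) by (metis span_add span_scale)
    qed
    have w: "w = s + c *\<^sub>R b'" by (simp add: s_def)
    have sX': "s \<in> X" "c *\<^sub>R b' \<in> X" using s sX b'X X by (auto simp: subspace_scale)
    have "B r w = B r s + c * B r b'"
      using bilin_onD(1)[OF B rX(3)] sX' b'X by (simp add: w lin_on_add lin_on_scale)
    also have "\<dots> = L s + c * L b'" using 1[OF s] 2 by simp
    also have "\<dots> = L w"
      using insert.prems(1) sX' b'X by (simp add: w lin_on_add lin_on_scale)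
    finally show "B r w = L w" .
  qed
qed

definition fin_dim :: "'a::real_vector set \<Rightarrow> bool" where
  "fin_dim X \<longleftrightarrow> (\<exists>S. finite S \<and> X \<subseteq> span S)"

lemma fin_dimE:
  assumes "fin_dim X" "subspace X"
  obtains S where "finite S" "S \<subseteq> X" "span S = X"
proof -
  obtain T where T: "finite T" "X \<subseteq> span T" using assms by (auto simp: fin_dim_def)
  obtain S where S: "S \<subseteq> X" "independent S" "X \<subseteq> span S" by (rule basis_exists[of X])
  have "finite S" using independent_span_bound[OF T(1) S(2)] S(1) T(2) by blast
  moreover have "span S = X" using S assms(2) by (simp add: span_minimal subset_antisym)
  ultimately show thesis using that[of S] S(1) by simp
qed

lemma fin_dim_subset: "fin_dim Y \<Longrightarrow> X \<subseteq> Y \<Longrightarrow> fin_dim X"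
  by (auto simp: fin_dim_def)

lemma fin_dim_Times:
  assumes "fin_dim X" "fin_dim Y"
  shows "fin_dim (X \<times> Y)"
proof -
  obtain S T where S: "finite S" "X \<subseteq> span S" and T: "finite T" "Y \<subseteq> span T"
    using assms by (auto simp: fin_dim_def)
  let ?U = "(\<lambda>x. (x, 0)) ` S \<union> (\<lambda>y. (0, y)) ` T"
  have l: "linear (\<lambda>x::'a. (x, 0::'b))" "linear (\<lambda>y::'b. (0::'a, y))"
    by (auto intro!: linearI)
  have "(x, y) \<in> span ?U" if "x \<in> X" "y \<in> Y" for x y
  proof -
    have "(x, 0::'b) \<in> span ((\<lambda>x. (x, 0)) ` S)"
      unfolding span_linear_image[OF l(1)] using subsetD[OF S(2) that(1)] by (rule imageI)
    moreover have "(0::'a, y) \<in> span ((\<lambda>y. (0, y)) ` T)"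
      unfolding span_linear_image[OF l(2)] using subsetD[OF T(2) that(2)] by (rule imageI)
    ultimately have "(x, 0) \<in> span ?U" "(0, y) \<in> span ?U"
      by (meson span_mono Un_upper1 Un_upper2 subsetD)+
    then have "(x, 0) + (0, y) \<in> span ?U" by (rule span_add)
    then show ?thesis by simp
  qed
  then show ?thesis using S T unfolding fin_dim_def by (intro exI[of _ ?U]) auto
qed

lemma fin_dim_sum:
  assumes "finite I" "\<And>i. i \<in> I \<Longrightarrow> fin_dim (Y i)"
    and "\<And>x. x \<in> X \<Longrightarrow> \<exists>f. x = (\<Sum>i\<in>I. f i) \<and> (\<forall>i\<in>I. f i \<in> Y i)"
  shows "fin_dim X"
proof -
  obtain S where S: "\<And>i. i \<in> I \<Longrightarrow> finite (S i) \<and> Y i \<subseteq> span (S i)"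
    using assms(2) unfolding fin_dim_def by metis
  have "x \<in> span (\<Union>i\<in>I. S i)" if x: "x \<in> X" for x
  proof -
    obtain f where f: "x = (\<Sum>i\<in>I. f i)" "\<forall>i\<in>I. f i \<in> Y i" using assms(3)[OF x] by blast
    have "f i \<in> span (\<Union>i\<in>I. S i)" if "i \<in> I" for i
      using f(2) S[OF that] that span_mono[of "S i" "\<Union>i\<in>I. S i"] by (meson UN_upper subsetD)
    then show ?thesis unfolding f(1) by (rule span_sum)
  qed
  then show ?thesis unfolding fin_dim_def
    using assms(1) S by (intro exI[of _ "\<Union>i\<in>I. S i"]) auto
qed

lemma fin_dim_lin_image:
  assumes "fin_dim X" "linear L" "\<And>y. y \<in> Y \<Longrightarrow> \<exists>x\<in>X. y = L x"
  shows "fin_dim Y"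
proof -
  obtain S where S: "finite S" "X \<subseteq> span S" using assms by (auto simp: fin_dim_def)
  have "Y \<subseteq> span (L ` S)" using assms(3) S(2) by (auto simp: span_linear_image[OF assms(2)])
  then show ?thesis using S(1) by (auto simp: fin_dim_def)
qed

theorem finite_lax_milgram:
  assumes "subspace X" "fin_dim X" "bilin_on X B"
    and "\<And>x y. x \<in> X \<Longrightarrow> y \<in> X \<Longrightarrow> B x x = 0 \<Longrightarrow> B x y = 0 \<and> B y x = 0"
    and "lin_on X L" "\<And>x. x \<in> X \<Longrightarrow> B x x = 0 \<Longrightarrow> L x = 0"
  shows "\<exists>r\<in>X. \<forall>w\<in>X. B r w = L w"
proof -
  obtain S where S: "finite S" "S \<subseteq> X" "span S = X" using fin_dimE[OF assms(2,1)] .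
  have "\<exists>r\<in>span S. \<forall>w\<in>span S. B r w = L w"
  proof (rule lax_milgram_span[OF assms(1,3) _ S(1,2) assms(5)])
  qed (fact assms(4,6))+
  then show ?thesis unfolding S(3) .
qed

text \<open>The quadratic polynomial \<open>t \<mapsto> B (t x + y, t x + y)\<close> is affine in \<open>t\<close> when
  \<open>B (x, x) = 0\<close>, and being nonnegative it has slope zero.\<close>

lemma semidef_null:
  assumes X: "subspace X" and B: "bilin_on X B"
    and sym: "\<And>x y. x \<in> X \<Longrightarrow> y \<in> X \<Longrightarrow> B x y = B y x"
    and pos: "\<And>x. x \<in> X \<Longrightarrow> B x x \<ge> 0"
    and x: "x \<in> X" "y \<in> X" "B x x = 0"
  shows "B x y = 0 \<and> B y x = 0"
proof -
  have *: "B (t *\<^sub>R x + y) (t *\<^sub>R x + y) = 2 * t * B x y + B y y" for t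
  proof -
    have z: "t *\<^sub>R x \<in> X" using X x by (simp add: subspace_scale)
    then have zy: "t *\<^sub>R x + y \<in> X" using X x by (simp add: subspace_add)
    have "B (t *\<^sub>R x + y) (t *\<^sub>R x + y) = t * B (t *\<^sub>R x + y) x + B (t *\<^sub>R x + y) y"
      using bilin_onD(1)[OF B zy] z x by (simp add: lin_on_add lin_on_scale)
    moreover have "B (t *\<^sub>R x + y) x = t * B x x + B y x" "B (t *\<^sub>R x + y) y = t * B x y + B y y"
      using lin_on_add[OF bilin_onD(2)[OF B x(1)] z x(2)] lin_on_add[OF bilin_onD(2)[OF B x(2)] z x(2)]
        lin_on_scale[OF bilin_onD(2)[OF B x(1)] x(1)] lin_on_scale[OF bilin_onD(2)[OF B x(2)] x(1)]
      by simp_all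
    ultimately show ?thesis using x sym by (simp add: algebra_simps)
  qed
  have "B x y = 0"
  proof (rule ccontr)
    assume ne: "B x y \<noteq> 0"
    \<comment> \<open>The quadratic form takes the value \<open>-1\<close> at \<open>t x + y\<close>.\<close>
    define t where "t = - (B y y + 1) / (2 * B x y)"
    have "2 * t * B x y + B y y = -1" using ne by (simp add: t_def field_simps)
    moreover have "t *\<^sub>R x + y \<in> X" using X x by (simp add: subspace_add subspace_scale)
    ultimately show False using pos *[of t] by force
  qed
  then show ?thesis using sym x by auto
qed

lemma semidef_cauchy_schwarz:
  assumes X: "subspace X" and B: "bilin_on X B"
    and sym: "\<And>x y. x \<in> X \<Longrightarrow> y \<in> X \<Longrightarrow> B x y = B y x"
    and pos: "\<And>x. x \<in> X \<Longrightarrow> B x x \<ge> 0"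
    and xy: "x \<in> X" "y \<in> X"
  shows "(B x y)\<^sup>2 \<le> B x x * B y y"
proof (cases "B y y = 0")
  case True
  then show ?thesis using semidef_null[OF X B sym pos xy(2,1)] by simp
next
  case False
  define z where "z = B y y *\<^sub>R x - B x y *\<^sub>R y"
  have m: "B y y *\<^sub>R x \<in> X" "B x y *\<^sub>R y \<in> X" using X xy by (simp_all add: subspace_scale)
  then have z: "z \<in> X" using X by (simp add: z_def subspace_diff)
  have l: "B z w = B y y * B x w - B x y * B y w" if "w \<in> X" for w
    unfolding z_def using lin_on_diff[OF bilin_onD(2)[OF B that] X m]
      lin_on_scale[OF bilin_onD(2)[OF B that] xy(1)] lin_on_scale[OF bilin_onD(2)[OF B that] xy(2)] by simp
  have "B z z = B z (B y y *\<^sub>R x) - B z (B x y *\<^sub>R y)"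
    using lin_on_diff[OF bilin_onD(1)[OF B z] X m] by (simp add: z_def)
  also have "\<dots> = B y y * B z x - B x y * B z y"
    using bilin_onD(1)[OF B z] xy by (simp add: lin_on_scale)
  also have "\<dots> = B y y * (B x x * B y y - (B x y)\<^sup>2)"
    by (simp add: l[OF xy(1)] l[OF xy(2)] sym[OF xy(2,1)] power2_eq_square algebra_simps)
  finally have "0 \<le> B y y * (B x x * B y y - (B x y)\<^sup>2)" using pos[OF z] by simp
  moreover have "B y y > 0" using pos[OF xy(2)] False by simp
  ultimately show ?thesis by (simp add: zero_le_mult_iff)
qed

section \<open>Polynomial functions\<close>

lemma sum_fun_apply: "(\<Sum>i\<in>I. f i) x = (\<Sum>i\<in>I. f i x)"
  by (induction I rule: infinite_finite_induct) auto

definition mono_fun :: "('d::finite \<Rightarrow> nat) \<Rightarrow> real^'d \<Rightarrow> real" where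
  "mono_fun \<alpha> x = (\<Prod>i\<in>UNIV. (x $ i) ^ \<alpha> i)"

lemma finite_multi_indices: "finite {\<alpha>::'d::finite \<Rightarrow> nat. (\<Sum>i\<in>UNIV. \<alpha> i) \<le> l}"
proof (rule finite_subset)
  show "{\<alpha>::'d \<Rightarrow> nat. (\<Sum>i\<in>UNIV. \<alpha> i) \<le> l} \<subseteq> (UNIV \<rightarrow>\<^sub>E {..l})"
  proof
    fix \<alpha> :: "'d \<Rightarrow> nat" assume "\<alpha> \<in> {\<alpha>. (\<Sum>i\<in>UNIV. \<alpha> i) \<le> l}"
    then have "\<alpha> i \<le> l" for i using member_le_sum[of i UNIV \<alpha>] by simp
    then show "\<alpha> \<in> UNIV \<rightarrow>\<^sub>E {..l}" by auto
  qed
  show "finite (UNIV \<rightarrow>\<^sub>E {..l} :: ('d \<Rightarrow> nat) set)" by (intro finite_PiE) simp_all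
qed

lemma poly_space_eq_span: "poly_space l = span (mono_fun ` {\<alpha>. (\<Sum>i\<in>UNIV. \<alpha> i) \<le> l})"
proof (intro equalityI subsetI)
  fix p :: "real^'d \<Rightarrow> real" assume "p \<in> poly_space l"
  then obtain c where c: "\<And>x. p x = (\<Sum>\<alpha> | (\<Sum>i\<in>UNIV. \<alpha> i) \<le> l. c \<alpha> * (\<Prod>i\<in>UNIV. (x $ i) ^ \<alpha> i))"
    unfolding poly_space_def by blast
  have "p = (\<Sum>\<alpha> | (\<Sum>i\<in>UNIV. \<alpha> i) \<le> l. c \<alpha> *\<^sub>R mono_fun \<alpha>)"
    by (simp add: fun_eq_iff c sum_fun_apply mono_fun_def)
  also have "\<dots> \<in> span (mono_fun ` {\<alpha>. (\<Sum>i\<in>UNIV. \<alpha> i) \<le> l})"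
    by (intro span_sum span_scale span_base) auto
  finally show "p \<in> span (mono_fun ` {\<alpha>. (\<Sum>i\<in>UNIV. \<alpha> i) \<le> l})" .
next
  fix p :: "real^'d \<Rightarrow> real" assume p: "p \<in> span (mono_fun ` {\<alpha>. (\<Sum>i\<in>UNIV. \<alpha> i) \<le> l})"
  then show "p \<in> poly_space l"
  proof (induction rule: span_induct_alt)
    case base
    show ?case unfolding poly_space_def by (auto intro!: exI[of _ "\<lambda>_. 0"])
  next
    case (step a m q)
    obtain \<beta> where \<beta>: "m = mono_fun \<beta>" "(\<Sum>i\<in>UNIV. \<beta> i) \<le> l" using step by auto
    obtain c where c: "\<And>x. q x = (\<Sum>\<alpha> | (\<Sum>i\<in>UNIV. \<alpha> i) \<le> l. c \<alpha> * (\<Prod>i\<in>UNIV. (x $ i) ^ \<alpha> i))"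
      using step unfolding poly_space_def by blast
    have "(a *\<^sub>R m + q) x = (\<Sum>\<alpha> | (\<Sum>i\<in>UNIV. \<alpha> i) \<le> l.
        ((if \<alpha> = \<beta> then a else 0) + c \<alpha>) * (\<Prod>i\<in>UNIV. (x $ i) ^ \<alpha> i))" for x
      using \<beta> finite_multi_indices[where 'd='d, of l]
      by (simp add: c mono_fun_def distrib_right sum.distrib if_distrib[of "\<lambda>t. t * _"] sum.delta
          cong: if_cong)
    then show ?case unfolding poly_space_def mem_Collect_eq by (intro exI allI)
  qed
qed

lemma subspace_poly_space: "subspace (poly_space l)"
  by (simp add: poly_space_eq_span)

lemma fin_dim_poly_space: "fin_dim (poly_space l)"
  unfolding fin_dim_def poly_space_eq_span
  by (rule exI[of _ "mono_fun ` {\<alpha>. (\<Sum>i\<in>UNIV. \<alpha> i) \<le> l}"]) (simp add: finite_multi_indices)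

lemma mono_fun_in_poly_space: "(\<Sum>i\<in>UNIV. \<alpha> i) \<le> l \<Longrightarrow> mono_fun \<alpha> \<in> poly_space l"
  unfolding poly_space_eq_span by (intro span_base) auto

lemma poly_space_mono: "l \<le> l' \<Longrightarrow> poly_space l \<subseteq> poly_space l'"
  unfolding poly_space_eq_span by (intro span_mono) auto

lemma affine_in_poly_space:
  assumes "l \<ge> 1"
  shows "(\<lambda>x::real^'d::finite. b + g \<bullet> x) \<in> poly_space l"
proof -
  have 1: "(\<lambda>x::real^'d. x $ j) = mono_fun (\<lambda>i. if i = j then 1 else 0)" for j
    by (simp add: fun_eq_iff mono_fun_def if_distrib[of "\<lambda>n. _ ^ n"] prod.delta cong: if_cong)
  have 2: "(\<lambda>x::real^'d. 1) = mono_fun (\<lambda>i. 0)" by (simp add: fun_eq_iff mono_fun_def)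
  have "(\<lambda>x::real^'d. x $ j) \<in> poly_space l" for j
    unfolding 1 by (rule mono_fun_in_poly_space) (use assms in simp)
  moreover have "(\<lambda>x::real^'d. 1) \<in> poly_space l"
    unfolding 2 by (rule mono_fun_in_poly_space) simp
  ultimately have "b *\<^sub>R (\<lambda>x::real^'d. 1) + (\<Sum>j\<in>UNIV. (g $ j) *\<^sub>R (\<lambda>x::real^'d. x $ j)) \<in> poly_space l"
    by (intro subspace_add[OF subspace_poly_space] subspace_sum[OF subspace_poly_space]
        subspace_scale[OF subspace_poly_space])
  also have "b *\<^sub>R (\<lambda>x::real^'d. 1) + (\<Sum>j\<in>UNIV. (g $ j) *\<^sub>R (\<lambda>x::real^'d. x $ j)) = (\<lambda>x. b + g \<bullet> x)"
    by (simp add: fun_eq_iff sum_fun_apply inner_vec_def)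
  finally show ?thesis .
qed

lemma poly_space_real_polynomial_function:
  assumes "p \<in> poly_space l"
  shows "real_polynomial_function p"
proof -
  obtain c where "p = (\<lambda>x. \<Sum>\<alpha> | (\<Sum>i\<in>UNIV. \<alpha> i) \<le> l. c \<alpha> * (\<Prod>i\<in>UNIV. (x $ i) ^ \<alpha> i))"
    using assms unfolding poly_space_def by blast
  moreover have "real_polynomial_function (\<lambda>x::real^'a. x $ i)" for i
    by (rule real_polynomial_function.intros(1)[OF bounded_linear_vec_nth])
  ultimately show ?thesis
    by (auto intro!: real_polynomial_function_sum real_polynomial_function_prod
        real_polynomial_function_power real_polynomial_function.intros(4) finite_multi_indices
        real_polynomial_function.intros(2))
qed

lemma poly_space_differentiable: "p \<in> poly_space l \<Longrightarrow> p differentiable (at x within S)"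
  by (rule differentiable_at_real_polynomial_function[OF poly_space_real_polynomial_function])

lemma poly_space_continuous_on: "p \<in> poly_space l \<Longrightarrow> continuous_on S p"
  by (meson poly_space_differentiable differentiable_imp_continuous_on differentiable_on_def)

text \<open>On every line a polynomial function is a univariate polynomial, which has finitely many
  zeros unless it vanishes.\<close>

lemma poly_space_identity:
  assumes p: "p \<in> poly_space l" and zero: "\<And>x. x \<in> S \<Longrightarrow> p x = 0" and int: "interior S \<noteq> {}"
  shows "p = 0"
proof
  fix y :: "real^'a"
  obtain c where c: "\<And>x. p x = (\<Sum>\<alpha> | (\<Sum>i\<in>UNIV. \<alpha> i) \<le> l. c \<alpha> * (\<Prod>i\<in>UNIV. (x $ i) ^ \<alpha> i))"
    using p unfolding poly_space_def by blast
  obtain x0 e where e: "e > 0" "ball x0 e \<subseteq> S" using int by (metis all_not_in_conv mem_interior)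
  define w where "w = y - x0"
  \<comment> \<open>The restriction of \<open>p\<close> to the line through \<open>x0\<close> and \<open>y\<close>.\<close>
  define q where "q = (\<Sum>\<alpha> | (\<Sum>i\<in>UNIV. \<alpha> i) \<le> l. Polynomial.smult (c \<alpha>) (\<Prod>i\<in>UNIV. [:x0 $ i, w $ i:] ^ \<alpha> i))"
  have q: "poly q t = p (x0 + t *\<^sub>R w)" for t
    by (simp add: q_def c poly_sum poly_prod)
  have "q = 0"
  proof (rule ccontr)
    assume "q \<noteq> 0"
    then have fin: "finite {t. poly q t = 0}" by (rule poly_roots_finite)
    have "poly q t = 0" if "t \<in> {0<..<e / (norm w + 1)}" for t
    proof -
      have "t * norm w \<le> t * (norm w + 1)" using that by (simp add: mult_left_mono)
      also have "\<dots> < e" using that by (simp add: pos_less_divide_eq add_nonneg_pos)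
      finally have "x0 + t *\<^sub>R w \<in> ball x0 e" using that by (simp add: dist_norm)
      then show ?thesis using e zero by (auto simp: q)
    qed
    then have "{0<..<e / (norm w + 1)} \<subseteq> {t. poly q t = 0}" by blast
    moreover have "infinite {0<..<e / (norm w + 1)}"
      using e by (intro infinite_Ioo) (simp add: add_nonneg_pos)
    ultimately show False using fin finite_subset by blast
  qed
  then show "p y = 0 y" using q[of 1] by (simp add: w_def)
qed

lemma poly_space_eqI:
  assumes "p \<in> poly_space l" "q \<in> poly_space l" "\<And>x. x \<in> S \<Longrightarrow> p x = q x" "interior S \<noteq> {}"
  shows "p = q"
proof -
  have "p - q = 0"
    using assms by (intro poly_space_identity[where S=S and l=l]) (auto simp: subspace_diff[OF subspace_poly_space])
  then show ?thesis by simp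
qed

lemma part_deriv_eq: "(f has_derivative f') (at x) \<Longrightarrow> part_deriv i f x = f' (axis i 1)"
  by (simp add: part_deriv_def frechet_derivative_at[symmetric])

lemma part_deriv_add:
  "f differentiable (at x) \<Longrightarrow> g differentiable (at x) \<Longrightarrow>
    part_deriv i (f + g) x = part_deriv i f x + part_deriv i g x"
  unfolding plus_fun_def
  by (subst part_deriv_eq[OF has_derivative_add]) (auto simp: frechet_derivative_works part_deriv_def)

lemma part_deriv_scale:
  "f differentiable (at x) \<Longrightarrow> part_deriv i (c *\<^sub>R f) x = c * part_deriv i f x"
  unfolding scaleR_fun_def
  by (subst part_deriv_eq[OF has_derivative_scaleR_right]) (auto simp: frechet_derivative_works part_deriv_def)

lemma part_deriv_mult:
  "f differentiable (at x) \<Longrightarrow> g differentiable (at x) \<Longrightarrow>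
    part_deriv i (\<lambda>x. f x * g x) x = part_deriv i f x * g x + f x * part_deriv i g x"
  by (subst part_deriv_eq[OF has_derivative_mult]) (auto simp: frechet_derivative_works part_deriv_def)

lemma part_deriv_affine: "part_deriv i (\<lambda>x. b + g \<bullet> x) x = g $ i"
proof -
  have "((\<lambda>x. b + g \<bullet> x) has_derivative (\<lambda>h. g \<bullet> h)) (at x)"
    by (auto intro!: derivative_eq_intros)
  then show ?thesis by (simp add: part_deriv_eq inner_axis)
qed

lemma grad_affine: "grad (\<lambda>x. b + g \<bullet> x) x = g"
  by (simp add: grad_def part_deriv_affine vec_eq_iff)

lemma frechet_derivative_eq_grad:
  assumes "f differentiable (at x)"
  shows "(f has_derivative (\<lambda>h. grad f x \<bullet> h)) (at x)"
proof -
  let ?D = "frechet_derivative f (at x)"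
  have D: "(f has_derivative ?D) (at x)" using assms frechet_derivative_works by blast
  have lin: "linear ?D" using D has_derivative_linear by blast
  have "?D h = grad f x \<bullet> h" for h
  proof -
    have "?D h = ?D (\<Sum>i\<in>UNIV. (h $ i) *\<^sub>R axis i 1)"
      using basis_expansion[of h] by (simp add: scalar_mult_eq_scaleR)
    also have "\<dots> = (\<Sum>i\<in>UNIV. (h $ i) * ?D (axis i 1))"
      by (simp add: linear_sum[OF lin] linear_scale[OF lin])
    finally show ?thesis by (simp add: grad_def inner_vec_def part_deriv_def mult.commute)
  qed
  then have "?D = (\<lambda>h. grad f x \<bullet> h)" by blast
  then show ?thesis using D by simp
qed

lemma part_deriv_mono_fun:
  "part_deriv j (mono_fun \<alpha>) = real (\<alpha> j) *\<^sub>R mono_fun (\<alpha>(j := \<alpha> j - 1))"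
proof
  fix x :: "real^'a"
  have "((\<lambda>x. \<Prod>i\<in>UNIV. (x $ i) ^ \<alpha> i) has_derivative
     (\<lambda>y. \<Sum>i\<in>UNIV. (of_nat (\<alpha> i) * (y $ i) * (x $ i) ^ (\<alpha> i - 1)) * (\<Prod>j\<in>UNIV - {i}. (x $ j) ^ \<alpha> j))) (at x)"
    by (intro has_derivative_prod has_derivative_power bounded_linear_imp_has_derivative
        bounded_linear_vec_nth)
  then have "part_deriv j (\<lambda>x. \<Prod>i\<in>UNIV. (x $ i) ^ \<alpha> i) x = 
     (\<Sum>i\<in>UNIV. (of_nat (\<alpha> i) * (axis j 1 $ i) * (x $ i) ^ (\<alpha> i - 1)) * (\<Prod>j\<in>UNIV - {i}. (x $ j) ^ \<alpha> j))"
    by (rule part_deriv_eq)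
  also have "\<dots> = (\<Sum>i\<in>UNIV. if i = j then of_nat (\<alpha> j) * (x $ j) ^ (\<alpha> j - 1) * (\<Prod>i\<in>UNIV - {j}. (x $ i) ^ \<alpha> i) else 0)"
    by (intro sum.cong) (auto simp: axis_def)
  also have "\<dots> = of_nat (\<alpha> j) * ((x $ j) ^ (\<alpha> j - 1) * (\<Prod>i\<in>UNIV - {j}. (x $ i) ^ \<alpha> i))"
    by simp
  also have "(x $ j) ^ (\<alpha> j - 1) * (\<Prod>i\<in>UNIV - {j}. (x $ i) ^ \<alpha> i) = mono_fun (\<alpha>(j := \<alpha> j - 1)) x"
    unfolding mono_fun_def by (subst prod.remove[of UNIV j]) (auto intro!: prod.cong)
  finally show "part_deriv j (mono_fun \<alpha>) x = (real (\<alpha> j) *\<^sub>R mono_fun (\<alpha>(j := \<alpha> j - 1))) x"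
    by (simp add: mono_fun_def[abs_def])
qed

lemma lin_on_part_deriv: "lin_on (poly_space l) (part_deriv i)"
  by (rule lin_onI) (auto simp: fun_eq_iff part_deriv_add part_deriv_scale poly_space_differentiable)

lemma part_deriv_poly_space:
  assumes "p \<in> poly_space l"
  shows "part_deriv i p \<in> poly_space (l - 1)"
proof -
  let ?D = "{p \<in> poly_space l. part_deriv i p \<in> poly_space (l - 1)}"
  note sub = subspace_poly_space[where 'a='a]
  have "subspace ?D"
  proof (rule subspaceI)
    show "0 \<in> ?D"
      using lin_on_zero[OF lin_on_part_deriv[of l i] subspace_0[OF sub]]
      by (simp add: subspace_0[OF sub])
  next
    fix p q assume "p \<in> ?D" "q \<in> ?D"
    then show "p + q \<in> ?D"
      by (simp add: subspace_add[OF sub] lin_on_add[OF lin_on_part_deriv[of l i]])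
  next
    fix c p assume "p \<in> ?D"
    then show "c *\<^sub>R p \<in> ?D"
      by (simp add: subspace_scale[OF sub] lin_on_scale[OF lin_on_part_deriv[of l i]])
  qed
  moreover have "mono_fun \<alpha> \<in> ?D" if \<alpha>: "(\<Sum>i\<in>UNIV. \<alpha> i) \<le> l" for \<alpha>
  proof (cases "\<alpha> i = 0")
    case True
    then show ?thesis using \<alpha>
      by (simp add: part_deriv_mono_fun subspace_0[OF sub] mono_fun_in_poly_space)
  next
    case False
    have "(\<Sum>j\<in>UNIV. (\<alpha>(i := \<alpha> i - 1)) j) = (\<Sum>j\<in>UNIV. \<alpha> j) - 1"
      using False by (simp add: sum.remove[of UNIV i])
    then show ?thesis using \<alpha>
      by (auto simp: part_deriv_mono_fun intro!: subspace_scale[OF sub] mono_fun_in_poly_space)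
  qed
  ultimately have "span (mono_fun ` {\<alpha>. (\<Sum>i\<in>UNIV. \<alpha> i) \<le> l}) \<subseteq> ?D"
    by (intro span_minimal) auto
  then show ?thesis using assms unfolding poly_space_eq_span[symmetric] by blast
qed

lemma part_deriv2_poly_space:
  "p \<in> poly_space (k + 2) \<Longrightarrow> part_deriv i (part_deriv j p) \<in> poly_space k"
  using part_deriv_poly_space[of "part_deriv j p" "k + 1" i] part_deriv_poly_space[of p "k + 2" j]
  by simp

lemma lin_on_grad: "lin_on (poly_space l) grad"
  by (rule lin_onI) (auto simp: fun_eq_iff grad_def vec_eq_iff part_deriv_add part_deriv_scale poly_space_differentiable)

lemma lin_on_hess: "lin_on (poly_space l) hess"
proof (rule lin_onI)
  fix p q :: "real^'a \<Rightarrow> real" and c assume p: "p \<in> poly_space l" 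
  have *: "part_deriv j p differentiable (at x)" if "p \<in> poly_space l" for j x and p :: "real^'a \<Rightarrow> real"
    using part_deriv_poly_space[OF that] by (rule poly_space_differentiable)
  show "hess (c *\<^sub>R p) = c *\<^sub>R hess p"
    using p * by (simp add: fun_eq_iff hess_def vec_eq_iff lin_on_scale[OF lin_on_part_deriv] part_deriv_scale)
  assume "q \<in> poly_space l"
  then show "hess (p + q) = hess p + hess q"
    using p * by (simp add: fun_eq_iff hess_def vec_eq_iff lin_on_add[OF lin_on_part_deriv] part_deriv_add)
qed

lemma grad_continuous_on: "p \<in> poly_space l \<Longrightarrow> continuous_on S (grad p)"
  unfolding grad_def[abs_def]
  by (intro continuous_on_vec_lambda poly_space_continuous_on[OF part_deriv_poly_space])

lemma hess_continuous_on: "p \<in> poly_space l \<Longrightarrow> continuous_on S (hess p)"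
  unfolding hess_def[abs_def]
  by (intro continuous_on_vec_lambda
      poly_space_continuous_on[OF part_deriv_poly_space[OF part_deriv_poly_space]])

lemma grad_zero_imp_const:
  fixes f :: "real^'d::finite \<Rightarrow> real"
  assumes "convex S" "\<And>x. x \<in> S \<Longrightarrow> f differentiable (at x)" "\<And>x. x \<in> S \<Longrightarrow> grad f x = 0"
  shows "\<exists>c. \<forall>x\<in>S. f x = c"
proof (rule has_derivative_zero_constant[OF assms(1)])
  fix x assume "x \<in> S"
  then have "(f has_derivative (\<lambda>h. 0)) (at x)"
    using frechet_derivative_eq_grad[OF assms(2)] assms(3) by simp
  then show "(f has_derivative (\<lambda>h. 0)) (at x within S)" by (rule has_derivative_at_withinI)
qed

text \<open>A polynomial identity on \<open>T\<close> holds everywhere, so all second derivatives vanish on the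
  whole space; the first ones are then constant, and subtracting the linear part leaves a constant.\<close>

lemma hess_zero_imp_affine:
  assumes p: "p \<in> poly_space l" and T: "interior T \<noteq> {}"
    and zero: "\<And>x. x \<in> T \<Longrightarrow> hess p x = 0"
  obtains b g where "p = (\<lambda>x. b + g \<bullet> x)"
proof -
  have z: "part_deriv i (part_deriv j p) = 0" for i j
    by (rule poly_space_identity[OF part_deriv_poly_space[OF part_deriv_poly_space[OF p]] _ T])
      (use zero in \<open>simp add: hess_def vec_eq_iff\<close>)
  have "\<exists>c. \<forall>x\<in>UNIV. part_deriv j p x = c" for j
    by (rule grad_zero_imp_const)
      (use z in \<open>auto simp: grad_def vec_eq_iff intro!: poly_space_differentiable part_deriv_poly_space[OF p]\<close>)
  then obtain c where c: "\<And>j x. part_deriv j p x = c j" by (metis UNIV_I)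
  define g :: "real^'a" where "g = (\<chi> j. c j)"
  let ?q = "(\<lambda>x. 0 + (- g) \<bullet> x)"
  have d: "?q differentiable (at x)" for x
    by (rule poly_space_differentiable[OF affine_in_poly_space[OF order_refl]])
  have "\<exists>b. \<forall>x\<in>UNIV. (p + ?q) x = b"
  proof (rule grad_zero_imp_const)
    fix x
    show "(p + ?q) differentiable (at x)"
      unfolding plus_fun_def by (intro differentiable_add poly_space_differentiable[OF p] d)
    show "grad (p + ?q) x = 0"
      using part_deriv_add[OF poly_space_differentiable[OF p] d] part_deriv_affine[where b=0 and g="-g"]
      by (simp add: grad_def vec_eq_iff c g_def)
  qed simp
  then obtain b where "\<And>x. p x - g \<bullet> x = b" by auto
  then have "p = (\<lambda>x. b + g \<bullet> x)" by (metis add.commute diff_add_cancel)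
  then show thesis by (rule that)
qed

section \<open>Inner products on compact sets\<close>

text \<open>The two properties of a measure that make the square integral of a continuous function on
  \<open>K\<close> a definite quadratic form. They hold for the volume on a cell and for the surface
  measure on a facet, which allows both to be treated alike.\<close>

definition full_support_on :: "('a::euclidean_space) measure \<Rightarrow> 'a set \<Rightarrow> bool" where
  "full_support_on M K \<longleftrightarrow> space M = UNIV \<and> sets borel \<subseteq> sets M \<and> compact K \<and> emeasure M K < \<infinity> \<and>
     (\<forall>x\<in>K. \<forall>r>0. emeasure M (K \<inter> ball x r) > 0)"

lemma full_support_on_integrable:
  fixes f :: "'a::euclidean_space \<Rightarrow> 'b::euclidean_space"
  assumes M: "full_support_on M K" and f: "continuous_on K f"
  shows "set_integrable M K f"
proof -
  have K: "compact K" "K \<in> sets borel" using M by (auto simp: full_support_on_def intro: borel_compact)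
  have "(\<lambda>x. indicator K x *\<^sub>R f x) \<in> borel_measurable borel"
    using K f by (intro borel_measurable_continuous_on_indicator) auto
  then have meas: "(\<lambda>x. indicator K x *\<^sub>R f x) \<in> borel_measurable M"
    using M unfolding measurable_def full_support_on_def by auto
  have "bounded (f ` K)" using K f by (simp add: compact_imp_bounded compact_continuous_image)
  then obtain B where B: "\<And>x. x \<in> K \<Longrightarrow> norm (f x) \<le> B" unfolding bounded_iff by blast
  have "K \<in> sets M" "emeasure M K < \<infinity>" using M K by (auto simp: full_support_on_def)
  then show ?thesis unfolding set_integrable_def
    using meas B by (intro integrableI_bounded_set[of K _ _ B]) auto
qed

lemma full_support_on_nonneg_zero:
  fixes f :: "'a::euclidean_space \<Rightarrow> real"
  assumes M: "full_support_on M K" and f: "continuous_on K f" "\<And>x. x \<in> K \<Longrightarrow> f x \<ge> 0"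
    and zero: "(LINT x:K|M. f x) = 0" and x: "x \<in> K"
  shows "f x = 0"
proof (rule ccontr)
  assume "f x \<noteq> 0"
  then have "f x > 0" using f(2)[OF x] by simp
  have "integrable M (\<lambda>x. indicator K x *\<^sub>R f x)"
    using full_support_on_integrable[OF M f(1)] by (simp add: set_integrable_def)
  then have AE: "AE x in M. indicator K x *\<^sub>R f x = 0"
    using zero f(2) unfolding set_lebesgue_integral_def
    by (subst (asm) integral_nonneg_eq_0_iff_AE) (auto simp: indicator_def)
  have "\<exists>r>0. \<forall>y\<in>K. dist y x < r \<longrightarrow> dist (f y) (f x) < f x"
    using f(1)[unfolded continuous_on_iff] x \<open>f x > 0\<close> by simp
  then obtain r where r: "r > 0" "\<And>y. y \<in> K \<Longrightarrow> dist y x < r \<Longrightarrow> dist (f y) (f x) < f x"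
    by blast
  have pos: "f y > 0" if "y \<in> K" "dist y x < r" for y
    using r(2)[OF that] by (auto simp: dist_real_def)
  have "K \<in> sets borel" using M by (simp add: full_support_on_def borel_compact)
  then have "K \<inter> ball x r \<in> sets borel" by simp
  then have s: "K \<inter> ball x r \<in> sets M" using M by (auto simp: full_support_on_def)
  have "AE y in M. y \<notin> K \<inter> ball x r"
    using AE
  proof eventually_elim
    case (elim y)
    then show ?case using pos[of y] by (auto simp: dist_commute indicator_def)
  qed
  then have "emeasure M (K \<inter> ball x r) = 0"
    using s M by (subst (asm) AE_iff_measurable[OF s]) (auto simp: full_support_on_def)
  then show False using M x r(1) unfolding full_support_on_def by force
qed

definition L2_ip :: "'a measure \<Rightarrow> 'a set \<Rightarrow> ('a \<Rightarrow> 'b::euclidean_space) \<Rightarrow> ('a \<Rightarrow> 'b) \<Rightarrow> real" where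
  "L2_ip M K f g = (LINT x:K|M. f x \<bullet> g x)"

lemma L2_inner_eq_ip: "L2_inner T f g = L2_ip lebesgue T f g"
  by (simp add: L2_inner_def L2_ip_def)

lemma L2_ip_sym: "L2_ip M K f g = L2_ip M K g f"
  by (simp add: L2_ip_def inner_commute)

lemma L2_ip_cong:
  "(\<And>x. x \<in> K \<Longrightarrow> f x = f' x) \<Longrightarrow> (\<And>x. x \<in> K \<Longrightarrow> g x = g' x) \<Longrightarrow> L2_ip M K f g = L2_ip M K f' g'"
  unfolding L2_ip_def set_lebesgue_integral_def
  by (intro Bochner_Integration.integral_cong) (auto simp: indicator_def)

lemma L2_ip_nonneg: "L2_ip M K f f \<ge> 0"
  unfolding L2_ip_def set_lebesgue_integral_def by (intro integral_nonneg_AE) (auto simp: indicator_def)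

lemma bilin_on_L2_ip:
  assumes "\<And>f g. f \<in> X \<Longrightarrow> g \<in> X \<Longrightarrow> set_integrable M K (\<lambda>x. f x \<bullet> g x)"
  shows "bilin_on X (L2_ip M K)"
proof -
  have *: "lin_on X (L2_ip M K f)" if "f \<in> X" for f
    using assms[OF that] by (intro lin_onI) (simp_all add: L2_ip_def inner_add_right set_integral_add)
  moreover have "lin_on X (\<lambda>f. L2_ip M K f g)" if "g \<in> X" for g
    using *[OF that] by (simp add: L2_ip_sym[of M K _ g])
  ultimately show ?thesis by (rule bilin_onI)
qed

lemma bilin_on_L2_ip_continuous:
  assumes "full_support_on M K"
  shows "bilin_on {f. continuous_on K f} (L2_ip M K)"
  by (rule bilin_on_L2_ip) (auto intro!: full_support_on_integrable[OF assms] continuous_intros)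

lemma L2_ip_zero:
  assumes "full_support_on M K" "continuous_on K f" "L2_ip M K f f = 0" "x \<in> K"
  shows "f x = 0"
  using full_support_on_nonneg_zero[OF assms(1), of "\<lambda>x. f x \<bullet> f x" x] assms
  by (auto simp: L2_ip_def intro!: continuous_intros)

lemma emeasure_lborel_open_pos:
  assumes "open U" "U \<noteq> {}"
  shows "emeasure lborel U > 0"
proof (rule ccontr)
  assume "\<not> emeasure lborel U > 0"
  then have "U \<in> null_sets lborel" using assms by (auto simp: null_sets_def)
  then have "negligible U" by (simp add: negligible_iff_null_sets null_sets_completionI)
  then show False using assms open_not_negligible by blast
qed

lemma full_support_on_lebesgue:
  fixes T :: "'a::euclidean_space set"
  assumes "compact T" "convex T" "interior T \<noteq> {}"
  shows "full_support_on lebesgue T"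
proof -
  have T: "T \<in> sets borel" using assms by (simp add: borel_compact)
  have "emeasure lebesgue (T \<inter> ball x r) > 0" if x: "x \<in> T" "r > 0" for x r
  proof -
    have "x \<in> closure (interior T)"
      using x assms by (simp add: convex_closure_interior compact_imp_closed)
    then obtain y where y: "y \<in> interior T" "dist y x < r"
      using x(2) by (auto simp: closure_approachable)
    have "0 < emeasure lborel (interior T \<inter> ball x r)"
      using y by (intro emeasure_lborel_open_pos) (auto simp: dist_commute)
    also have "\<dots> \<le> emeasure lborel (T \<inter> ball x r)"
      using interior_subset T by (intro emeasure_mono) auto
    finally show ?thesis using T by simp
  qed
  then show ?thesis
    using assms T emeasure_bounded_finite[of T] by (auto simp: full_support_on_def compact_imp_bounded)
qed

text \<open>A small ball around a relative interior point of \<open>F\<close> projects into \<open>F\<close>, because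
  the projection onto the affine hull does not increase distances, and lies in the slab; its volume
  bounds the surface measure of the part of \<open>F\<close> near that point from below.\<close>

lemma full_support_on_face_measure:
  fixes F :: "(real^'d::finite) set"
  assumes F: "compact F" "convex F" "F \<noteq> {}"
  shows "full_support_on (face_measure F) F"
proof -
  define A where "A = affine hull F"
  have A: "closed A" "convex A" "A \<noteq> {}" "F \<subseteq> A"
    using F by (auto simp: A_def closed_affine_hull affine_imp_convex hull_subset)
  define S where "S = {x. infdist x A \<le> 1 / 2}"
  have S: "closed S" unfolding S_def by (intro closed_Collect_le continuous_intros)
  define N where "N = restrict_space lborel S"
  have cp: "closest_point A \<in> measurable N borel" unfolding N_def
    using A by (intro measurable_restrict_space1) (auto intro!: borel_measurable_continuous_onI continuous_on_closest_point)
  have cpb: "closest_point A \<in> measurable borel borel"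
    using A by (auto intro!: borel_measurable_continuous_onI continuous_on_closest_point)
  have fm: "face_measure F = distr N borel (closest_point A)"
    by (simp add: face_measure_def N_def S_def A_def)
  have em: "emeasure (face_measure F) K = emeasure lborel (closest_point A -` K \<inter> S)"
    if "K \<in> sets borel" for K
  proof -
    have "emeasure (face_measure F) K = emeasure N (closest_point A -` K \<inter> S)"
      unfolding fm using that cp by (subst emeasure_distr) (auto simp: N_def space_restrict_space)
    also have "\<dots> = emeasure lborel (closest_point A -` K \<inter> S)"
      unfolding N_def using S by (intro emeasure_restrict_space) auto
    finally show ?thesis .
  qed
  have Fb: "F \<in> sets borel" using F by (simp add: borel_compact)
  have "bounded (closest_point A -` F \<inter> S)"
  proof -
    obtain B where B: "\<And>x. x \<in> F \<Longrightarrow> norm x \<le> B"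
      using F compact_imp_bounded bounded_iff by metis
    have "norm x \<le> B + 1 / 2" if "closest_point A x \<in> F" "infdist x A \<le> 1 / 2" for x
    proof -
      have "dist x (closest_point A x) \<le> infdist x A"
        using A closest_point_exists[OF A(1,3)] unfolding infdist_def
        by (auto intro!: cINF_greatest)
      then have "norm (x - closest_point A x) \<le> 1 / 2" using that by (simp add: dist_norm)
      moreover have "norm x \<le> norm (closest_point A x) + norm (x - closest_point A x)"
        by (metis add.commute diff_add_cancel norm_triangle_ineq)
      ultimately show ?thesis using B[OF that(1)] by linarith
    qed
    then show ?thesis by (auto simp: S_def bounded_iff)
  qed
  then have fin: "emeasure (face_measure F) F < \<infinity>"
    unfolding em[OF Fb] by (rule emeasure_bounded_finite)
  have pos: "emeasure (face_measure F) (F \<inter> ball x r) > 0" if x: "x \<in> F" "r > 0" for x r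
  proof -
    have "x \<in> closure (rel_interior F)"
      using x F by (simp add: convex_closure_rel_interior compact_imp_closed)
    then obtain y where y: "y \<in> rel_interior F" "dist y x < r"
      using x(2) by (auto simp: closure_approachable)
    then obtain e where e: "e > 0" "ball y e \<inter> A \<subseteq> F"
      by (auto simp: mem_rel_interior_ball A_def)
    define d where "d = min (min e (1 / 2)) (r - dist y x)"
    have d: "d > 0" "d \<le> e" "d \<le> 1 / 2" "d \<le> r - dist y x" 
      using e y by (auto simp: d_def min_def)
    have yA: "y \<in> A" using y rel_interior_subset A by blast
    have "ball y d \<subseteq> closest_point A -` (F \<inter> ball x r) \<inter> S"
    proof
      fix z assume z: "z \<in> ball y d"
      let ?c = "closest_point A z"
      have "dist ?c y \<le> dist z y"
        using closest_point_lipschitz[OF A(2,1,3), of z y] closest_point_self[OF yA] by simp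
      then have c: "dist ?c y < d" using z by (simp add: dist_commute)
      have "?c \<in> A" using A by (simp add: closest_point_in_set)
      then have "?c \<in> F" using c d e by (auto simp: dist_commute)
      moreover have "dist ?c x < r" using c d dist_triangle[of ?c x y] by linarith
      moreover have "infdist z A \<le> 1 / 2"
        using infdist_le[OF yA, of z] z d by (simp add: dist_commute)
      ultimately show "z \<in> closest_point A -` (F \<inter> ball x r) \<inter> S"
        by (simp add: S_def dist_commute)
    qed
    moreover have "closest_point A -` (F \<inter> ball x r) \<inter> S \<in> sets borel"
      using measurable_sets[OF cpb, of "F \<inter> ball x r"] Fb S by auto
    ultimately have "emeasure lborel (ball y d) \<le> emeasure (face_measure F) (F \<inter> ball x r)"
      using em[of "F \<inter> ball x r"] Fb by (auto intro!: emeasure_mono)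
    moreover have "emeasure lborel (ball y d) > 0"
      using d by (intro emeasure_lborel_open_pos) auto
    ultimately show ?thesis by (rule less_le_trans[rotated])
  qed
  show ?thesis unfolding full_support_on_def using F fin pos by (auto simp: fm)
qed

section \<open>Simplices, facets and normals\<close>

abbreviation full_simplex :: "(real^'d::finite) set \<Rightarrow> bool" where
  "full_simplex T \<equiv> int CARD('d) simplex T"

lemma full_simplex_props:
  fixes T :: "(real^'d::finite) set"
  assumes "full_simplex T"
  shows "compact T" "convex T" "polytope T" "interior T \<noteq> {}" "aff_dim T = int CARD('d)"
    "finite {F. F facet_of T}" "full_support_on lebesgue T"
proof -
  show 1: "compact T" "convex T" "polytope T" "aff_dim T = int CARD('d)"
    using assms by (auto simp: compact_simplex convex_simplex simplex_imp_polytope aff_dim_simplex)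
  show 2: "interior T \<noteq> {}"
  proof -
    have "T \<noteq> {}" using 1(4) by auto
    then show ?thesis using 1(2,4) by (simp add: interior_rel_interior[symmetric] rel_interior_eq_empty)
  qed
  show "finite {F. F facet_of T}" using 1 by (simp add: finite_polytope_facets)
  show "full_support_on lebesgue T" using 1 2 by (simp add: full_support_on_lebesgue)
qed

lemma full_simplex_facet:
  fixes T :: "(real^'d::finite) set"
  assumes "full_simplex T" "F facet_of T"
  shows "compact F" "convex F" "F \<noteq> {}" "F \<subseteq> T" "aff_dim F = int CARD('d) - 1"
    "full_support_on (face_measure F) F"
proof -
  note T = full_simplex_props[OF assms(1)]
  have "F face_of T" using assms(2) by (rule facet_of_imp_face_of)
  then show 1: "compact F" "convex F" "F \<noteq> {}" "F \<subseteq> T" "aff_dim F = int CARD('d) - 1"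
    using T assms(2) face_of_imp_compact face_of_imp_convex
    by (auto simp: facet_of_def face_of_imp_subset)
  then show "full_support_on (face_measure F) F" by (simp add: full_support_on_face_measure)
qed

text \<open>The affine hull of \<open>F\<close> is the whole hyperplane through \<open>x0\<close> orthogonal to
  \<open>n\<close>, so it contains the translate of \<open>x0\<close> by the tangential part of
  \<open>g\<close>, to which \<open>g\<close> is therefore orthogonal.\<close>

lemma normal_unique:
  fixes F :: "(real^'d::finite) set"
  assumes F: "aff_dim F = int CARD('d) - 1" "x0 \<in> F" and n: "unit_normal F n"
    and g: "\<And>x y. x \<in> F \<Longrightarrow> y \<in> F \<Longrightarrow> g \<bullet> (y - x) = 0"
  shows "g = (g \<bullet> n) *\<^sub>R n"
proof -
  let ?H = "{x. n \<bullet> x = n \<bullet> x0}"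
  have n1: "n \<noteq> 0" "n \<bullet> n = 1" using n by (auto simp: unit_normal_def dot_square_norm)
  have "n \<bullet> (y - x0) = 0" if "y \<in> F" for y using n F(2) that unfolding unit_normal_def by blast
  then have FH: "F \<subseteq> ?H" by (auto simp: inner_diff_right)
  have "affine hull F = affine hull ?H"
    using F n1 by (simp add: aff_dim_eq_full_gen[OF FH, symmetric])
  moreover have "affine hull ?H = ?H" by (simp add: affine_hyperplane affine_hull_eq)
  moreover have "affine hull F \<subseteq> {x. g \<bullet> x = g \<bullet> x0}"
    using g[OF F(2)] by (intro hull_minimal affine_hyperplane) (auto simp: inner_diff_right)
  moreover have "x0 + (g - (g \<bullet> n) *\<^sub>R n) \<in> ?H"
    using n1 by (simp add: inner_diff_right inner_add_right inner_commute)
  ultimately have "x0 + (g - (g \<bullet> n) *\<^sub>R n) \<in> {x. g \<bullet> x = g \<bullet> x0}" by (metis subsetD)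
  then have "g \<bullet> (g - (g \<bullet> n) *\<^sub>R n) = 0" by (simp add: inner_add_right)
  then have "(g - (g \<bullet> n) *\<^sub>R n) \<bullet> (g - (g \<bullet> n) *\<^sub>R n) = 0"
    using n1 by (simp add: inner_diff_right inner_diff_left inner_commute)
  then show ?thesis by simp
qed

text \<open>A facet of a polytope is exposed by a hyperplane, which yields one outward unit normal. Any other
  is a multiple of it, and the opposite sign would force the cell into the hyperplane.\<close>

lemma outward_normal_unit:
  fixes T :: "(real^'d::finite) set"
  assumes T: "full_simplex T" and F: "F facet_of T"
  shows "unit_normal F (outward_normal T F)"
proof -
  note Tp = full_simplex_props[OF T] and Fp = full_simplex_facet[OF T F]
  obtain x0 where x0: "x0 \<in> F" using Fp by blast
  have "F exposed_face_of T"
    using Tp facet_of_imp_face_of[OF F] by (simp add: exposed_face_of_polyhedron polytope_imp_polyhedron)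
  moreover have "F \<noteq> T" using Fp(5) Tp(5) by auto
  ultimately obtain a b where ab: "a \<noteq> 0" "T \<subseteq> {x. a \<bullet> x \<le> b}" "F = T \<inter> {x. a \<bullet> x = b}"
    using Fp(3) by (auto simp: exposed_face_of)
  define n where "n = a /\<^sub>R norm a"
  let ?P = "\<lambda>n. unit_normal F n \<and> (\<forall>x\<in>F. \<forall>y\<in>T. n \<bullet> (y - x) \<le> 0)"
  have nP: "?P n"
    using ab by (auto simp: n_def unit_normal_def inner_diff_right divide_simps)
  have "m = n" if m: "?P m" for m
  proof -
    have m1: "m = (m \<bullet> n) *\<^sub>R n"
      by (rule normal_unique[OF Fp(5) x0]) (use nP m in \<open>auto simp: unit_normal_def\<close>)
    then have "norm m = \<bar>m \<bullet> n\<bar> * norm n" by (metis norm_scaleR)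
    then have "m \<bullet> n = 1 \<or> m \<bullet> n = - 1" using nP m by (auto simp: unit_normal_def)
    then show ?thesis
    proof
      assume "m \<bullet> n = - 1"
      then have "m = - n" using m1 by simp
      then have "n \<bullet> (y - x0) = 0" if "y \<in> T" for y
        using nP m x0 that by force
      then have "T \<subseteq> {y. n \<bullet> y = n \<bullet> x0}" by (auto simp: inner_diff_right)
      then have "aff_dim T \<le> int CARD('d) - 1"
        using aff_dim_subset[of T "{y. n \<bullet> y = n \<bullet> x0}"] nP
        by (cases "n = 0") (auto simp: aff_dim_hyperplane unit_normal_def)
      then show ?thesis using Tp by simp
    qed (use m1 in simp)
  qed
  then have "?P (outward_normal T F)" unfolding outward_normal_def
    by (intro theI[of ?P n]) (use nP in blast)+
  then show ?thesis by blast
qed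

lemma normal_sign:
  fixes F :: "(real^'d::finite) set"
  assumes "aff_dim F = int CARD('d) - 1" "F \<noteq> {}" "unit_normal F n" "unit_normal F m"
  shows "m = (m \<bullet> n) *\<^sub>R n" "(m \<bullet> n)\<^sup>2 = 1"
proof -
  obtain x0 where x0: "x0 \<in> F" using assms by blast
  show 1: "m = (m \<bullet> n) *\<^sub>R n"
    by (rule normal_unique[OF assms(1) x0 assms(3)]) (use assms(4) in \<open>auto simp: unit_normal_def\<close>)
  then have "norm m = \<bar>m \<bullet> n\<bar> * norm n" by (metis norm_scaleR)
  then have "\<bar>m \<bullet> n\<bar> = 1" using assms by (auto simp: unit_normal_def)
  then show "(m \<bullet> n)\<^sup>2 = 1" by (metis one_power2 power2_abs)
qed

section \<open>The local reconstruction and the local form\<close>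

text \<open>The families on which the boundary integrals behave linearly.\<close>

definition bd_continuous :: "(real^'d::finite) set \<Rightarrow> ((real^'d) set \<Rightarrow> real^'d \<Rightarrow> real) set" where
  "bd_continuous T = {a. \<forall>F. F facet_of T \<longrightarrow> continuous_on F (a F)}"

lemma subspace_bd_continuous: "subspace (bd_continuous T)"
  unfolding bd_continuous_def
  by (rule subspaceI) (auto simp: zero_fun_def plus_fun_def scaleR_fun_def intro!: continuous_intros)

lemma bd_inner_eq_ip: "bd_inner T a b = (\<Sum>F | F facet_of T. L2_ip (face_measure F) F (a F) (b F))"
  by (simp add: bd_inner_def L2_ip_def)

lemma bd_inner_sym: "bd_inner T a b = bd_inner T b a"
  by (simp add: bd_inner_eq_ip L2_ip_sym)

lemma bd_inner_nonneg: "bd_inner T a a \<ge> 0"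
  unfolding bd_inner_eq_ip by (intro sum_nonneg L2_ip_nonneg)

lemma bd_inner_cong:
  assumes "\<And>F x. F facet_of T \<Longrightarrow> x \<in> F \<Longrightarrow> a F x = a' F x"
    "\<And>F x. F facet_of T \<Longrightarrow> x \<in> F \<Longrightarrow> b F x = b' F x"
  shows "bd_inner T a b = bd_inner T a' b'"
  unfolding bd_inner_eq_ip by (intro sum.cong refl L2_ip_cong) (use assms in auto)

lemma bilin_on_bd_inner:
  assumes T: "full_simplex T"
  shows "bilin_on (bd_continuous T) (bd_inner T)"
  unfolding bd_inner_eq_ip
proof (rule bilin_on_sum)
  fix F assume "F \<in> {F. F facet_of T}"
  then have F: "F facet_of T" by simp
  have "lin_on (bd_continuous T) (\<lambda>a. a F)" by (rule lin_onI) auto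
  then show "bilin_on (bd_continuous T) (\<lambda>a b. L2_ip (face_measure F) F (a F) (b F))"
    by (rule bilin_on_compose[OF bilin_on_L2_ip_continuous[OF full_simplex_facet(6)[OF T F]]])
      (use F in \<open>auto simp: bd_continuous_def\<close>)
qed

lemma bd_inner_zero:
  assumes T: "full_simplex T" and a: "a \<in> bd_continuous T" "bd_inner T a a = 0"
    and F: "F facet_of T" "x \<in> F"
  shows "a F x = 0"
proof -
  have "L2_ip (face_measure F) F (a F) (a F) = 0"
    using a(2) F(1) full_simplex_props(6)[OF T] unfolding bd_inner_eq_ip
    by (simp add: sum_nonneg_eq_0_iff L2_ip_nonneg)
  then show ?thesis
    using L2_ip_zero[OF full_simplex_facet(6)[OF T F(1)]] a(1) F by (auto simp: bd_continuous_def)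
qed

lemma subspace_face_poly_space: "subspace (face_poly_space k F)"
proof (rule subspaceI)
  note P = subspace_poly_space[where 'a='a and l=k]
  show "0 \<in> face_poly_space k F"
    using subspace_0[OF P] by (auto simp: face_poly_space_def intro!: bexI[of _ 0])
  fix q r assume "q \<in> face_poly_space k F"
  then obtain p where p: "p \<in> poly_space k" "\<forall>x\<in>F. q x = p x" "\<forall>x. x \<notin> F \<longrightarrow> q x = 0"
    by (auto simp: face_poly_space_def)
  then show "c *\<^sub>R q \<in> face_poly_space k F" for c
    using subspace_scale[OF P p(1)] by (auto simp: face_poly_space_def intro!: bexI[of _ "c *\<^sub>R p"])
  assume "r \<in> face_poly_space k F"
  then obtain s where s: "s \<in> poly_space k" "\<forall>x\<in>F. r x = s x" "\<forall>x. x \<notin> F \<longrightarrow> r x = 0"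
    by (auto simp: face_poly_space_def)
  then show "q + r \<in> face_poly_space k F"
    using p subspace_add[OF P p(1) s(1)] by (auto simp: face_poly_space_def intro!: bexI[of _ "p + s"])
qed

lemma subspace_facewise_poly_space: "subspace (facewise_poly_space k \<F>)"
proof (rule subspaceI)
  show "0 \<in> facewise_poly_space k \<F>"
    by (simp add: facewise_poly_space_def zero_fun_def[symmetric] subspace_0[OF subspace_face_poly_space])
  fix q assume q: "q \<in> facewise_poly_space k \<F>"
  then show "c *\<^sub>R q \<in> facewise_poly_space k \<F>" for c
    by (simp add: facewise_poly_space_def zero_fun_def[symmetric] subspace_scale[OF subspace_face_poly_space])
  fix r assume "r \<in> facewise_poly_space k \<F>"
  with q show "q + r \<in> facewise_poly_space k \<F>"
    by (simp add: facewise_poly_space_def zero_fun_def[symmetric] subspace_add[OF subspace_face_poly_space])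
qed

text \<open>Extension by zero off a single face is linear, and a family is the sum of the extensions of its
  members.\<close>

lemma fin_dim_facewise_poly_space:
  assumes "finite \<F>"
  shows "fin_dim (facewise_poly_space k \<F>)"
proof -
  define E where "E F p = (\<lambda>F' x. if F' = F \<and> x \<in> F then p x else 0)" for F and p :: "real^'a \<Rightarrow> real"
  have lin: "linear (E F)" for F by (rule linearI) (auto simp: E_def fun_eq_iff)
  show ?thesis
  proof (rule fin_dim_sum[OF assms])
    show "fin_dim (E F ` poly_space k)" for F
      by (rule fin_dim_lin_image[OF fin_dim_poly_space[of k] lin]) auto
    fix \<eta> assume \<eta>: "\<eta> \<in> facewise_poly_space k \<F>"
    then obtain p where p: "\<And>F. F \<in> \<F> \<Longrightarrow> p F \<in> poly_space k \<and> (\<forall>x\<in>F. \<eta> F x = p F x)"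
      unfolding facewise_poly_space_def face_poly_space_def by (simp; metis)
    have off: "\<eta> F x = 0" if "F \<notin> \<F> \<or> x \<notin> F" for F x
      using \<eta> that by (cases "F \<in> \<F>") (auto simp: facewise_poly_space_def face_poly_space_def)
    have "\<eta> F' x = (\<Sum>F\<in>\<F>. E F (p F)) F' x" for F' x
    proof (cases "F' \<in> \<F> \<and> x \<in> F'")
      case True
      have "(\<Sum>F\<in>\<F>. E F (p F)) F' x = (\<Sum>F\<in>\<F>. if F' = F then p F x else 0)"
        unfolding sum_fun_apply using True by (intro sum.cong) (auto simp: E_def)
      then show ?thesis using True assms p by simp
    next
      case False
      then have "(\<Sum>F\<in>\<F>. E F (p F)) F' x = 0"
        unfolding sum_fun_apply by (intro sum.neutral) (auto simp: E_def)
      then show ?thesis using False off[of F' x] by auto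
    qed
    then show "\<exists>f. \<eta> = (\<Sum>F\<in>\<F>. f F) \<and> (\<forall>F\<in>\<F>. f F \<in> E F ` poly_space k)"
      using p by (intro exI[of _ "\<lambda>F. E F (p F)"]) (auto simp: fun_eq_iff)
  qed
qed

abbreviation facets :: "(real^'d::finite) set \<Rightarrow> (real^'d) set set" where
  "facets T \<equiv> {F. F facet_of T}"

lemma facewise_bd_continuous: "facewise_poly_space k (facets T) \<subseteq> bd_continuous T"
proof
  fix \<eta> assume \<eta>: "\<eta> \<in> facewise_poly_space k (facets T)"
  have "continuous_on F (\<eta> F)" if F: "F facet_of T" for F
  proof -
    obtain p where p: "p \<in> poly_space k" "\<forall>x\<in>F. \<eta> F x = p x"
      using \<eta> F by (auto simp: facewise_poly_space_def face_poly_space_def)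
    then show ?thesis using poly_space_continuous_on[OF p(1), of F] continuous_on_cong by metis
  qed
  then show "\<eta> \<in> bd_continuous T" by (simp add: bd_continuous_def)
qed

lemma facewise_zero:
  assumes "full_simplex T" "q \<in> facewise_poly_space k (facets T)" "bd_inner T q q = 0"
  shows "q = 0"
proof (intro ext)
  fix F x
  show "q F x = 0 F x"
  proof (cases "F facet_of T \<and> x \<in> F")
    case True
    then show ?thesis
      using bd_inner_zero[OF assms(1) subsetD[OF facewise_bd_continuous assms(2)] assms(3)] by simp
  next
    case False
    then show ?thesis using assms(2)
      by (cases "F facet_of T") (auto simp: facewise_poly_space_def face_poly_space_def)
  qed
qed

lemma bd_proj_unique:
  assumes T: "full_simplex T"
    and q: "q \<in> facewise_poly_space k (facets T)" "\<And>r. r \<in> facewise_poly_space k (facets T) \<Longrightarrow> bd_inner T q r = bd_inner T g r"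
  shows "bd_proj k T g = q"
  unfolding bd_proj_def
proof (rule the_equality)
  show "q \<in> facewise_poly_space k {F. F facet_of T} \<and>
      (\<forall>r\<in>facewise_poly_space k {F. F facet_of T}. bd_inner T q r = bd_inner T g r)"
    using q by simp
  fix p assume p: "p \<in> facewise_poly_space k {F. F facet_of T} \<and>
      (\<forall>r\<in>facewise_poly_space k {F. F facet_of T}. bd_inner T p r = bd_inner T g r)"
  let ?X = "facewise_poly_space k (facets T)"
  note sub = subspace_facewise_poly_space[where k=k and \<F>="facets T"]
  have B: "bilin_on ?X (bd_inner T)"
    using bilin_on_bd_inner[OF T] facewise_bd_continuous[of k T]
    unfolding bilin_on_def by (meson lin_on_subset subsetD)
  have d: "p - q \<in> ?X" using p q(1) by (simp add: subspace_diff[OF sub])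
  have "bd_inner T (p - q) (p - q) = bd_inner T p (p - q) - bd_inner T q (p - q)"
    using lin_on_diff[OF bilin_onD(2)[OF B d] sub] p q(1) by simp
  also have "\<dots> = 0" using p q(2) d by simp
  finally have "p - q = 0" using facewise_zero[OF T d] by simp
  then show "p = q" by simp
qed

lemma bd_proj_props:
  assumes T: "full_simplex T" and g: "g \<in> bd_continuous T"
  shows "bd_proj k T g \<in> facewise_poly_space k (facets T)"
    "r \<in> facewise_poly_space k (facets T) \<Longrightarrow> bd_inner T (bd_proj k T g) r = bd_inner T g r"
proof -
  let ?X = "facewise_poly_space k (facets T)"
  have B: "bilin_on ?X (bd_inner T)"
    using bilin_on_bd_inner[OF T] facewise_bd_continuous by (rule bilin_on_subset)
  have L: "lin_on ?X (bd_inner T g)"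
    using bilin_onD(1)[OF bilin_on_bd_inner[OF T] g] facewise_bd_continuous by (rule lin_on_subset)
  have zero: "bd_inner T 0 y = 0" for y
    by (simp add: bd_inner_def)
  have "\<exists>q\<in>?X. \<forall>r\<in>?X. bd_inner T q r = bd_inner T g r"
  proof (rule finite_lax_milgram[OF subspace_facewise_poly_space _ B _ L])
    show "fin_dim ?X" by (rule fin_dim_facewise_poly_space[OF full_simplex_props(6)[OF T]])
    show "bd_inner T x y = 0 \<and> bd_inner T y x = 0" if "x \<in> ?X" "bd_inner T x x = 0" for x y
      using facewise_zero[OF T that] zero bd_inner_sym[of T y x] by simp
    show "bd_inner T g x = 0" if "x \<in> ?X" "bd_inner T x x = 0" for x
      using facewise_zero[OF T that] zero bd_inner_sym[of T g x] by simp
  qed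
  then obtain q where q: "q \<in> ?X" "\<And>r. r \<in> ?X \<Longrightarrow> bd_inner T q r = bd_inner T g r" by blast
  then have "bd_proj k T g = q" by (rule bd_proj_unique[OF T])
  then show "bd_proj k T g \<in> ?X" "r \<in> ?X \<Longrightarrow> bd_inner T (bd_proj k T g) r = bd_inner T g r"
    using q by simp_all
qed

lemma lin_on_bd_proj:
  assumes T: "full_simplex T"
  shows "lin_on (bd_continuous T) (bd_proj k T)"
proof -
  note B = bilin_on_bd_inner[OF T]
  note sub = subspace_facewise_poly_space[where k=k and \<F>="facets T"]
  have in_bd: "r \<in> bd_continuous T" if "r \<in> facewise_poly_space k (facets T)" for r
    using that facewise_bd_continuous by blast
  show ?thesis
  proof (rule lin_onI)
    fix g h assume gh: "g \<in> bd_continuous T" "h \<in> bd_continuous T"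
    show "bd_proj k T (g + h) = bd_proj k T g + bd_proj k T h"
    proof (rule bd_proj_unique[OF T])
      show "bd_proj k T g + bd_proj k T h \<in> facewise_poly_space k (facets T)"
        using gh by (simp add: subspace_add[OF sub] bd_proj_props[OF T])
      fix r assume r: "r \<in> facewise_poly_space k (facets T)"
      show "bd_inner T (bd_proj k T g + bd_proj k T h) r = bd_inner T (g + h) r"
        using bd_proj_props[OF T, where k=k] gh r in_bd
        by (simp add: lin_on_add[OF bilin_onD(2)[OF B in_bd[OF r]]])
    qed
  next
    fix c g assume g: "g \<in> bd_continuous T"
    show "bd_proj k T (c *\<^sub>R g) = c *\<^sub>R bd_proj k T g"
    proof (rule bd_proj_unique[OF T])
      show "c *\<^sub>R bd_proj k T g \<in> facewise_poly_space k (facets T)"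
        using g by (simp add: subspace_scale[OF sub] bd_proj_props[OF T])
      fix r assume r: "r \<in> facewise_poly_space k (facets T)"
      show "bd_inner T (c *\<^sub>R bd_proj k T g) r = bd_inner T (c *\<^sub>R g) r"
        using bd_proj_props[OF T, where k=k] g r in_bd
        by (simp add: lin_on_scale[OF bilin_onD(2)[OF B in_bd[OF r]]])
    qed
  qed
qed

text \<open>Facewise polynomials vanish off their faces by definition. Cutting a family off in this way makes
  it an admissible test function of the projection and changes no boundary integral.\<close>

definition bd_restrict ::
    "(real^'d::finite) set \<Rightarrow> ((real^'d) set \<Rightarrow> real^'d \<Rightarrow> real) \<Rightarrow> (real^'d) set \<Rightarrow> real^'d \<Rightarrow> real" where
  "bd_restrict T a F x = (if F facet_of T \<and> x \<in> F then a F x else 0)"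

lemma bd_restrict_facewise:
  assumes "\<And>F. F facet_of T \<Longrightarrow> \<exists>p\<in>poly_space k. \<forall>x\<in>F. a F x = p x"
  shows "bd_restrict T a \<in> facewise_poly_space k (facets T)"
  using assms by (auto simp: facewise_poly_space_def face_poly_space_def bd_restrict_def fun_eq_iff)

lemma bd_proj_zero_imp_zero:
  assumes T: "full_simplex T" and g: "g \<in> bd_continuous T" "bd_proj k T g = 0"
    and p: "\<And>F. F facet_of T \<Longrightarrow> \<exists>p\<in>poly_space k. \<forall>x\<in>F. g F x = p x"
    and F: "F facet_of T" "x \<in> F"
  shows "g F x = 0"
proof -
  let ?g = "bd_restrict T g"
  have m: "?g \<in> facewise_poly_space k (facets T)" using p by (rule bd_restrict_facewise)
  have "bd_inner T ?g ?g = bd_inner T g ?g"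
    by (rule bd_inner_cong) (auto simp: bd_restrict_def)
  also have "\<dots> = 0"
    using bd_proj_props(2)[OF T g(1) m] g(2) by (simp add: bd_inner_def)
  finally have "?g = 0" using facewise_zero[OF T m] by simp
  then have "?g F x = 0" by simp
  then show ?thesis using F by (simp add: bd_restrict_def)
qed

lemma normal_deriv_bd_continuous: "v \<in> poly_space l \<Longrightarrow> normal_deriv T v \<in> bd_continuous T"
  unfolding bd_continuous_def normal_deriv_def[abs_def]
  by (auto intro!: continuous_intros grad_continuous_on)

lemma lin_on_normal_deriv: "lin_on (poly_space l) (normal_deriv T)"
  using lin_on_grad[of l] unfolding lin_on_def normal_deriv_def[abs_def] fun_eq_iff
  by (auto simp: inner_add_left)

lemma lin_on_normal_deriv2: "lin_on (poly_space l) (normal_deriv2 T)"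
  using lin_on_hess[of l] unfolding lin_on_def normal_deriv2_def[abs_def] fun_eq_iff
  by (auto simp: inner_add_right matrix_vector_mult_add_rdistrib scaleR_matrix_vector_assoc[symmetric])

lemma normal_deriv2_poly_space:
  assumes "w \<in> poly_space (k + 2)"
  shows "normal_deriv2 T w F \<in> poly_space k"
proof -
  let ?n = "outward_normal T F"
  have "normal_deriv2 T w F = (\<Sum>i\<in>UNIV. \<Sum>j\<in>UNIV. (?n $ i * ?n $ j) *\<^sub>R part_deriv i (part_deriv j w))"
    by (simp add: fun_eq_iff normal_deriv2_def sum_fun_apply inner_vec_def matrix_vector_mult_def
        hess_def sum_distrib_left mult_ac)
  also have "\<dots> \<in> poly_space k"
    using part_deriv2_poly_space[OF assms]
    by (intro subspace_sum[OF subspace_poly_space] subspace_scale[OF subspace_poly_space])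
  finally show ?thesis .
qed

lemma normal_deriv2_bd_continuous:
  "w \<in> poly_space (k + 2) \<Longrightarrow> normal_deriv2 T w \<in> bd_continuous T"
  unfolding bd_continuous_def mem_Collect_eq
  by (intro allI impI poly_space_continuous_on[OF normal_deriv2_poly_space])

lemma hess_poly_space_1:
  assumes "p \<in> poly_space 1"
  shows "hess p = 0"
proof -
  have c: "part_deriv i q = 0" if "q \<in> poly_space 0" for i and q :: "real^'a \<Rightarrow> real"
  proof -
    have "{\<alpha>::'a \<Rightarrow> nat. (\<Sum>i\<in>UNIV. \<alpha> i) \<le> 0} = {\<lambda>i. 0}" by (auto simp: fun_eq_iff)
    then have "\<exists>c. \<forall>x. q x = c" using that by (auto simp: poly_space_def)
    then obtain c where q: "q = (\<lambda>x. c + 0 \<bullet> x)" by (auto simp: fun_eq_iff)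
    show ?thesis unfolding q by (rule ext) (subst part_deriv_affine, simp)
  qed
  have "part_deriv i (part_deriv j p) = 0" for i j
    using c[of "part_deriv j p" i] part_deriv_poly_space[OF assms] by simp
  then show ?thesis by (simp add: fun_eq_iff hess_def vec_eq_iff)
qed

definition local_space ::
    "nat \<Rightarrow> (real^'d::finite) set \<Rightarrow> ((real^'d \<Rightarrow> real) \<times> ((real^'d) set \<Rightarrow> real^'d \<Rightarrow> real)) set" where
  "local_space k T = poly_space (k + 2) \<times> facewise_poly_space k (facets T)"

text \<open>The quantity penalised by the stabilisation; up to sign it is also the boundary term of the
  reconstruction.\<close>

definition flux_gap :: "(real^'d::finite) set \<Rightarrow> (real^'d \<Rightarrow> real) \<times> ((real^'d) set \<Rightarrow> real^'d \<Rightarrow> real)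
    \<Rightarrow> (real^'d) set \<Rightarrow> real^'d \<Rightarrow> real" where
  "flux_gap T s = snd s - normal_deriv T (fst s)"

lemma flux_gap_bd_continuous: "s \<in> local_space k T \<Longrightarrow> flux_gap T s \<in> bd_continuous T"
  unfolding flux_gap_def local_space_def
  using facewise_bd_continuous[of k T]
  by (auto intro!: subspace_diff[OF subspace_bd_continuous] normal_deriv_bd_continuous)

lemma lin_on_fst: "lin_on X fst" and lin_on_snd: "lin_on X snd"
  by (auto simp: lin_on_def)

lemma lin_on_flux_gap: "lin_on (local_space k T) (flux_gap T)"
  unfolding flux_gap_def[abs_def]
  by (intro lin_on_ops lin_on_snd lin_on_compose[OF lin_on_fst lin_on_normal_deriv])
    (auto simp: local_space_def)

lemma bd_inner_minus_left: "bd_inner T (- a) b = - bd_inner T a b"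
  by (simp add: bd_inner_def sum_negf set_lebesgue_integral_def)

text \<open>The defining property of the reconstruction, with the boundary term expressed by the flux gap so
  that it is visibly linear in the pair.\<close>

definition is_recon :: "nat \<Rightarrow> (real^'d::finite) set
    \<Rightarrow> (real^'d \<Rightarrow> real) \<times> ((real^'d) set \<Rightarrow> real^'d \<Rightarrow> real) \<Rightarrow> (real^'d \<Rightarrow> real) \<Rightarrow> bool" where
  "is_recon k T s r \<longleftrightarrow> r \<in> poly_space (k + 2) \<and>
     (\<forall>w\<in>poly_space (k + 2). L2_inner T (hess r) (hess w) =
        L2_inner T (hess (fst s)) (hess w) + bd_inner T (flux_gap T s) (normal_deriv2 T w)) \<and>
     (\<forall>\<xi>\<in>poly_space 1. L2_inner T r \<xi> = L2_inner T (fst s) \<xi>)"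

lemma recon_eq_The: "recon k T s = (THE r. is_recon k T s r)"
proof -
  obtain v \<eta> where s: "s = (v, \<eta>)" by (cases s)
  have "(\<lambda>F x. normal_deriv T v F x - \<eta> F x) = - flux_gap T s"
    by (simp add: fun_eq_iff flux_gap_def s)
  then show ?thesis
    unfolding recon_def is_recon_def s prod.case by (simp add: bd_inner_minus_left s)
qed

lemma bilin_on_L2_hess:
  assumes "full_simplex T"
  shows "bilin_on (poly_space l) (\<lambda>r w. L2_inner T (hess r) (hess w))"
  unfolding L2_inner_eq_ip
  by (rule bilin_on_compose[OF bilin_on_L2_ip_continuous[OF full_simplex_props(7)[OF assms]] lin_on_hess])
    (auto intro: hess_continuous_on)

lemma bilin_on_L2_poly:
  assumes "full_simplex T"
  shows "bilin_on (poly_space l) (L2_inner T)"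
proof -
  have "poly_space l \<subseteq> {f. continuous_on T f}" by (auto intro: poly_space_continuous_on)
  then show ?thesis unfolding L2_inner_eq_ip[abs_def]
    using bilin_on_subset[OF bilin_on_L2_ip_continuous[OF full_simplex_props(7)[OF assms]]] by metis
qed

lemma L2_hess_zero:
  assumes T: "full_simplex T" and r: "r \<in> poly_space l" "L2_inner T (hess r) (hess r) = 0" and x: "x \<in> T"
  shows "hess r x = 0"
  using L2_ip_zero[OF full_simplex_props(7)[OF T] hess_continuous_on[OF r(1)] _ x] r(2)
  by (simp add: L2_inner_eq_ip)

lemma L2_poly_zero:
  assumes T: "full_simplex T" and r: "r \<in> poly_space l" "L2_inner T r r = 0"
  shows "r = 0"
proof (rule poly_space_identity[OF r(1)])
  show "r x = 0" if "x \<in> T" for x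
    using L2_ip_zero[OF full_simplex_props(7)[OF T] poly_space_continuous_on[OF r(1)] _ that] r(2)
    by (simp add: L2_inner_eq_ip)
qed (rule full_simplex_props(4)[OF T])

lemma L2_inner_zero_left: "(\<And>x. x \<in> T \<Longrightarrow> f x = 0) \<Longrightarrow> L2_inner T f g = 0"
  using L2_ip_cong[of T f 0 g g lebesgue] by (simp add: L2_inner_eq_ip) (simp add: L2_ip_def)

lemma L2_inner_sym: "L2_inner T f g = L2_inner T g f"
  by (simp add: L2_inner_eq_ip L2_ip_sym)

lemma L2_inner_nonneg: "L2_inner T f f \<ge> 0"
  by (simp add: L2_inner_eq_ip L2_ip_nonneg)

lemma poly_space_1_subset: "poly_space 1 \<subseteq> poly_space (k + 2)"
  by (rule poly_space_mono) simp

text \<open>The Hessian form is only semidefinite, with the affine functions as null space. The right-hand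
  side vanishes on this null space, so the first condition is solvable; an affine correction, found
  with the definite \<open>L\<^sup>2\<close> product on the affine functions, satisfies the second
  condition without affecting the first.\<close>

lemma is_recon_exists:
  assumes T: "full_simplex T" and s: "s \<in> local_space k T"
  shows "\<exists>r. is_recon k T s r"
proof -
  let ?X = "poly_space (k + 2) :: (real^'a \<Rightarrow> real) set"
  let ?A = "\<lambda>r w. L2_inner T (hess r) (hess w)"
  let ?L = "\<lambda>w. ?A (fst s) w + bd_inner T (flux_gap T s) (normal_deriv2 T w)"
  have v: "fst s \<in> ?X" using s by (auto simp: local_space_def)
  note A = bilin_on_L2_hess[OF T, of "k + 2"]
  note g = flux_gap_bd_continuous[OF s]
  have null: "?A x y = 0 \<and> ?A y x = 0" if "x \<in> ?X" "y \<in> ?X" "?A x x = 0" for x y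
    using semidef_null[OF subspace_poly_space A] that L2_inner_sym L2_inner_nonneg by blast
  have "\<exists>r\<in>?X. \<forall>w\<in>?X. ?A r w = ?L w"
  proof (rule finite_lax_milgram[OF subspace_poly_space fin_dim_poly_space A null])
    show "lin_on ?X ?L"
      by (intro lin_on_ops bilin_onD(1)[OF A v]
          lin_on_compose[OF lin_on_normal_deriv2 bilin_onD(1)[OF bilin_on_bd_inner[OF T] g]]
          normal_deriv2_bd_continuous)
    fix w assume w: "w \<in> ?X" "?A w w = 0"
    have "hess w x = 0" if "x \<in> T" for x using L2_hess_zero[OF T w that] .
    then have "normal_deriv2 T w F x = 0" if "F facet_of T" "x \<in> F" for F x
      using that full_simplex_facet(4)[OF T that(1)] by (auto simp: normal_deriv2_def)
    then have "bd_inner T (flux_gap T s) (normal_deriv2 T w) = bd_inner T (flux_gap T s) 0"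
      by (intro bd_inner_cong) auto
    then show "?L w = 0" using null[OF w(1) v w(2)] by (simp add: bd_inner_def)
  qed
  then obtain r0 where r0: "r0 \<in> ?X" "\<And>w. w \<in> ?X \<Longrightarrow> ?A r0 w = ?L w" by blast
  let ?Y = "poly_space 1 :: (real^'a \<Rightarrow> real) set"
  note C = bilin_on_L2_poly[OF T, of 1]
  note C2 = bilin_on_L2_poly[OF T, of "k + 2"]
  have vr: "fst s - r0 \<in> ?X" using v r0(1) by (rule subspace_diff[OF subspace_poly_space])
  have z: "L2_inner T 0 y = 0" "L2_inner T y 0 = 0" for y :: "real^'a \<Rightarrow> real"
    by (simp_all add: L2_inner_def)
  have "\<exists>p\<in>?Y. \<forall>\<xi>\<in>?Y. L2_inner T p \<xi> = L2_inner T (fst s - r0) \<xi>"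
  proof (rule finite_lax_milgram[OF subspace_poly_space fin_dim_poly_space C])
    show "L2_inner T x y = 0 \<and> L2_inner T y x = 0" if "x \<in> ?Y" "L2_inner T x x = 0" for x y
      using L2_poly_zero[OF T that] z by simp
    show "lin_on ?Y (L2_inner T (fst s - r0))"
      by (rule lin_on_subset[OF bilin_onD(1)[OF C2 vr] poly_space_1_subset])
    show "L2_inner T (fst s - r0) x = 0" if "x \<in> ?Y" "L2_inner T x x = 0" for x
      using L2_poly_zero[OF T that] z by simp
  qed
  then obtain p where p: "p \<in> ?Y" "\<And>\<xi>. \<xi> \<in> ?Y \<Longrightarrow> L2_inner T p \<xi> = L2_inner T (fst s - r0) \<xi>"
    by blast
  have pX: "p \<in> ?X" using p(1) poly_space_1_subset by blast
  have "hess (r0 + p) = hess r0"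
    using lin_on_add[OF lin_on_hess r0(1) pX] hess_poly_space_1[OF p(1)] by simp
  moreover have "L2_inner T (r0 + p) \<xi> = L2_inner T (fst s) \<xi>" if "\<xi> \<in> ?Y" for \<xi>
  proof -
    have \<xi>: "\<xi> \<in> ?X" using that poly_space_1_subset by blast
    show ?thesis
      using lin_on_add[OF bilin_onD(2)[OF C2 \<xi>] r0(1) pX] p(2)[OF that]
        lin_on_diff[OF bilin_onD(2)[OF C2 \<xi>] subspace_poly_space v r0(1)] by simp
  qed
  ultimately have "is_recon k T s (r0 + p)"
    using r0 pX by (simp add: is_recon_def subspace_add[OF subspace_poly_space])
  then show ?thesis by blast
qed

text \<open>The difference of two candidates has vanishing Hessian, hence is affine, and is orthogonal to the
  affine functions.\<close>

lemma is_recon_unique: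
  assumes T: "full_simplex T" and r: "is_recon k T s r" "is_recon k T s r'"
  shows "r = r'"
proof -
  let ?X = "poly_space (k + 2) :: (real^'a \<Rightarrow> real) set"
  let ?d = "r - r'"
  have m: "r \<in> ?X" "r' \<in> ?X" using r by (auto simp: is_recon_def)
  have d: "?d \<in> ?X" using m by (rule subspace_diff[OF subspace_poly_space])
  have "L2_inner T (hess ?d) (hess ?d) = 0"
    using lin_on_diff[OF bilin_onD(2)[OF bilin_on_L2_hess[OF T] d] subspace_poly_space m] r d
    by (simp add: is_recon_def)
  then obtain b g where bg: "?d = (\<lambda>x. b + g \<bullet> x)"
    using hess_zero_imp_affine[OF d full_simplex_props(4)[OF T]] L2_hess_zero[OF T d] by metis
  have d1: "?d \<in> poly_space 1" unfolding bg by (rule affine_in_poly_space) simp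
  have "L2_inner T ?d ?d = 0"
    using lin_on_diff[OF bilin_onD(2)[OF bilin_on_L2_poly[OF T] d] subspace_poly_space m] r d1
    by (simp add: is_recon_def)
  then have "?d = 0" by (rule L2_poly_zero[OF T d])
  then show ?thesis by simp
qed

lemma is_recon_recon:
  assumes "full_simplex T" "s \<in> local_space k T"
  shows "is_recon k T s (recon k T s)"
  unfolding recon_eq_The
  using is_recon_exists[OF assms] is_recon_unique[OF assms(1)] by (metis theI)

lemma recon_eqI:
  assumes "full_simplex T" "is_recon k T s r"
  shows "recon k T s = r"
  unfolding recon_eq_The using is_recon_unique[OF assms(1)] assms(2) by blast

lemma recon_poly_space:
  "full_simplex T \<Longrightarrow> s \<in> local_space k T \<Longrightarrow> recon k T s \<in> poly_space (k + 2)"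
  using is_recon_recon[of T s k] unfolding is_recon_def by blast

lemma lin_on_recon:
  assumes T: "full_simplex T"
  shows "lin_on (local_space k T) (recon k T)"
proof -
  let ?X = "poly_space (k + 2) :: (real^'a \<Rightarrow> real) set"
  note P = subspace_poly_space[where 'a='a and l="k + 2"]
  have m: "fst s \<in> ?X" if "s \<in> local_space k T" for s using that by (auto simp: local_space_def)
  note H = bilin_onD(2)[OF bilin_on_L2_hess[OF T, of "k + 2"]]
  note L = bilin_onD(2)[OF bilin_on_L2_poly[OF T, of "k + 2"]]
  note N = bilin_onD(2)[OF bilin_on_bd_inner[OF T] normal_deriv2_bd_continuous]
  show ?thesis
  proof (rule lin_onI)
    fix s t assume st: "s \<in> local_space k T" "t \<in> local_space k T"
    note r = is_recon_recon[OF T st(1)] is_recon_recon[OF T st(2)]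
    note rX = recon_poly_space[OF T st(1)] recon_poly_space[OF T st(2)]
    show "recon k T (s + t) = recon k T s + recon k T t"
    proof (rule recon_eqI[OF T], unfold is_recon_def, intro conjI ballI)
      show "recon k T s + recon k T t \<in> ?X" using rX by (rule subspace_add[OF P])
      fix w :: "real^'a \<Rightarrow> real" assume w: "w \<in> ?X"
      show "L2_inner T (hess (recon k T s + recon k T t)) (hess w) =
          L2_inner T (hess (fst (s + t))) (hess w) + bd_inner T (flux_gap T (s + t)) (normal_deriv2 T w)"
        using r w lin_on_add[OF H[OF w] rX] lin_on_add[OF H[OF w] m[OF st(1)] m[OF st(2)]]
          lin_on_add[OF lin_on_flux_gap st]
          lin_on_add[OF N[OF w] flux_gap_bd_continuous[OF st(1)] flux_gap_bd_continuous[OF st(2)]]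
        by (simp add: is_recon_def)
    next
      fix \<xi> :: "real^'a \<Rightarrow> real" assume \<xi>: "\<xi> \<in> poly_space 1"
      then have \<xi>X: "\<xi> \<in> ?X" using poly_space_1_subset by blast
      show "L2_inner T (recon k T s + recon k T t) \<xi> = L2_inner T (fst (s + t)) \<xi>"
        using r \<xi> lin_on_add[OF L[OF \<xi>X] rX] lin_on_add[OF L[OF \<xi>X] m[OF st(1)] m[OF st(2)]]
        by (simp add: is_recon_def)
    qed
  next
    fix c s assume s: "s \<in> local_space k T"
    note r = is_recon_recon[OF T s] and rX = recon_poly_space[OF T s]
    show "recon k T (c *\<^sub>R s) = c *\<^sub>R recon k T s"
    proof (rule recon_eqI[OF T], unfold is_recon_def, intro conjI ballI)
      show "c *\<^sub>R recon k T s \<in> ?X" using rX by (rule subspace_scale[OF P])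
      fix w :: "real^'a \<Rightarrow> real" assume w: "w \<in> ?X"
      show "L2_inner T (hess (c *\<^sub>R recon k T s)) (hess w) =
          L2_inner T (hess (fst (c *\<^sub>R s))) (hess w) + bd_inner T (flux_gap T (c *\<^sub>R s)) (normal_deriv2 T w)"
        using r w lin_on_scale[OF H[OF w] rX] lin_on_scale[OF H[OF w] m[OF s]]
          lin_on_scale[OF lin_on_flux_gap s]
          lin_on_scale[OF N[OF w] flux_gap_bd_continuous[OF s]]
        by (simp add: is_recon_def distrib_left)
    next
      fix \<xi> :: "real^'a \<Rightarrow> real" assume \<xi>: "\<xi> \<in> poly_space 1"
      then have \<xi>X: "\<xi> \<in> ?X" using poly_space_1_subset by blast
      show "L2_inner T (c *\<^sub>R recon k T s) \<xi> = L2_inner T (fst (c *\<^sub>R s)) \<xi>"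
        using r \<xi> lin_on_scale[OF L[OF \<xi>X] rX] lin_on_scale[OF L[OF \<xi>X] m[OF s]]
        by (simp add: is_recon_def)
    qed
  qed
qed

definition local_form :: "nat \<Rightarrow> (real^'d::finite) set
    \<Rightarrow> (real^'d \<Rightarrow> real) \<times> ((real^'d) set \<Rightarrow> real^'d \<Rightarrow> real)
    \<Rightarrow> (real^'d \<Rightarrow> real) \<times> ((real^'d) set \<Rightarrow> real^'d \<Rightarrow> real) \<Rightarrow> real" where
  "local_form k T s t = L2_inner T (hess (recon k T s)) (hess (recon k T t)) + stab k T s t"

lemma stab_eq: "stab k T s t =
    inverse (diameter T) * bd_inner T (bd_proj k T (flux_gap T s)) (bd_proj k T (flux_gap T t))"
proof -
  have "flux_gap T (v, \<eta>) = (\<lambda>F x. \<eta> F x - normal_deriv T v F x)" for v \<eta>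
    by (simp add: fun_eq_iff flux_gap_def)
  then show ?thesis by (cases s; cases t) (simp add: stab_def)
qed

lemma bilin_on_local_form:
  assumes T: "full_simplex T"
  shows "bilin_on (local_space k T) (local_form k T)"
  unfolding local_form_def[abs_def]
proof (rule bilin_on_ops(1))
  show "bilin_on (local_space k T) (\<lambda>s t. L2_inner T (hess (recon k T s)) (hess (recon k T t)))"
    by (rule bilin_on_compose[OF bilin_on_L2_hess[OF T] lin_on_recon[OF T] recon_poly_space[OF T]])
  have "lin_on (local_space k T) (\<lambda>s. bd_proj k T (flux_gap T s))"
    by (rule lin_on_compose[OF lin_on_flux_gap lin_on_bd_proj[OF T] flux_gap_bd_continuous])
  then have "bilin_on (local_space k T)
      (\<lambda>s t. bd_inner T (bd_proj k T (flux_gap T s)) (bd_proj k T (flux_gap T t)))"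
    by (rule bilin_on_compose[OF bilin_on_bd_inner[OF T]])
      (use bd_proj_props(1)[OF T flux_gap_bd_continuous] facewise_bd_continuous in blast)
  then show "bilin_on (local_space k T) (stab k T)"
    unfolding stab_eq[abs_def] by (rule bilin_on_ops(3))
qed

lemma diameter_full_simplex:
  fixes T :: "(real^'d::finite) set"
  assumes T: "full_simplex T"
  shows "diameter T > 0"
proof -
  obtain x e where e: "e > 0" "cball x e \<subseteq> T"
    using full_simplex_props(4)[OF T] by (metis all_not_in_conv mem_interior_cball)
  define y where "y = x + e *\<^sub>R axis undefined 1"
  have "y \<in> T" "x \<in> T" "dist x y = e" using e by (auto simp: y_def dist_norm intro!: subsetD[OF e(2)])
  then show ?thesis
    using diameter_bounded_bound[OF compact_imp_bounded[OF full_simplex_props(1)[OF T]], of x y] e by simp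
qed

lemma local_form_nonneg:
  assumes "full_simplex T"
  shows "local_form k T s s \<ge> 0"
  unfolding local_form_def stab_eq using diameter_full_simplex[OF assms]
  by (intro add_nonneg_nonneg mult_nonneg_nonneg L2_inner_nonneg bd_inner_nonneg) simp

text \<open>The projection of the flux gap controls the whole boundary term of the reconstruction, since the
  normal-normal derivative of a polynomial of degree \<open>k + 2\<close> has degree \<open>k\<close>. This
  makes the Hessian of the polynomial itself vanish. The flux gap is then a facewise polynomial of
  degree \<open>k\<close>, so it equals its projection and vanishes as well.\<close>

lemma local_form_zero:
  assumes T: "full_simplex T" and s: "s \<in> local_space k T" "local_form k T s s = 0"
  obtains b g where "fst s = (\<lambda>x. b + g \<bullet> x)"
    "\<And>F x. F facet_of T \<Longrightarrow> x \<in> F \<Longrightarrow> snd s F x = g \<bullet> outward_normal T F"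
proof -
  let ?v = "fst s" and ?r = "recon k T s" and ?G = "flux_gap T s"
  have v: "?v \<in> poly_space (k + 2)" using s by (auto simp: local_space_def)
  have G: "?G \<in> bd_continuous T" using s(1) by (rule flux_gap_bd_continuous)
  have "inverse (diameter T) * bd_inner T (bd_proj k T ?G) (bd_proj k T ?G) \<ge> 0"
    using diameter_full_simplex[OF T] by (intro mult_nonneg_nonneg bd_inner_nonneg) simp
  then have 0: "L2_inner T (hess ?r) (hess ?r) = 0" "bd_inner T (bd_proj k T ?G) (bd_proj k T ?G) = 0"
    using s(2) L2_inner_nonneg[of T "hess ?r"] diameter_full_simplex[OF T]
    unfolding local_form_def stab_eq by (auto simp: add_nonneg_eq_0_iff)
  have proj: "bd_proj k T ?G = 0" using facewise_zero[OF T bd_proj_props(1)[OF T G] 0(2)] .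
  \<comment> \<open>Normal-normal derivatives of \<open>v\<close> have degree \<open>k\<close>, so only the projected gap is tested.\<close>
  have "bd_inner T ?G (normal_deriv2 T ?v) = bd_inner T ?G (bd_restrict T (normal_deriv2 T ?v))"
    by (rule bd_inner_cong) (auto simp: bd_restrict_def)
  also have "\<dots> = bd_inner T (bd_proj k T ?G) (bd_restrict T (normal_deriv2 T ?v))"
    by (rule bd_proj_props(2)[OF T G, symmetric])
      (use normal_deriv2_poly_space[OF v] in \<open>auto intro!: bd_restrict_facewise\<close>)
  also have "\<dots> = 0" by (simp add: proj bd_inner_def)
  finally have "L2_inner T (hess ?r) (hess ?v) = L2_inner T (hess ?v) (hess ?v)"
    using is_recon_recon[OF T s(1)] v by (simp add: is_recon_def)
  moreover have "L2_inner T (hess ?r) (hess ?v) = 0"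
    by (rule L2_inner_zero_left) (rule L2_hess_zero[OF T recon_poly_space[OF T s(1)] 0(1)])
  ultimately obtain b g where bg: "?v = (\<lambda>x. b + g \<bullet> x)"
    using hess_zero_imp_affine[OF v full_simplex_props(4)[OF T]] L2_hess_zero[OF T v] by metis
  have nd: "normal_deriv T ?v F x = g \<bullet> outward_normal T F" for F x
    by (simp add: normal_deriv_def bg grad_affine)
  have "?G F x = 0" if F: "F facet_of T" "x \<in> F" for F x
  proof (rule bd_proj_zero_imp_zero[OF T G proj _ F])
    fix F assume F: "F facet_of T"
    then obtain p where p: "p \<in> poly_space k" "\<And>x. x \<in> F \<Longrightarrow> snd s F x = p x"
      using s(1) by (auto simp: local_space_def facewise_poly_space_def face_poly_space_def)
    have c: "(\<lambda>x. g \<bullet> outward_normal T F) \<in> poly_space k"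
    proof -
      have "(g \<bullet> outward_normal T F) *\<^sub>R mono_fun (\<lambda>i. 0) \<in> poly_space k"
        by (intro subspace_scale[OF subspace_poly_space] mono_fun_in_poly_space) simp
      then show ?thesis by (simp add: mono_fun_def[abs_def] scaleR_fun_def)
    qed
    show "\<exists>p\<in>poly_space k. \<forall>x\<in>F. ?G F x = p x"
      using p(2) nd by (intro bexI[OF _ subspace_diff[OF subspace_poly_space p(1) c]]) (simp add: flux_gap_def)
  qed
  then have "snd s F x = g \<bullet> outward_normal T F" if "F facet_of T" "x \<in> F" for F x
    using that nd[of F x] by (simp add: flux_gap_def)
  then show thesis using that bg by blast
qed

section \<open>Piecewise polynomial spaces on a mesh\<close>

text \<open>On a null set every function is integrable for the completed measure. This is what admits the classical gradient of a piecewise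
  polynomial, which takes arbitrary values on the mesh skeleton.\<close>

lemma set_integral_spike:
  fixes f :: "'a::euclidean_space \<Rightarrow> real"
  assumes "S \<subseteq> S'" "negligible (S' - S)" "set_integrable lebesgue S f"
  shows "set_integrable lebesgue S' f" "(LINT x:S'|lebesgue. f x) = (LINT x:S|lebesgue. f x)"
proof -
  have n: "negligible {x \<in> S - S'. f x \<noteq> 0}" "negligible {x \<in> S' - S. f x \<noteq> 0}"
    using assms(1,2) by (auto intro: negligible_subset)
  show i: "set_integrable lebesgue S' f"
    using absolutely_integrable_spike_set_eq[OF n] assms(3) by simp
  show "(LINT x:S'|lebesgue. f x) = (LINT x:S|lebesgue. f x)"
    using set_lebesgue_integral_eq_integral(2)[OF i] set_lebesgue_integral_eq_integral(2)[OF assms(3)]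
      integral_spike_set[OF n] by simp
qed

lemma set_integral_mono_set:
  fixes f :: "'a \<Rightarrow> real"
  assumes "set_integrable M S f" "set_integrable M S' f" "S \<subseteq> S'" "\<And>x. x \<in> S' \<Longrightarrow> f x \<ge> 0"
  shows "(LINT x:S|M. f x) \<le> (LINT x:S'|M. f x)"
  using assms unfolding set_lebesgue_integral_def set_integrable_def
  by (intro integral_mono) (auto simp: indicator_def)

lemma L2_space_mult:
  assumes "f \<in> L2_space S" "g \<in> L2_space S"
  shows "set_integrable lebesgue S (\<lambda>x. f x * g x)"
  unfolding set_integrable_def
proof (rule Bochner_Integration.integrable_bound)
  show "integrable lebesgue (\<lambda>x. indicator S x *\<^sub>R (f x)\<^sup>2 + indicator S x *\<^sub>R (g x)\<^sup>2)"
    using assms by (auto simp: L2_space_def set_integrable_def)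
  have "(\<lambda>x. (indicator S x *\<^sub>R f x) * (indicator S x *\<^sub>R g x)) \<in> borel_measurable lebesgue"
    using assms unfolding L2_space_def set_borel_measurable_def by (intro borel_measurable_times) auto
  moreover have "(\<lambda>x. (indicator S x *\<^sub>R f x) * (indicator S x *\<^sub>R g x)) = (\<lambda>x. indicator S x *\<^sub>R (f x * g x))"
    by (auto simp: indicator_def)
  ultimately show "(\<lambda>x. indicator S x *\<^sub>R (f x * g x)) \<in> borel_measurable lebesgue" by simp
  have "\<bar>a * b\<bar> \<le> a\<^sup>2 + b\<^sup>2" for a b :: real
  proof -
    have "2 * (\<bar>a\<bar> * \<bar>b\<bar>) \<le> \<bar>a\<bar>\<^sup>2 + \<bar>b\<bar>\<^sup>2"
      using sum_squares_ge_zero[of "\<bar>a\<bar> - \<bar>b\<bar>" 0] by (simp add: power2_eq_square algebra_simps)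
    moreover have "0 \<le> \<bar>a\<bar> * \<bar>b\<bar>" by simp
    ultimately show ?thesis unfolding abs_mult power2_abs by linarith
  qed
  then show "AE x in lebesgue. norm (indicator S x *\<^sub>R (f x * g x))
      \<le> norm (indicator S x *\<^sub>R (f x)\<^sup>2 + indicator S x *\<^sub>R (g x)\<^sup>2)"
    by (intro AE_I2) (auto simp: indicator_def)
qed

locale mesh =
  fixes \<Omega> :: "(real^'d::finite) set" and \<T> :: "(real^'d) set set"
  assumes domain: "polytopal_domain \<Omega>" and mesh: "simplicial_mesh \<Omega> \<T>"
begin

lemma omega: "\<Omega> \<noteq> {}" "open \<Omega>" "bounded \<Omega>" "convex \<Omega>"
  using domain by (auto simp: polytopal_domain_def)

lemma cells: "finite \<T>" "T \<in> \<T> \<Longrightarrow> full_simplex T" "\<Union>\<T> = closure \<Omega>"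
  "T \<in> \<T> \<Longrightarrow> T' \<in> \<T> \<Longrightarrow> T \<inter> T' face_of T"
  using mesh by (auto simp: simplicial_mesh_def triangulation_def)

lemma closure_compact: "compact (closure \<Omega>)"
  using omega by (simp add: compact_closure)

lemma interior_closure_omega: "interior (closure \<Omega>) = \<Omega>"
  using omega by (simp add: convex_interior_closure interior_open)

lemma full_support_on_closure: "full_support_on lebesgue (closure \<Omega>)"
  using omega by (intro full_support_on_lebesgue closure_compact convex_closure) (simp_all add: interior_closure_omega)

lemma finite_mesh_faces: "finite (mesh_faces \<T>)"
  unfolding mesh_faces_def using cells full_simplex_props(6) by blast

abbreviation PW :: "nat \<Rightarrow> (real^'d \<Rightarrow> real) set" where
  "PW l \<equiv> cont_pw_poly_space l \<T>"

lemma subspace_PW: "subspace (PW l)"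
proof (rule subspaceI)
  note P = subspace_poly_space[where 'a='d and l=l]
  show "0 \<in> PW l" using subspace_0[OF P]
    by (auto simp: cont_pw_poly_space_def zero_fun_def intro!: bexI[of _ "\<lambda>x. 0"])
  fix v assume v: "v \<in> PW l"
  show "c *\<^sub>R v \<in> PW l" for c
    unfolding cont_pw_poly_space_def mem_Collect_eq
  proof (intro conjI ballI allI impI)
    show "continuous_on (\<Union>\<T>) (c *\<^sub>R v)"
      using v unfolding scaleR_fun_def by (auto simp: cont_pw_poly_space_def intro!: continuous_intros)
    fix T assume "T \<in> \<T>"
    then obtain p where "p \<in> poly_space l" "\<forall>x\<in>T. v x = p x" using v by (auto simp: cont_pw_poly_space_def)
    then show "\<exists>p\<in>poly_space l. \<forall>x\<in>T. (c *\<^sub>R v) x = p x"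
      by (intro bexI[of _ "c *\<^sub>R p"]) (simp_all add: subspace_scale[OF P])
  qed (use v in \<open>auto simp: cont_pw_poly_space_def\<close>)
  fix w assume w: "w \<in> PW l"
  show "v + w \<in> PW l"
    unfolding cont_pw_poly_space_def mem_Collect_eq
  proof (intro conjI ballI allI impI)
    show "continuous_on (\<Union>\<T>) (v + w)"
      using v w unfolding plus_fun_def by (auto simp: cont_pw_poly_space_def intro!: continuous_intros)
    fix T assume T: "T \<in> \<T>"
    obtain p where p: "p \<in> poly_space l" "\<forall>x\<in>T. v x = p x" using v T by (auto simp: cont_pw_poly_space_def)
    obtain q where q: "q \<in> poly_space l" "\<forall>x\<in>T. w x = q x" using w T by (auto simp: cont_pw_poly_space_def)
    show "\<exists>p\<in>poly_space l. \<forall>x\<in>T. (v + w) x = p x"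
      using p q by (intro bexI[of _ "p + q"]) (simp_all add: subspace_add[OF P])
  qed (use v w in \<open>auto simp: cont_pw_poly_space_def\<close>)
qed

definition cell_poly :: "nat \<Rightarrow> (real^'d) set \<Rightarrow> (real^'d \<Rightarrow> real) \<Rightarrow> real^'d \<Rightarrow> real" where
  "cell_poly l T v = (THE p. p \<in> poly_space l \<and> (\<forall>x\<in>T. p x = v x))"

lemma cell_poly_eqI:
  assumes "T \<in> \<T>" "p \<in> poly_space l" "\<And>x. x \<in> T \<Longrightarrow> p x = v x"
  shows "cell_poly l T v = p"
  unfolding cell_poly_def
proof (rule the_equality)
  show "p \<in> poly_space l \<and> (\<forall>x\<in>T. p x = v x)" using assms by simp
  show "q = p" if "q \<in> poly_space l \<and> (\<forall>x\<in>T. q x = v x)" for q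
    by (rule poly_space_eqI[of q l p T])
      (use that assms full_simplex_props(4)[OF cells(2)] in auto)
qed

lemma cell_poly:
  assumes "T \<in> \<T>" "v \<in> PW l"
  shows "cell_poly l T v \<in> poly_space l" "x \<in> T \<Longrightarrow> cell_poly l T v x = v x"
proof -
  obtain p where p: "p \<in> poly_space l" "\<And>x. x \<in> T \<Longrightarrow> p x = v x"
    using assms by (fastforce simp: cont_pw_poly_space_def)
  then have "cell_poly l T v = p" using cell_poly_eqI[OF assms(1)] by blast
  then show "cell_poly l T v \<in> poly_space l" "x \<in> T \<Longrightarrow> cell_poly l T v x = v x" using p by simp_all
qed

lemma lin_on_cell_poly:
  assumes "T \<in> \<T>"
  shows "lin_on (PW l) (cell_poly l T)"
  by (rule lin_onI; rule cell_poly_eqI[OF assms])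
    (auto simp: cell_poly[OF assms] subspace_add[OF subspace_poly_space] subspace_scale[OF subspace_poly_space])

text \<open>Assigning each point to one of the cells containing it gives a partition; a piecewise polynomial is
  the sum of its pieces cut off to the parts.\<close>

lemma fin_dim_PW: "fin_dim (PW l)"
proof -
  define pick where "pick x = (SOME T. T \<in> \<T> \<and> x \<in> T)" for x
  have pick: "pick x \<in> \<T> \<and> x \<in> pick x" if "x \<in> \<Union>\<T>" for x
    unfolding pick_def by (rule someI_ex) (use that in auto)
  define E where "E T p = (\<lambda>x. if x \<in> \<Union>\<T> \<and> pick x = T then p x else 0)" for T and p :: "real^'d \<Rightarrow> real"
  have lin: "linear (E T)" for T by (rule linearI) (auto simp: E_def fun_eq_iff)
  show ?thesis
  proof (rule fin_dim_sum[OF cells(1)])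
    show "fin_dim (E T ` poly_space l)" for T
      by (rule fin_dim_lin_image[OF fin_dim_poly_space[of l] lin]) auto
    fix v assume v: "v \<in> PW l"
    have "v x = (\<Sum>T\<in>\<T>. E T (cell_poly l T v)) x" for x
    proof (cases "x \<in> \<Union>\<T>")
      case True
      have "(\<Sum>T\<in>\<T>. E T (cell_poly l T v)) x = (\<Sum>T\<in>\<T>. if pick x = T then cell_poly l T v x else 0)"
        unfolding sum_fun_apply using True by (intro sum.cong) (auto simp: E_def)
      also have "\<dots> = cell_poly l (pick x) v x" using pick[OF True] cells(1) by simp
      finally show ?thesis using cell_poly(2)[of "pick x" v l x] pick[OF True] v by simp
    next
      case False
      then show ?thesis using v by (simp add: sum_fun_apply E_def cont_pw_poly_space_def)
    qed
    then show "\<exists>f. v = (\<Sum>T\<in>\<T>. f T) \<and> (\<forall>T\<in>\<T>. f T \<in> E T ` poly_space l)"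
      using v cell_poly(1) by (intro exI[of _ "\<lambda>T. E T (cell_poly l T v)"]) (auto simp: fun_eq_iff)
  qed
qed

subsection \<open>The global form\<close>

abbreviation pair_space :: "nat \<Rightarrow> ((real^'d \<Rightarrow> real) \<times> ((real^'d) set \<Rightarrow> real^'d \<Rightarrow> real)) set" where
  "pair_space k \<equiv> PW (k + 2) \<times> facewise_poly_space k (mesh_faces \<T>)"

lemma local_comp_eq: "local_comp \<nu> k T s = (cell_poly (k + 2) T (fst s),
    \<lambda>F x. if F facet_of T then (\<nu> F \<bullet> outward_normal T F) * snd s F x else 0)"
  by (simp add: local_comp_def cell_poly_def split_beta)

lemma local_comp_local_space:
  assumes "T \<in> \<T>" "s \<in> pair_space k"
  shows "local_comp \<nu> k T s \<in> local_space k T"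
proof -
  have "(\<lambda>x. (\<nu> F \<bullet> outward_normal T F) * snd s F x) \<in> face_poly_space k F" if "F facet_of T" for F
  proof -
    have "snd s F \<in> face_poly_space k F"
      using assms that by (auto simp: facewise_poly_space_def mesh_faces_def)
    then have "(\<nu> F \<bullet> outward_normal T F) *\<^sub>R snd s F \<in> face_poly_space k F"
      by (rule subspace_scale[OF subspace_face_poly_space])
    then show ?thesis by (simp add: scaleR_fun_def)
  qed
  then show ?thesis using assms cell_poly(1)
    by (auto simp: local_comp_eq local_space_def facewise_poly_space_def cong: if_cong)
qed

lemma lin_on_local_comp:
  assumes "T \<in> \<T>"
  shows "lin_on (pair_space k) (local_comp \<nu> k T)"
proof (rule lin_onI)
  fix s t :: "(real^'d \<Rightarrow> real) \<times> ((real^'d) set \<Rightarrow> real^'d \<Rightarrow> real)" and c :: real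
  assume s: "s \<in> pair_space k"
  then show "local_comp \<nu> k T (c *\<^sub>R s) = c *\<^sub>R local_comp \<nu> k T s"
    using lin_on_scale[OF lin_on_cell_poly[OF assms]]
    by (auto simp: local_comp_eq fun_eq_iff simp del: mult_cancel_left)
  assume "t \<in> pair_space k"
  then show "local_comp \<nu> k T (s + t) = local_comp \<nu> k T s + local_comp \<nu> k T t"
    using s lin_on_add[OF lin_on_cell_poly[OF assms]]
    by (auto simp: local_comp_eq fun_eq_iff distrib_left)
qed

lemma a_form_eq: "a_form \<nu> \<T> k s t = (\<Sum>T\<in>\<T>. local_form k T (local_comp \<nu> k T s) (local_comp \<nu> k T t))"
  by (simp add: a_form_def local_form_def)

lemma bilin_on_a_form: "bilin_on (pair_space k) (a_form \<nu> \<T> k)"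
  unfolding a_form_eq[abs_def]
  by (intro bilin_on_sum bilin_on_compose[OF bilin_on_local_form[OF cells(2)] lin_on_local_comp]
      local_comp_local_space)

lemma a_form_nonneg: "a_form \<nu> \<T> k s s \<ge> 0"
  unfolding a_form_eq by (intro sum_nonneg local_form_nonneg cells(2))

lemma a_form_zero:
  assumes s: "s \<in> pair_space k" "a_form \<nu> \<T> k s s = 0" and T: "T \<in> \<T>"
  obtains b g where "\<And>x. x \<in> T \<Longrightarrow> fst s x = b + g \<bullet> x"
    "\<And>F x. F facet_of T \<Longrightarrow> x \<in> F \<Longrightarrow> (\<nu> F \<bullet> outward_normal T F) * snd s F x = g \<bullet> outward_normal T F"
proof -
  have "local_form k T (local_comp \<nu> k T s) (local_comp \<nu> k T s) = 0"
    using s(2) T cells(1,2) unfolding a_form_eq by (simp add: sum_nonneg_eq_0_iff local_form_nonneg)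
  then obtain b g where *: "fst (local_comp \<nu> k T s) = (\<lambda>x. b + g \<bullet> x)"
    "\<And>F x. F facet_of T \<Longrightarrow> x \<in> F \<Longrightarrow> snd (local_comp \<nu> k T s) F x = g \<bullet> outward_normal T F"
    using local_form_zero[OF cells(2)[OF T] local_comp_local_space[OF T s(1)]] by metis
  show thesis
  proof (rule that[of b g])
    show "fst s x = b + g \<bullet> x" if "x \<in> T" for x
      using cell_poly(2)[OF T _ that, of "fst s" "k + 2"] s(1) *(1) by (auto simp: local_comp_eq)
    show "(\<nu> F \<bullet> outward_normal T F) * snd s F x = g \<bullet> outward_normal T F" if "F facet_of T" "x \<in> F" for F x
      using *(2)[OF that] that by (simp add: local_comp_eq)
  qed
qed

subsection \<open>Integrals over the domain\<close>

lemma set_integrable_omega: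
  assumes "continuous_on (closure \<Omega>) f"
  shows "set_integrable lebesgue \<Omega> (f :: _ \<Rightarrow> real)"
  using full_support_on_integrable[OF full_support_on_closure assms] omega closure_subset
  by (rule_tac set_integrable_subset) auto

lemma PW_continuous: "v \<in> PW l \<Longrightarrow> continuous_on (closure \<Omega>) v"
  using cells(3) by (simp add: cont_pw_poly_space_def)

lemma continuous_L2_space:
  assumes "continuous_on (closure \<Omega>) f"
  shows "f \<in> L2_space \<Omega>"
proof -
  have "continuous_on (closure \<Omega>) (\<lambda>x. (f x)\<^sup>2)" using assms by (intro continuous_intros)
  then show ?thesis
    using set_integrable_omega[OF assms] set_integrable_omega[of "\<lambda>x. (f x)\<^sup>2"]
    by (auto simp: L2_space_def set_integrable_def set_borel_measurable_def)
qed

lemma PW_L2_space: "v \<in> PW l \<Longrightarrow> v \<in> L2_space \<Omega>"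
  by (rule continuous_L2_space[OF PW_continuous])

lemma lin_on_L2_space_omega:
  assumes "f \<in> L2_space \<Omega>"
  shows "lin_on (L2_space \<Omega>) (L2_inner \<Omega> f)"
  by (rule lin_onI)
    (simp_all add: L2_inner_def distrib_left set_integral_add L2_space_mult[OF assms] mult.left_commute)

lemma bilin_on_L2_omega: "bilin_on (L2_space \<Omega>) (L2_inner \<Omega>)"
proof (rule bilin_onI)
  show 1: "lin_on (L2_space \<Omega>) (L2_inner \<Omega> f)" if "f \<in> L2_space \<Omega>" for f
    using that by (rule lin_on_L2_space_omega)
  show "lin_on (L2_space \<Omega>) (\<lambda>f. L2_inner \<Omega> f g)" if "g \<in> L2_space \<Omega>" for g
    using 1[OF that] by (simp add: L2_inner_sym[of \<Omega> _ g])
qed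

definition cell_interiors :: "(real^'d) set" where
  "cell_interiors = (\<Union>T\<in>\<T>. interior T)"

lemma cell_interiors_sets: "cell_interiors \<in> sets lebesgue"
  unfolding cell_interiors_def using cells(1) by (intro sets.finite_UN) auto

lemma cell_interiors: "cell_interiors \<subseteq> \<Omega>" "negligible (\<Omega> - cell_interiors)"
proof -
  have "interior T \<subseteq> \<Omega>" if "T \<in> \<T>" for T
    using cells(3) that interior_mono[of T "closure \<Omega>"] by (auto simp: interior_closure_omega)
  then show "cell_interiors \<subseteq> \<Omega>" by (auto simp: cell_interiors_def)
  have "negligible (\<Union>T\<in>\<T>. frontier T)"
    using cells(1,2) full_simplex_props(2) negligible_convex_frontier by (intro negligible_Union) auto
  moreover have "\<Omega> - cell_interiors \<subseteq> (\<Union>T\<in>\<T>. frontier T)"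
  proof
    fix x assume x: "x \<in> \<Omega> - cell_interiors"
    then have "x \<in> \<Union>\<T>" using closure_subset cells(3) by blast
    then obtain T where "T \<in> \<T>" "x \<in> T" by blast
    then show "x \<in> (\<Union>T\<in>\<T>. frontier T)"
      using x closure_subset by (auto simp: cell_interiors_def frontier_def)
  qed
  ultimately show "negligible (\<Omega> - cell_interiors)" by (rule negligible_subset)
qed

lemma PW_interior:
  assumes v: "v \<in> PW l" and T: "T \<in> \<T>" and x: "x \<in> interior T"
  shows "v differentiable (at x)" "grad v x = grad (cell_poly l T v) x"
proof -
  let ?p = "cell_poly l T v"
  have "(?p has_derivative (\<lambda>h. grad ?p x \<bullet> h)) (at x)"
    by (rule frechet_derivative_eq_grad[OF poly_space_differentiable[OF cell_poly(1)[OF T v]]])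
  then have *: "(v has_derivative (\<lambda>h. grad ?p x \<bullet> h)) (at x)"
    by (rule has_derivative_transform_within_open[OF _ open_interior x])
      (use cell_poly(2)[OF T v] interior_subset in auto)
  then show "v differentiable (at x)" by (auto simp: differentiable_def)
  show "grad v x = grad ?p x"
    by (simp add: grad_def[of v] part_deriv_eq[OF *] vec_eq_iff inner_axis)
qed

lemma grad_integrable:
  assumes v: "v \<in> PW l" and w: "w \<in> PW l'"
  shows "set_integrable lebesgue cell_interiors (\<lambda>x. grad v x \<bullet> grad w x)"
  unfolding cell_interiors_def
proof (rule set_integrable_UN[OF cells(1)])
  fix T assume T: "T \<in> \<T>"
  have "set_integrable lebesgue T (\<lambda>x. grad (cell_poly l T v) x \<bullet> grad (cell_poly l' T w) x)"
    by (intro full_support_on_integrable full_simplex_props(7) cells(2)[OF T] continuous_intros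
        grad_continuous_on[OF cell_poly(1)[OF T v]] grad_continuous_on[OF cell_poly(1)[OF T w]])
  then have "set_integrable lebesgue (interior T) (\<lambda>x. grad (cell_poly l T v) x \<bullet> grad (cell_poly l' T w) x)"
    by (rule set_integrable_subset) (auto simp: interior_subset)
  then show "set_integrable lebesgue (interior T) (\<lambda>x. grad v x \<bullet> grad w x)"
    using PW_interior(2)[OF v T] PW_interior(2)[OF w T] by (simp cong: set_integrable_cong)
qed auto

lemma L2_grad_eq:
  assumes "v \<in> PW l" "w \<in> PW l'"
  shows "L2_inner \<Omega> (grad v) (grad w) = L2_inner cell_interiors (grad v) (grad w)"
  unfolding L2_inner_def by (rule set_integral_spike(2)[OF cell_interiors grad_integrable[OF assms]])

lemma bilin_on_grad: "bilin_on (PW l) (\<lambda>v w. L2_inner \<Omega> (grad v) (grad w))"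
proof (rule bilin_onI)
  have add: "grad (v + w) x = grad v x + grad w x" "grad (c *\<^sub>R v) x = c *\<^sub>R grad v x"
    if vw: "v \<in> PW l" "w \<in> PW l" and x: "x \<in> cell_interiors" for v w x c
  proof -
    obtain T where T: "T \<in> \<T>" "x \<in> interior T" using x by (auto simp: cell_interiors_def)
    note d = PW_interior(1)[OF vw(1) T] PW_interior(1)[OF vw(2) T]
    show "grad (v + w) x = grad v x + grad w x" "grad (c *\<^sub>R v) x = c *\<^sub>R grad v x"
      by (simp_all add: grad_def vec_eq_iff part_deriv_add[OF d] part_deriv_scale[OF d(1)])
  qed
  show 1: "lin_on (PW l) (\<lambda>w. L2_inner \<Omega> (grad v) (grad w))" if v: "v \<in> PW l" for v
  proof (rule lin_onI)
    fix u w assume uw: "u \<in> PW l" "w \<in> PW l"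
    note s = subspace_add[OF subspace_PW uw]
    have "L2_inner cell_interiors (grad v) (grad (u + w))
        = (LINT x:cell_interiors|lebesgue. grad v x \<bullet> grad u x + grad v x \<bullet> grad w x)"
      unfolding L2_inner_def by (rule set_lebesgue_integral_cong)
        (simp_all add: cell_interiors_sets add[OF uw] inner_add_right)
    also have "\<dots> = L2_inner cell_interiors (grad v) (grad u) + L2_inner cell_interiors (grad v) (grad w)"
      unfolding L2_inner_def
      by (rule set_integral_add(2)[OF grad_integrable[OF v uw(1)] grad_integrable[OF v uw(2)]])
    finally show "L2_inner \<Omega> (grad v) (grad (u + w)) = L2_inner \<Omega> (grad v) (grad u) + L2_inner \<Omega> (grad v) (grad w)"
      by (simp add: L2_grad_eq[OF v s] L2_grad_eq[OF v uw(1)] L2_grad_eq[OF v uw(2)])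
  next
    fix c u assume u: "u \<in> PW l"
    note s = subspace_scale[OF subspace_PW u, of c]
    have "L2_inner cell_interiors (grad v) (grad (c *\<^sub>R u))
        = (LINT x:cell_interiors|lebesgue. c * (grad v x \<bullet> grad u x))"
      unfolding L2_inner_def by (rule set_lebesgue_integral_cong)
        (simp_all add: cell_interiors_sets add(2)[OF u u])
    then show "L2_inner \<Omega> (grad v) (grad (c *\<^sub>R u)) = c *\<^sub>R L2_inner \<Omega> (grad v) (grad u)"
      unfolding L2_grad_eq[OF v s] L2_grad_eq[OF v u] by (simp add: L2_inner_def)
  qed
  show "lin_on (PW l) (\<lambda>v. L2_inner \<Omega> (grad v) (grad w))" if "w \<in> PW l" for w
    using 1[OF that] by (simp add: L2_inner_sym[of \<Omega> _ "grad w"])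
qed

text \<open>The integral over one cell is at most the integral over the domain, so the gradient of the
  polynomial piece vanishes on that cell.\<close>

lemma L2_grad_zero:
  assumes v: "v \<in> PW l" and zero: "L2_inner \<Omega> (grad v) (grad v) = 0" and T: "T \<in> \<T>"
  shows "\<exists>c. \<forall>x\<in>T. v x = c"
proof -
  let ?p = "cell_poly l T v"
  note Tp = full_simplex_props[OF cells(2)[OF T]]
  have cont: "continuous_on S (grad ?p)" for S
    by (rule grad_continuous_on[OF cell_poly(1)[OF T v]])
  have iT: "set_integrable lebesgue T (\<lambda>x. grad ?p x \<bullet> grad ?p x)"
    by (intro full_support_on_integrable Tp continuous_intros cont)
  have i: "set_integrable lebesgue (interior T) (\<lambda>x. grad ?p x \<bullet> grad ?p x)"
    using iT by (rule set_integrable_subset) (auto simp: interior_subset)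
  have n: "negligible (T - interior T)"
    using negligible_convex_frontier[OF Tp(2)] Tp(1) by (simp add: frontier_def compact_imp_closed)
  have "L2_inner T (grad ?p) (grad ?p) = (LINT x:interior T|lebesgue. grad ?p x \<bullet> grad ?p x)"
    unfolding L2_inner_def by (rule set_integral_spike(2)[OF interior_subset n i])
  also have "\<dots> = (LINT x:interior T|lebesgue. grad v x \<bullet> grad v x)"
    by (rule set_lebesgue_integral_cong) (auto simp: PW_interior(2)[OF v T])
  also have "\<dots> \<le> (LINT x:cell_interiors|lebesgue. grad v x \<bullet> grad v x)"
  proof (rule set_integral_mono_set[OF _ grad_integrable[OF v v]])
    show "set_integrable lebesgue (interior T) (\<lambda>x. grad v x \<bullet> grad v x)"
      using i PW_interior(2)[OF v T] by (simp cong: set_integrable_cong)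
  qed (use T in \<open>auto simp: cell_interiors_def\<close>)
  also have "\<dots> = 0" using zero L2_grad_eq[OF v v] by (simp add: L2_inner_def)
  finally have "L2_ip lebesgue T (grad ?p) (grad ?p) = 0"
    using L2_inner_nonneg[of T "grad ?p"] by (simp add: L2_inner_eq_ip)
  then have "grad ?p x = 0" if "x \<in> T" for x using L2_ip_zero[OF Tp(7) cont _ that] by simp
  then have "\<exists>c. \<forall>x\<in>T. ?p x = c"
    using poly_space_differentiable[OF cell_poly(1)[OF T v]] by (intro grad_zero_imp_const[OF Tp(2)])
  then show ?thesis using cell_poly(2)[OF T v] by auto
qed

end

section \<open>The space of functions with zero trace\<close>

lemma lborel_integral_shift:
  fixes f :: "'a::euclidean_space \<Rightarrow> real"
  assumes "integrable lborel f"
  shows "integrable lborel (\<lambda>x. f (c + x))" "(\<integral>x. f (c + x) \<partial>lborel) = (\<integral>x. f x \<partial>lborel)"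
proof -
  have [measurable]: "f \<in> borel_measurable borel" using assms by auto
  have d: "distr lborel borel ((+) c) = lborel" by (rule lborel_distr_plus)
  have "integrable (distr lborel borel ((+) c)) f" using assms by (simp add: d)
  then show "integrable lborel (\<lambda>x. f (c + x))" by (subst (asm) integrable_distr_eq) auto
  have "(\<integral>x. f x \<partial>distr lborel borel ((+) c)) = (\<integral>x. f (c + x) \<partial>lborel)" by (rule integral_distr) auto
  then show "(\<integral>x. f (c + x) \<partial>lborel) = (\<integral>x. f x \<partial>lborel)" by (simp add: d)
qed

lemma directional_derivative:
  assumes "\<And>x. f differentiable (at x)"
  shows "((\<lambda>t. f (x + t *\<^sub>R axis i 1)) has_real_derivative part_deriv i f (x + t *\<^sub>R axis i 1)) (at t)"
proof -
  have 1: "((\<lambda>t. x + t *\<^sub>R axis i 1) has_derivative (\<lambda>h. h *\<^sub>R axis i 1)) (at t)"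
    by (auto intro!: derivative_eq_intros)
  have "((\<lambda>t. f (x + t *\<^sub>R axis i 1)) has_derivative
      (\<lambda>h. grad f (x + t *\<^sub>R axis i 1) \<bullet> (h *\<^sub>R axis i 1))) (at t)"
    by (rule has_derivative_compose[OF 1 frechet_derivative_eq_grad[OF assms]])
  then show ?thesis by (simp add: has_field_derivative_def inner_axis grad_def mult.commute[of _ "part_deriv _ _ _"] cong: if_cong)
qed

lemma part_deriv_zero_off:
  assumes "closed K" "\<And>x. x \<notin> K \<Longrightarrow> f x = 0" "x \<notin> K"
  shows "part_deriv i f x = 0"
proof -
  have "((\<lambda>x. 0::real) has_derivative (\<lambda>h. 0)) (at x)" by simp
  then have "(f has_derivative (\<lambda>h. 0)) (at x)"
    by (rule has_derivative_transform_within_open[where s="- K"]) (use assms in auto)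
  then show ?thesis by (simp add: part_deriv_eq)
qed

text \<open>The integral of a compactly supported function is invariant under translation, so the
  derivative of this integral along the translation vanishes.\<close>

lemma integral_part_deriv_zero:
  fixes f :: "real^'d::finite \<Rightarrow> real"
  assumes K: "compact K" and off: "\<And>x. x \<notin> K \<Longrightarrow> f x = 0"
    and diff: "\<And>x. f differentiable (at x)" and cont: "continuous_on UNIV (part_deriv i f)"
  shows "(\<integral>x. part_deriv i f x \<partial>lborel) = 0"
proof -
  define e :: "real^'d" where "e = axis i 1"
  have off': "part_deriv i f x = 0" if "x \<notin> K" for x
    by (rule part_deriv_zero_off[OF compact_imp_closed[OF K] off that])
  have contf: "continuous_on S f" for S
    using diff by (meson continuous_at_imp_continuous_on differentiable_imp_continuous_within)
  have int: "integrable lborel f"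
  proof -
    have "integrable lborel (\<lambda>x. indicator K x *\<^sub>R f x)" by (rule borel_integrable_compact[OF K contf])
    moreover have "(\<lambda>x. indicator K x *\<^sub>R f x) = f"
      using off by (intro ext) (simp add: indicator_def of_bool_def)
    ultimately show ?thesis by simp
  qed
  have "bounded (part_deriv i f ` K)"
    using K cont by (meson compact_continuous_image compact_imp_bounded continuous_on_subset subset_UNIV)
  then obtain M0 where M0: "\<And>x. x \<in> K \<Longrightarrow> \<bar>part_deriv i f x\<bar> \<le> M0" unfolding bounded_iff by auto
  define M where "M = max M0 0"
  have M: "\<bar>part_deriv i f x\<bar> \<le> M" for x using M0[of x] off'[of x] by (cases "x \<in> K") (auto simp: M_def)
  obtain R where R: "\<And>x. x \<in> K \<Longrightarrow> norm x \<le> R"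
    using compact_imp_bounded[OF K] bounded_iff by metis
  \<comment> \<open>Steps of size at most one keep all difference quotients supported in a common ball.\<close>
  define h where "h n = inverse (real (Suc n))" for n
  have h: "0 < h n" "h n \<le> 1" for n by (auto simp: h_def field_simps)
  define q where "q n x = (f (h n *\<^sub>R e + x) - f x) / h n" for n x
  have "(\<lambda>n. \<integral>x. q n x \<partial>lborel) \<longlonglongrightarrow> (\<integral>x. part_deriv i f x \<partial>lborel)"
  proof (rule integral_dominated_convergence)
    show "part_deriv i f \<in> borel_measurable lborel"
      using borel_measurable_continuous_onI[OF cont] by simp
    show "q n \<in> borel_measurable lborel" for n
      unfolding q_def using lborel_integral_shift(1)[OF int] int by measurable
    show "integrable lborel (\<lambda>x. M * indicator (cball 0 (R + 1)) x :: real)"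
      using emeasure_bounded_finite[OF bounded_cball, of 0 "R + 1"]
      by (intro integrable_mult_right integrable_real_indicator) auto
    show "AE x in lborel. norm (q n x) \<le> M * indicator (cball 0 (R + 1)) x" for n
    proof (rule AE_I2)
      fix x
      obtain t where t: "f (x + h n *\<^sub>R e) - f (x + 0 *\<^sub>R e) = (h n - 0) * part_deriv i f (x + t *\<^sub>R e)"
        using MVT2[OF h(1)[of n], of "\<lambda>t. f (x + t *\<^sub>R e)" "\<lambda>t. part_deriv i f (x + t *\<^sub>R e)"]
          directional_derivative[OF diff] unfolding e_def by blast
      then have "q n x = part_deriv i f (x + t *\<^sub>R e)"
        using h(1)[of n] by (simp add: q_def add.commute)
      then have 1: "norm (q n x) \<le> M" using M by simp
      have 2: "q n x = 0" if "x \<notin> cball 0 (R + 1)"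
      proof -
        have "norm (h n *\<^sub>R e) \<le> 1" using h[of n] by (simp add: e_def norm_axis_1)
        then have "norm (h n *\<^sub>R e + x) > R" using that norm_triangle_ineq2[of x "- (h n *\<^sub>R e)"]
          by (simp add: add.commute)
        then have "h n *\<^sub>R e + x \<notin> K" "x \<notin> K" using R that by force+
        then show ?thesis by (simp add: q_def off)
      qed
      show "norm (q n x) \<le> M * indicator (cball 0 (R + 1)) x"
        using 1 2 by (cases "x \<in> cball 0 (R + 1)") auto
    qed
    show "AE x in lborel. (\<lambda>n. q n x) \<longlonglongrightarrow> part_deriv i f x"
    proof (rule AE_I2)
      fix x
      have "((\<lambda>t. (f (x + t *\<^sub>R e) - f (x + 0 *\<^sub>R e)) / (t - 0)) \<longlongrightarrow> part_deriv i f (x + 0 *\<^sub>R e)) (at 0)"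
        using directional_derivative[OF diff, of x i 0] unfolding has_field_derivative_iff e_def by simp
      moreover have "filterlim h (at 0) sequentially"
      proof (rule filterlim_atI)
        show "h \<longlonglongrightarrow> 0" unfolding h_def by (rule LIMSEQ_inverse_real_of_nat)
        show "\<forall>\<^sub>F n in sequentially. h n \<noteq> 0"
          using h(1) by (intro always_eventually allI) (metis less_irrefl)
      qed
      ultimately have "((\<lambda>n. (f (x + h n *\<^sub>R e) - f (x + 0 *\<^sub>R e)) / (h n - 0)) \<longlongrightarrow> part_deriv i f (x + 0 *\<^sub>R e)) sequentially"
        by (rule filterlim_compose)
      then show "(\<lambda>n. q n x) \<longlonglongrightarrow> part_deriv i f x" by (simp add: q_def add.commute)
    qed
  qed
  moreover have "(\<integral>x. q n x \<partial>lborel) = 0" for n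
  proof -
    have "(\<integral>x. q n x \<partial>lborel) = ((\<integral>x. f (h n *\<^sub>R e + x) \<partial>lborel) - (\<integral>x. f x \<partial>lborel)) / h n"
      unfolding q_def using lborel_integral_shift(1)[OF int] int by simp
    then show ?thesis by (simp add: lborel_integral_shift(2)[OF int])
  qed
  ultimately show ?thesis by (simp add: LIMSEQ_const_iff)
qed

subsection \<open>Test functions\<close>

lemma Cm_fun_Suc_imp: "Cm_fun (Suc m) f \<Longrightarrow> Cm_fun m f"
proof (induction m arbitrary: f)
  case 0
  then show ?case
    by (auto intro!: continuous_at_imp_continuous_on differentiable_imp_continuous_within)
qed auto

lemma Cm_fun_continuous: "Cm_fun m f \<Longrightarrow> continuous_on UNIV f"
  by (induction m) (use Cm_fun_Suc_imp in auto)

lemma Cm_fun_scale: "Cm_fun m f \<Longrightarrow> Cm_fun m (c *\<^sub>R f)"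
proof (induction m arbitrary: f)
  case 0
  then show ?case by (simp add: scaleR_fun_def continuous_intros)
next
  case (Suc m)
  have p: "part_deriv i (c *\<^sub>R f) = c *\<^sub>R part_deriv i f" for i
    using Suc.prems by (simp add: fun_eq_iff part_deriv_scale)
  show ?case unfolding Cm_fun.simps p
  proof (intro conjI allI Suc.IH)
    show "c *\<^sub>R f differentiable (at x)" for x
      using Suc.prems unfolding scaleR_fun_def by (auto intro!: differentiable_scaleR)
  qed (use Suc.prems in simp)
qed

lemma Cm_fun_add: "Cm_fun m f \<Longrightarrow> Cm_fun m g \<Longrightarrow> Cm_fun m (f + g)"
proof (induction m arbitrary: f g)
  case 0
  then show ?case by (simp add: plus_fun_def continuous_intros)
next
  case (Suc m)
  have p: "part_deriv i (f + g) = part_deriv i f + part_deriv i g" for i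
    using Suc.prems by (simp add: fun_eq_iff part_deriv_add)
  show ?case unfolding Cm_fun.simps p
  proof (intro conjI allI Suc.IH)
    show "f + g differentiable (at x)" for x
      using Suc.prems unfolding plus_fun_def by simp
  qed (use Suc.prems in simp_all)
qed

text \<open>Products with affine weights must again be test functions.\<close>

lemma Cm_fun_mult: "Cm_fun m f \<Longrightarrow> Cm_fun m g \<Longrightarrow> Cm_fun m (\<lambda>x. f x * g x)"
proof (induction m arbitrary: f g)
  case 0
  then show ?case by (simp add: continuous_intros)
next
  case (Suc m)
  have p: "part_deriv i (\<lambda>x. f x * g x) = (\<lambda>x. part_deriv i f x * g x) + (\<lambda>x. f x * part_deriv i g x)" for i
    using Suc.prems by (simp add: fun_eq_iff part_deriv_mult)
  show ?case unfolding Cm_fun.simps p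
  proof (intro conjI allI Cm_fun_add Suc.IH)
    show "(\<lambda>x. f x * g x) differentiable (at x)" for x using Suc.prems by simp
  qed (use Suc.prems Cm_fun_Suc_imp[OF Suc.prems(1)] Cm_fun_Suc_imp[OF Suc.prems(2)] in simp_all)
qed

lemma Cm_fun_affine: "Cm_fun m (\<lambda>x. b + g \<bullet> x)"
proof (cases m)
  case (Suc n)
  have const: "Cm_fun n (\<lambda>x::real^'a. c + 0 \<bullet> x)" for n and c :: real
  proof (induction n arbitrary: c)
    case (Suc n)
    have "part_deriv i (\<lambda>x::real^'a. c + 0 \<bullet> x) = (\<lambda>x. 0 + 0 \<bullet> x)" for i
      by (rule ext) (subst part_deriv_affine, simp)
    then show ?case using Suc[of 0] by simp
  qed (simp add: continuous_intros)
  have "part_deriv i (\<lambda>x. b + g \<bullet> x) = (\<lambda>x. g $ i + 0 \<bullet> x)" for i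
    by (rule ext) (subst part_deriv_affine, simp)
  moreover have "(\<lambda>x. b + g \<bullet> x) differentiable (at x)" for x
    by (rule poly_space_differentiable[OF affine_in_poly_space[OF order_refl]])
  ultimately show ?thesis using Suc const[of n] by simp
qed (simp add: continuous_intros)

lemma test_functions_smooth:
  assumes "\<phi> \<in> test_functions \<Omega>"
  shows "Cm_fun m \<phi>" "\<phi> differentiable (at x)" "continuous_on S \<phi>"
proof -
  show c: "Cm_fun m \<phi>" for m using assms by (simp add: test_functions_def)
  show "\<phi> differentiable (at x)" using c[of 1] by simp
  show "continuous_on S \<phi>" using Cm_fun_continuous[OF c] continuous_on_subset by blast
qed

lemma part_deriv_test_functions:
  assumes "\<phi> \<in> test_functions \<Omega>"
  shows "part_deriv i \<phi> \<in> test_functions \<Omega>"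
proof -
  obtain K where K: "compact K" "K \<subseteq> \<Omega>" "\<And>x. x \<notin> K \<Longrightarrow> \<phi> x = 0"
    using assms by (auto simp: test_functions_def)
  have "Cm_fun m (part_deriv i \<phi>)" for m using test_functions_smooth(1)[OF assms, of "Suc m"] by simp
  then show ?thesis
    using K part_deriv_zero_off[OF compact_imp_closed[OF K(1)] K(3)] by (auto simp: test_functions_def)
qed

lemma test_functions_mult:
  assumes "\<phi> \<in> test_functions \<Omega>" "\<And>m. Cm_fun m q"
  shows "(\<lambda>x. q x * \<phi> x) \<in> test_functions \<Omega>"
  using assms unfolding test_functions_def by (auto intro!: Cm_fun_mult)

lemma subspace_test_functions: "subspace (test_functions \<Omega>)"
proof (rule subspaceI)
  have "Cm_fun m (0 :: real^'a \<Rightarrow> real)" for m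
    using Cm_fun_affine[of m 0 0] by (simp add: zero_fun_def)
  then show "0 \<in> test_functions \<Omega>" by (auto simp: test_functions_def intro!: exI[of _ "{}"])
  fix f assume f: "f \<in> test_functions \<Omega>"
  then obtain K where K: "compact K" "K \<subseteq> \<Omega>" "\<And>x. x \<notin> K \<Longrightarrow> f x = 0"
    by (auto simp: test_functions_def)
  show "c *\<^sub>R f \<in> test_functions \<Omega>" for c
    unfolding test_functions_def mem_Collect_eq
    using K test_functions_smooth(1)[OF f]
    by (intro conjI allI Cm_fun_scale exI[of _ K]) auto
  fix g assume g: "g \<in> test_functions \<Omega>"
  obtain L where L: "compact L" "L \<subseteq> \<Omega>" "\<And>x. x \<notin> L \<Longrightarrow> g x = 0" using g by (auto simp: test_functions_def)
  show "f + g \<in> test_functions \<Omega>"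
    unfolding test_functions_def mem_Collect_eq
    using K L test_functions_smooth(1)[OF f] test_functions_smooth(1)[OF g]
    by (intro conjI allI Cm_fun_add exI[of _ "K \<union> L"]) auto
qed

lemma lin_on_part_deriv_test: "lin_on (test_functions \<Omega>) (part_deriv i)"
  by (rule lin_onI) (auto simp: fun_eq_iff part_deriv_add part_deriv_scale test_functions_smooth)

text \<open>The support is a compact subset of \<open>\<Omega>\<close>, so integrating over \<open>\<Omega>\<close> is the same
  as integrating over the whole space.\<close>

lemma integral_test_part_deriv:
  assumes "\<phi> \<in> test_functions \<Omega>"
  shows "(LINT x:\<Omega>|lebesgue. part_deriv i \<phi> x) = 0"
proof -
  obtain K where K: "compact K" "K \<subseteq> \<Omega>" "\<And>x. x \<notin> K \<Longrightarrow> \<phi> x = 0"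
    using assms by (auto simp: test_functions_def)
  have cont: "continuous_on UNIV (part_deriv i \<phi>)"
    by (rule test_functions_smooth(3)[OF part_deriv_test_functions[OF assms]])
  have "(\<lambda>x. indicator \<Omega> x *\<^sub>R part_deriv i \<phi> x) = part_deriv i \<phi>"
  proof
    fix x
    show "indicator \<Omega> x *\<^sub>R part_deriv i \<phi> x = part_deriv i \<phi> x"
    using part_deriv_zero_off[OF compact_imp_closed[OF K(1)] K(3), where x=x and i=i] K(2) by (cases "x \<in> K") auto
  qed
  then have "(LINT x:\<Omega>|lebesgue. part_deriv i \<phi> x) = (\<integral>x. part_deriv i \<phi> x \<partial>lebesgue)"
    unfolding set_lebesgue_integral_def by simp
  also have "\<dots> = (\<integral>x. part_deriv i \<phi> x \<partial>lborel)"
    using borel_measurable_continuous_onI[OF cont] by (intro integral_completion) simp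
  also have "\<dots> = 0" by (rule integral_part_deriv_zero[OF K(1,3) test_functions_smooth(2)[OF assms] cont])
  finally show ?thesis .
qed

subsection \<open>The closure of the test functions\<close>

lemma subspace_L2_space: "subspace (L2_space S)"
proof (rule subspaceI)
  show "0 \<in> L2_space S"
    by (simp add: L2_space_def set_integrable_def set_borel_measurable_def)
  fix f assume f: "f \<in> L2_space S"
  show "c *\<^sub>R f \<in> L2_space S" for c
  proof -
    have "(\<lambda>x. c * (indicator S x *\<^sub>R f x)) \<in> borel_measurable lebesgue"
      using f by (auto simp: L2_space_def set_borel_measurable_def)
    moreover have "set_integrable lebesgue S (\<lambda>x. c\<^sup>2 * (f x)\<^sup>2)"
      using f by (intro set_integrable_mult_right) (simp add: L2_space_def)
    ultimately show ?thesis by (simp add: L2_space_def set_borel_measurable_def power_mult_distrib mult_ac)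
  qed
  fix g assume g: "g \<in> L2_space S"
  have "(\<lambda>x. indicator S x *\<^sub>R f x + indicator S x *\<^sub>R g x) \<in> borel_measurable lebesgue"
    using f g unfolding L2_space_def set_borel_measurable_def by (intro borel_measurable_add) auto
  moreover have "set_integrable lebesgue S (\<lambda>x. ((f x)\<^sup>2 + 2 * (f x * g x)) + (g x)\<^sup>2)"
    using f g L2_space_mult[OF f g]
    by (intro set_integral_add set_integrable_mult_right) (auto simp: L2_space_def)
  ultimately show "f + g \<in> L2_space S"
    by (simp add: L2_space_def set_borel_measurable_def power2_sum distrib_left add_ac mult_ac)
qed

context mesh
begin

lemma test_functions_L2: "\<phi> \<in> test_functions \<Omega> \<Longrightarrow> \<phi> \<in> L2_space \<Omega>"
  by (rule continuous_L2_space[OF test_functions_smooth(3)])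

abbreviation L2sq :: "(real^'d \<Rightarrow> real) \<Rightarrow> real" where
  "L2sq f \<equiv> L2_inner \<Omega> f f"

lemma L2sq_scale: "L2sq (c *\<^sub>R f) = c\<^sup>2 * L2sq f"
  by (simp add: L2_inner_def power2_eq_square mult.assoc mult.left_commute)

lemma L2sq_add_le:
  assumes fg: "f \<in> L2_space \<Omega>" "g \<in> L2_space \<Omega>"
  shows "L2sq (f + g) \<le> 2 * L2sq f + 2 * L2sq g"
proof -
  note B = bilin_on_L2_omega
  have m: "f + g \<in> L2_space \<Omega>" "f - g \<in> L2_space \<Omega>"
    using subspace_add[OF subspace_L2_space fg] subspace_diff[OF subspace_L2_space fg] by auto
  have "L2sq (f + g) = L2sq f + 2 * L2_inner \<Omega> f g + L2sq g"
    using lin_on_add[OF bilin_onD(1)[OF B m(1)] fg] lin_on_add[OF bilin_onD(2)[OF B fg(1)] fg]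
      lin_on_add[OF bilin_onD(2)[OF B fg(2)] fg] L2_inner_sym[of \<Omega> g f] by simp
  moreover have "L2sq (f - g) = L2sq f - 2 * L2_inner \<Omega> f g + L2sq g"
    using lin_on_diff[OF bilin_onD(1)[OF B m(2)] subspace_L2_space fg]
      lin_on_diff[OF bilin_onD(2)[OF B fg(1)] subspace_L2_space fg]
      lin_on_diff[OF bilin_onD(2)[OF B fg(2)] subspace_L2_space fg] L2_inner_sym[of \<Omega> g f] by simp
  ultimately show ?thesis using L2_inner_nonneg[of \<Omega> "f - g"] by linarith
qed

lemma L2_inner_tendsto:
  assumes \<phi>: "\<And>n. \<phi> n \<in> L2_space \<Omega>" and u: "u \<in> L2_space \<Omega>" and w: "w \<in> L2_space \<Omega>"
    and lim: "(\<lambda>n. L2sq (\<phi> n - u)) \<longlonglongrightarrow> 0"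
  shows "(\<lambda>n. L2_inner \<Omega> (\<phi> n) w) \<longlonglongrightarrow> L2_inner \<Omega> u w"
proof -
  have "(L2_inner \<Omega> (\<phi> n - u) w)\<^sup>2 \<le> L2sq (\<phi> n - u) * L2sq w" for n
    using semidef_cauchy_schwarz[OF subspace_L2_space bilin_on_L2_omega L2_inner_sym L2_inner_nonneg
        subspace_diff[OF subspace_L2_space \<phi> u] w] .
  then have le: "\<forall>\<^sub>F n in sequentially. (L2_inner \<Omega> (\<phi> n - u) w)\<^sup>2 \<le> L2sq (\<phi> n - u) * L2sq w"
    by (intro always_eventually allI)
  have lim': "(\<lambda>n. L2sq (\<phi> n - u) * L2sq w) \<longlonglongrightarrow> 0"
    using tendsto_mult_right[OF lim, of "L2sq w"] by simp
  have "(\<lambda>n. (L2_inner \<Omega> (\<phi> n - u) w)\<^sup>2) \<longlonglongrightarrow> 0"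
    by (rule tendsto_sandwich[OF _ le tendsto_const[of 0] lim']) simp
  then have "(\<lambda>n. sqrt ((L2_inner \<Omega> (\<phi> n - u) w)\<^sup>2)) \<longlonglongrightarrow> sqrt 0" by (rule tendsto_real_sqrt)
  then have "(\<lambda>n. L2_inner \<Omega> (\<phi> n - u) w) \<longlonglongrightarrow> 0" by (simp add: tendsto_rabs_zero_iff)
  moreover have "L2_inner \<Omega> (\<phi> n - u) w = L2_inner \<Omega> (\<phi> n) w - L2_inner \<Omega> u w" for n
    by (rule lin_on_diff[OF bilin_onD(2)[OF bilin_on_L2_omega w] subspace_L2_space \<phi> u])
  ultimately show ?thesis by (simp add: LIM_zero_iff)
qed

text \<open>A componentwise form of membership in \<open>H1_zero\<close>: all conditions become statements about
  the scalar \<open>L\<^sup>2\<close> product, to which bilinearity and the Cauchy--Schwarz inequality apply.\<close>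

definition H1_zero_data ::
    "(real^'d \<Rightarrow> real) \<Rightarrow> ('d \<Rightarrow> real^'d \<Rightarrow> real) \<Rightarrow> (nat \<Rightarrow> real^'d \<Rightarrow> real) \<Rightarrow> bool" where
  "H1_zero_data u g \<phi> \<longleftrightarrow> u \<in> L2_space \<Omega> \<and> (\<forall>i. g i \<in> L2_space \<Omega>) \<and>
     (\<forall>\<psi>\<in>test_functions \<Omega>. \<forall>i. L2_inner \<Omega> u (part_deriv i \<psi>) = - L2_inner \<Omega> (g i) \<psi>) \<and>
     (\<forall>n. \<phi> n \<in> test_functions \<Omega>) \<and> (\<lambda>n. L2sq (\<phi> n - u)) \<longlonglongrightarrow> 0 \<and>
     (\<forall>i. (\<lambda>n. L2sq (part_deriv i (\<phi> n) - g i)) \<longlonglongrightarrow> 0)"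

lemma norm_grad_integral:
  assumes "\<phi> \<in> test_functions \<Omega>" "\<And>i. (\<lambda>x. g x $ i) \<in> L2_space \<Omega>"
  shows "(LINT x:\<Omega>|lebesgue. (norm (grad \<phi> x - g x))\<^sup>2)
    = (\<Sum>i\<in>UNIV. L2sq (part_deriv i \<phi> - (\<lambda>x. g x $ i)))"
proof -
  let ?d = "\<lambda>i. part_deriv i \<phi> - (\<lambda>x. g x $ i)"
  have d: "?d i \<in> L2_space \<Omega>" for i
    using subspace_diff[OF subspace_L2_space test_functions_L2[OF part_deriv_test_functions[OF assms(1)]] assms(2)] .
  have "(norm (grad \<phi> x - g x))\<^sup>2 = (\<Sum>i\<in>UNIV. ?d i x * ?d i x)" for x
    by (simp add: power2_norm_eq_inner inner_vec_def grad_def)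
  then have "(LINT x:\<Omega>|lebesgue. (norm (grad \<phi> x - g x))\<^sup>2) = (LINT x:\<Omega>|lebesgue. (\<Sum>i\<in>UNIV. ?d i x * ?d i x))"
    by simp
  also have "\<dots> = (\<Sum>i\<in>UNIV. LINT x:\<Omega>|lebesgue. ?d i x * ?d i x)"
    using L2_space_mult[OF d d] unfolding set_lebesgue_integral_def set_integrable_def
    by (simp only: scaleR_sum_right Bochner_Integration.integral_sum)
  finally show ?thesis by (simp add: L2_inner_def)
qed

lemma H1_zero_iff: "u \<in> H1_zero \<Omega> \<longleftrightarrow> (\<exists>g \<phi>. H1_zero_data u g \<phi>)"
proof
  assume "u \<in> H1_zero \<Omega>"
  then obtain g \<phi> where u: "u \<in> L2_space \<Omega>" and g: "\<And>i. (\<lambda>x. g x $ i) \<in> L2_space \<Omega>"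
    and w: "weak_gradient \<Omega> u g" and \<phi>: "\<And>n. \<phi> n \<in> test_functions \<Omega>"
    and 1: "(\<lambda>n. LINT x:\<Omega>|lebesgue. (\<phi> n x - u x)\<^sup>2) \<longlonglongrightarrow> 0"
    and 2: "(\<lambda>n. LINT x:\<Omega>|lebesgue. (norm (grad (\<phi> n) x - g x))\<^sup>2) \<longlonglongrightarrow> 0"
    unfolding H1_zero_def by blast
  have "(\<lambda>n. L2sq (part_deriv i (\<phi> n) - (\<lambda>x. g x $ i))) \<longlonglongrightarrow> 0" for i
  proof (rule tendsto_sandwich[OF _ _ tendsto_const[of 0] 2])
    show "\<forall>\<^sub>F n in sequentially. L2sq (part_deriv i (\<phi> n) - (\<lambda>x. g x $ i))
        \<le> (LINT x:\<Omega>|lebesgue. (norm (grad (\<phi> n) x - g x))\<^sup>2)"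
      unfolding norm_grad_integral[OF \<phi> g] using L2_inner_nonneg
      by (intro always_eventually allI member_le_sum[of i UNIV]) auto
  qed (simp add: L2_inner_nonneg)
  moreover have "(\<lambda>n. L2sq (\<phi> n - u)) \<longlonglongrightarrow> 0" using 1 by (simp add: L2_inner_def power2_eq_square)
  ultimately have "H1_zero_data u (\<lambda>i x. g x $ i) \<phi>"
    using u g w \<phi> by (simp add: H1_zero_data_def weak_gradient_def)
  then show "\<exists>g \<phi>. H1_zero_data u g \<phi>" by blast
next
  assume "\<exists>g \<phi>. H1_zero_data u g \<phi>"
  then obtain g \<phi> where d: "H1_zero_data u g \<phi>" by blast
  define g' :: "real^'d \<Rightarrow> real^'d" where "g' x = (\<chi> i. g i x)" for x
  have g': "(\<lambda>x. g' x $ i) = g i" for i by (simp add: g'_def)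
  have \<phi>: "\<phi> n \<in> test_functions \<Omega>" for n using d by (simp add: H1_zero_data_def)
  have "(\<lambda>n. \<Sum>i\<in>UNIV. L2sq (part_deriv i (\<phi> n) - g i)) \<longlonglongrightarrow> (\<Sum>i\<in>(UNIV::'d set). 0)"
    using d by (intro tendsto_sum) (simp add: H1_zero_data_def)
  then have "(\<lambda>n. LINT x:\<Omega>|lebesgue. (norm (grad (\<phi> n) x - g' x))\<^sup>2) \<longlonglongrightarrow> 0"
    using norm_grad_integral[OF \<phi>, of g'] d by (simp add: g' H1_zero_data_def)
  moreover have "(\<lambda>n. LINT x:\<Omega>|lebesgue. (\<phi> n x - u x)\<^sup>2) \<longlonglongrightarrow> 0"
    using d by (simp add: H1_zero_data_def L2_inner_def power2_eq_square)
  ultimately show "u \<in> H1_zero \<Omega>"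
    using d unfolding H1_zero_def H1_zero_data_def mem_Collect_eq weak_gradient_def
    by (intro conjI exI[of _ g'] exI[of _ \<phi>]) (simp_all add: g')
qed

lemma subspace_H1_zero: "subspace (H1_zero \<Omega>)"
proof (rule subspaceI)
  note L = subspace_L2_space[of \<Omega>] and Tt = subspace_test_functions[of \<Omega>]
  have z: "L2_inner \<Omega> 0 f = 0" for f :: "real^'d \<Rightarrow> real" by (simp add: L2_inner_def)
  have p0: "part_deriv i (0 :: real^'d \<Rightarrow> real) = 0" for i
    by (rule lin_on_zero[OF lin_on_part_deriv_test subspace_0[OF Tt]])
  have "H1_zero_data 0 0 0"
    by (simp add: H1_zero_data_def subspace_0[OF L] subspace_0[OF Tt] z p0)
  then show "0 \<in> H1_zero \<Omega>" using H1_zero_iff by blast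
  fix u assume "u \<in> H1_zero \<Omega>"
  then obtain g \<phi> where u: "H1_zero_data u g \<phi>" using H1_zero_iff by blast
  note u' = u[unfolded H1_zero_data_def]
  show "c *\<^sub>R u \<in> H1_zero \<Omega>" for c
  proof -
    have "L2_inner \<Omega> (c *\<^sub>R f) h = c * L2_inner \<Omega> f h" for f h :: "real^'d \<Rightarrow> real"
      by (simp add: L2_inner_def mult.assoc)
    moreover have "(\<lambda>n. c\<^sup>2 * L2sq (\<phi> n - u)) \<longlonglongrightarrow> 0"
      "(\<lambda>n. c\<^sup>2 * L2sq (part_deriv i (\<phi> n) - g i)) \<longlonglongrightarrow> 0" for i
      using u' by (auto intro!: tendsto_mult_right_zero)
    moreover have "part_deriv i (c *\<^sub>R \<phi> n) - c *\<^sub>R g i = c *\<^sub>R (part_deriv i (\<phi> n) - g i)"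
      "c *\<^sub>R \<phi> n - c *\<^sub>R u = c *\<^sub>R (\<phi> n - u)" for i n
      using lin_on_scale[OF lin_on_part_deriv_test[of \<Omega> i], of "\<phi> n" c] u'
      by (simp_all only: scaleR_diff_right)
    ultimately have "H1_zero_data (c *\<^sub>R u) (\<lambda>i. c *\<^sub>R g i) (\<lambda>n. c *\<^sub>R \<phi> n)"
      using u' unfolding H1_zero_data_def
      by (simp only: L2sq_scale subspace_scale[OF L] subspace_scale[OF Tt]) simp
    then show ?thesis using H1_zero_iff by blast
  qed
  fix v assume "v \<in> H1_zero \<Omega>"
  then obtain h \<psi> where v: "H1_zero_data v h \<psi>" using H1_zero_iff by blast
  note v' = v[unfolded H1_zero_data_def]
  have sum_lim: "(\<lambda>n. L2sq (a n + b n)) \<longlonglongrightarrow> 0"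
    if "(\<lambda>n. L2sq (a n)) \<longlonglongrightarrow> 0" "(\<lambda>n. L2sq (b n)) \<longlonglongrightarrow> 0" "\<And>n. a n \<in> L2_space \<Omega>" "\<And>n. b n \<in> L2_space \<Omega>"
    for a b :: "nat \<Rightarrow> real^'d \<Rightarrow> real"
  proof (rule tendsto_sandwich[OF _ _ tendsto_const[of 0]])
    show "(\<lambda>n. 2 * L2sq (a n) + 2 * L2sq (b n)) \<longlonglongrightarrow> 0"
      using tendsto_add[OF tendsto_mult_right_zero[OF that(1), of 2] tendsto_mult_right_zero[OF that(2), of 2]] by simp
    show "\<forall>\<^sub>F n in sequentially. 0 \<le> L2sq (a n + b n)"
      by (intro always_eventually allI L2_inner_nonneg)
    show "\<forall>\<^sub>F n in sequentially. L2sq (a n + b n) \<le> 2 * L2sq (a n) + 2 * L2sq (b n)"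
      by (intro always_eventually allI L2sq_add_le that(3,4))
  qed
  have T2: "part_deriv i f \<in> L2_space \<Omega>" "f \<in> L2_space \<Omega>" if "f \<in> test_functions \<Omega>" for f i
    using that part_deriv_test_functions test_functions_L2 by blast+
  have "H1_zero_data (u + v) (\<lambda>i. g i + h i) (\<lambda>n. \<phi> n + \<psi> n)"
    unfolding H1_zero_data_def
  proof (intro conjI allI ballI)
    show "u + v \<in> L2_space \<Omega>" "g i + h i \<in> L2_space \<Omega>" "\<phi> n + \<psi> n \<in> test_functions \<Omega>" for i n
      using u' v' by (simp_all add: subspace_add[OF L] subspace_add[OF Tt])
    show "L2_inner \<Omega> (u + v) (part_deriv i \<theta>) = - L2_inner \<Omega> (g i + h i) \<theta>" if "\<theta> \<in> test_functions \<Omega>" for \<theta> i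
    proof -
      have gi: "g i \<in> L2_space \<Omega>" "h i \<in> L2_space \<Omega>" "u \<in> L2_space \<Omega>" "v \<in> L2_space \<Omega>"
        using u' v' by auto
      show ?thesis
        using lin_on_add[OF bilin_onD(2)[OF bilin_on_L2_omega T2(1)[OF that]] gi(3,4)]
          lin_on_add[OF bilin_onD(2)[OF bilin_on_L2_omega T2(2)[OF that]] gi(1,2)] u' v' that by simp
    qed
    have e: "\<phi> n + \<psi> n - (u + v) = (\<phi> n - u) + (\<psi> n - v)" for n by simp
    show "(\<lambda>n. L2sq (\<phi> n + \<psi> n - (u + v))) \<longlonglongrightarrow> 0"
      unfolding e by (rule sum_lim) (use u' v' in \<open>simp_all add: subspace_diff[OF L] T2\<close>)
    fix i
    have e: "part_deriv i (\<phi> n + \<psi> n) - (g i + h i) = (part_deriv i (\<phi> n) - g i) + (part_deriv i (\<psi> n) - h i)" for n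
      using lin_on_add[OF lin_on_part_deriv_test, of "\<phi> n" \<Omega> "\<psi> n" i] u' v' by simp
    show "(\<lambda>n. L2sq (part_deriv i (\<phi> n + \<psi> n) - (g i + h i))) \<longlonglongrightarrow> 0"
      unfolding e by (rule sum_lim) (use u' v' in \<open>simp_all add: subspace_diff[OF L] T2\<close>)
  qed
  then show "u + v \<in> H1_zero \<Omega>" using H1_zero_iff by blast
qed

lemma integration_by_parts:
  assumes \<phi>: "\<phi> \<in> test_functions \<Omega>" and q: "\<And>m. Cm_fun m q"
  shows "L2_inner \<Omega> (part_deriv i \<phi>) q = - L2_inner \<Omega> \<phi> (part_deriv i q)"
proof -
  have d: "q differentiable (at x)" for x using q[of 1] by simp
  have c: "continuous_on S q" "continuous_on S (part_deriv i q)" for S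
    using Cm_fun_continuous[OF q] Cm_fun_continuous[of 0 "part_deriv i q"] q[of 1]
    by (auto intro: continuous_on_subset)
  note t = test_functions_L2[OF \<phi>] test_functions_L2[OF part_deriv_test_functions[OF \<phi>, of i]]
  have "0 = (LINT x:\<Omega>|lebesgue. part_deriv i (\<lambda>x. q x * \<phi> x) x)"
    using integral_test_part_deriv[OF test_functions_mult[OF \<phi> q]] by simp
  also have "part_deriv i (\<lambda>x. q x * \<phi> x) = (\<lambda>x. part_deriv i \<phi> x * q x + \<phi> x * part_deriv i q x)"
    by (rule ext) (subst part_deriv_mult[OF d test_functions_smooth(2)[OF \<phi>]], simp)
  also have "(LINT x:\<Omega>|lebesgue. part_deriv i \<phi> x * q x + \<phi> x * part_deriv i q x)
      = L2_inner \<Omega> (part_deriv i \<phi>) q + L2_inner \<Omega> \<phi> (part_deriv i q)"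
    unfolding L2_inner_def inner_real_def
    by (rule set_integral_add(2)[OF L2_space_mult[OF t(2) continuous_L2_space[OF c(1)]]
          L2_space_mult[OF t(1) continuous_L2_space[OF c(2)]]])
  finally show ?thesis by simp
qed

lemma L2_cong_omega:
  "(\<And>x. x \<in> \<Omega> \<Longrightarrow> f x = f' x) \<Longrightarrow> (\<And>x. x \<in> \<Omega> \<Longrightarrow> h x = h' x) \<Longrightarrow> L2_inner \<Omega> f h = L2_inner \<Omega> f' h'"
  unfolding L2_inner_eq_ip by (rule L2_ip_cong)

lemma continuous_mult_L2:
  assumes w: "continuous_on UNIV w" and g: "g \<in> L2_space \<Omega>"
  shows "(\<lambda>x. w x * g x) \<in> L2_space \<Omega>"
proof -
  have "bounded (w ` closure \<Omega>)"
    using closure_compact w by (meson compact_continuous_image compact_imp_bounded continuous_on_subset subset_UNIV)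
  then obtain M where M: "\<And>x. x \<in> closure \<Omega> \<Longrightarrow> \<bar>w x\<bar> \<le> M" unfolding bounded_iff by auto
  have wm: "w \<in> borel_measurable lebesgue"
    using borel_measurable_continuous_onI[OF w] by (simp add: measurable_completion)
  have m: "(\<lambda>x. w x * (indicator \<Omega> x *\<^sub>R g x)) \<in> borel_measurable lebesgue"
    using g wm unfolding L2_space_def set_borel_measurable_def by (intro borel_measurable_times) auto
  have "set_integrable lebesgue \<Omega> (\<lambda>x. (w x * g x)\<^sup>2)"
    unfolding set_integrable_def
  proof (rule Bochner_Integration.integrable_bound)
    show "integrable lebesgue (\<lambda>x. M\<^sup>2 * (indicator \<Omega> x *\<^sub>R (g x)\<^sup>2))"
      using g by (intro integrable_mult_right) (simp add: L2_space_def set_integrable_def)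
    have "(\<lambda>x. (w x * (indicator \<Omega> x *\<^sub>R g x))\<^sup>2) = (\<lambda>x. indicator \<Omega> x *\<^sub>R (w x * g x)\<^sup>2)"
      by (auto simp: indicator_def)
    then show "(\<lambda>x. indicator \<Omega> x *\<^sub>R (w x * g x)\<^sup>2) \<in> borel_measurable lebesgue"
      using borel_measurable_power[OF m, of 2] by simp
    have "(w x * g x)\<^sup>2 \<le> M\<^sup>2 * (g x)\<^sup>2" if "x \<in> \<Omega>" for x
    proof -
      have "\<bar>w x\<bar> \<le> M" using M closure_subset that by blast
      then have "(w x)\<^sup>2 \<le> M\<^sup>2" by (metis abs_ge_zero power2_abs power_mono)
      then show ?thesis by (simp add: power_mult_distrib mult_right_mono)
    qed
    then show "AE x in lebesgue. norm (indicator \<Omega> x *\<^sub>R (w x * g x)\<^sup>2) \<le> norm (M\<^sup>2 * (indicator \<Omega> x *\<^sub>R (g x)\<^sup>2))"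
      by (intro AE_I2) (auto simp: indicator_def)
  qed
  then show ?thesis using m by (simp add: L2_space_def set_borel_measurable_def mult.left_commute)
qed

text \<open>Let \<open>g\<close> be the weak gradient of \<open>u\<close> and \<open>w = \<beta> + \<gamma> \<bullet> x\<close>. Integration by parts
  for the approximating test functions gives, in the limit,
  \<open>(g\<^sub>i, u w) = - (u, a\<^sub>i w + \<gamma>\<^sub>i u)\<close>. Testing the weak gradient with
  \<open>w\<close> times these functions gives \<open>(g\<^sub>i, u w) = (u, a\<^sub>i w)\<close>, because
  \<open>u\<close> is affine. The identity is the difference.\<close>

lemma H1_zero_affine_identity:
  assumes u: "u \<in> H1_zero \<Omega>" and A: "\<And>x. x \<in> \<Omega> \<Longrightarrow> u x = b + a \<bullet> x"
  shows "2 * (a $ i) * L2_inner \<Omega> u (\<lambda>x. \<beta> + \<gamma> \<bullet> x) = - (\<gamma> $ i) * L2sq u"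
proof -
  obtain g \<phi> where "H1_zero_data u g \<phi>" using u H1_zero_iff by blast
  note d = this[unfolded H1_zero_data_def]
  let ?A = "\<lambda>x. b + a \<bullet> x" and ?w = "\<lambda>x. \<beta> + \<gamma> \<bullet> x"
  have uL: "u \<in> L2_space \<Omega>" and gL: "g i \<in> L2_space \<Omega>" and \<phi>: "\<phi> n \<in> test_functions \<Omega>" for n
    using d by auto
  have c: "continuous_on S ?w" "continuous_on S ?A" for S by (intro continuous_intros)+
  have Aw: "Cm_fun m (\<lambda>x. ?A x * ?w x)" for m by (intro Cm_fun_mult Cm_fun_affine)
  have df: "(\<lambda>x. b' + g' \<bullet> x) differentiable (at x)" for b' x and g' :: "real^'d"
    by (rule poly_space_differentiable[OF affine_in_poly_space[OF order_refl]])
  have pAw: "part_deriv i (\<lambda>x. ?A x * ?w x) = (\<lambda>x. a $ i * ?w x + \<gamma> $ i * ?A x)"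
    by (rule ext) (simp add: part_deriv_mult[OF df df] part_deriv_affine mult.commute)
  have cont_pAw: "continuous_on S (\<lambda>x. a $ i * ?w x + \<gamma> $ i * ?A x)" for S
    by (intro continuous_intros)
  \<comment> \<open>Integration by parts against the smooth factor \<open>A w\<close>, in the limit.\<close>
  have \<phi>L: "\<phi> n \<in> L2_space \<Omega>" "part_deriv i (\<phi> n) \<in> L2_space \<Omega>" for n
    using \<phi> test_functions_L2 part_deriv_test_functions by blast+
  have lim: "(\<lambda>n. L2sq (\<phi> n - u)) \<longlonglongrightarrow> 0" "(\<lambda>n. L2sq (part_deriv i (\<phi> n) - g i)) \<longlonglongrightarrow> 0"
    using d by auto
  have "continuous_on S (\<lambda>x. ?A x * ?w x)" for S by (intro continuous_intros)
  then have AwL: "(\<lambda>x. ?A x * ?w x) \<in> L2_space \<Omega>" by (rule continuous_L2_space)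
  note l1 = L2_inner_tendsto[OF \<phi>L(2) gL AwL lim(2)]
  note l2 = tendsto_minus[OF L2_inner_tendsto[OF \<phi>L(1) uL continuous_L2_space[OF cont_pAw] lim(1)]]
  have 1: "L2_inner \<Omega> (g i) (\<lambda>x. ?A x * ?w x) = - L2_inner \<Omega> u (\<lambda>x. a $ i * ?w x + \<gamma> $ i * ?A x)"
    using LIMSEQ_unique[OF l1] l2 integration_by_parts[OF \<phi> Aw] by (simp add: pAw)
  \<comment> \<open>The weak gradient tested with \<open>w \<phi>\<^sub>n\<close>, in the limit.\<close>
  have "L2_inner \<Omega> (\<phi> n) (\<lambda>x. ?w x * g i x) = L2_inner \<Omega> (\<phi> n) (\<lambda>x. a $ i * ?w x)" for n
  proof -
    let ?\<psi> = "\<lambda>x. ?w x * \<phi> n x"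
    have \<psi>: "?\<psi> \<in> test_functions \<Omega>" by (rule test_functions_mult[OF \<phi> Cm_fun_affine])
    have "- L2_inner \<Omega> (g i) ?\<psi> = L2_inner \<Omega> u (part_deriv i ?\<psi>)" using d \<psi> by simp
    also have "\<dots> = L2_inner \<Omega> ?A (part_deriv i ?\<psi>)" by (rule L2_cong_omega) (auto simp: A)
    also have "\<dots> = L2_inner \<Omega> (part_deriv i ?\<psi>) ?A" by (rule L2_inner_sym)
    also have "\<dots> = - L2_inner \<Omega> ?\<psi> (part_deriv i ?A)" by (rule integration_by_parts[OF \<psi> Cm_fun_affine])
    also have "part_deriv i ?A = (\<lambda>x. a $ i)" by (rule ext) (rule part_deriv_affine)
    finally show ?thesis by (simp add: L2_inner_def mult_ac)
  qed
  moreover have "(\<lambda>n. L2_inner \<Omega> (\<phi> n) (\<lambda>x. ?w x * g i x)) \<longlonglongrightarrow> L2_inner \<Omega> u (\<lambda>x. ?w x * g i x)"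
    by (rule L2_inner_tendsto[OF \<phi>L(1) uL continuous_mult_L2[OF c(1) gL] lim(1)])
  moreover have "(\<lambda>n. L2_inner \<Omega> (\<phi> n) (\<lambda>x. a $ i * ?w x)) \<longlonglongrightarrow> L2_inner \<Omega> u (\<lambda>x. a $ i * ?w x)"
    by (rule L2_inner_tendsto[OF \<phi>L(1) uL _ lim(1)]) (intro continuous_L2_space continuous_intros)
  ultimately have "L2_inner \<Omega> u (\<lambda>x. ?w x * g i x) = L2_inner \<Omega> u (\<lambda>x. a $ i * ?w x)"
    using LIMSEQ_unique by simp
  moreover have "L2_inner \<Omega> u (\<lambda>x. ?w x * g i x) = L2_inner \<Omega> (g i) (\<lambda>x. ?A x * ?w x)"
  proof -
    have "L2_inner \<Omega> u (\<lambda>x. ?w x * g i x) = L2_inner \<Omega> ?A (\<lambda>x. ?w x * g i x)"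
      by (rule L2_cong_omega) (auto simp: A)
    then show ?thesis by (simp add: L2_inner_def mult_ac)
  qed
  ultimately have 2: "L2_inner \<Omega> u (\<lambda>x. a $ i * ?w x) = - L2_inner \<Omega> u (\<lambda>x. a $ i * ?w x + \<gamma> $ i * ?A x)"
    using 1 by simp
  have wL: "?w \<in> L2_space \<Omega>" "?A \<in> L2_space \<Omega>" using c continuous_L2_space by blast+
  note lu = lin_on_L2_space_omega[OF uL]
  have e: "(\<lambda>x. a $ i * ?w x) = a $ i *\<^sub>R ?w" "(\<lambda>x. \<gamma> $ i * ?A x) = \<gamma> $ i *\<^sub>R ?A"
    by (simp_all add: scaleR_fun_def)
  have e2: "(\<lambda>x. a $ i * ?w x + \<gamma> $ i * ?A x) = a $ i *\<^sub>R ?w + \<gamma> $ i *\<^sub>R ?A"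
    by (simp add: fun_eq_iff)
  have "L2_inner \<Omega> u ?A = L2sq u" by (rule L2_cong_omega) (auto simp: A)
  then show ?thesis
    using 2 wL unfolding e e2
    by (simp add: lin_on_scale[OF lu] lin_on_add[OF lu] subspace_scale[OF subspace_L2_space])
qed

text \<open>In the identity above take \<open>w = u\<close> if some \<open>a\<^sub>i\<close> is nonzero, which gives
  \<open>3 a\<^sub>i \<parallel>u\<parallel>\<^sup>2 = 0\<close>, and
  \<open>w = x\<^sub>i\<close> if \<open>u\<close> is constant.\<close>

lemma H1_zero_affine:
  assumes u: "u \<in> H1_zero \<Omega>" and A: "\<And>x. x \<in> \<Omega> \<Longrightarrow> u x = b + a \<bullet> x" and x: "x \<in> \<Omega>"
  shows "u x = 0"
proof -
  let ?A = "\<lambda>x. b + a \<bullet> x"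
  have uA: "L2_inner \<Omega> u ?A = L2sq u" by (rule L2_cong_omega) (auto simp: A)
  have "L2sq u = 0"
  proof (cases "a = 0")
    case True
    then show ?thesis
      using H1_zero_affine_identity[OF u A, where i=undefined and \<beta>=0 and \<gamma>="axis undefined 1"] by simp
  next
    case False
    then obtain i where "a $ i \<noteq> 0" by (auto simp: vec_eq_iff)
    then show ?thesis
      using H1_zero_affine_identity[OF u A, where i=i and \<beta>=b and \<gamma>=a] uA by simp
  qed
  moreover have "L2sq u = L2_inner \<Omega> ?A ?A" by (rule L2_cong_omega) (auto simp: A)
  moreover have "L2_inner (closure \<Omega>) ?A ?A = L2_inner \<Omega> ?A ?A"
    unfolding L2_inner_def
  proof (rule set_integral_spike(2)[OF closure_subset])
    show "negligible (closure \<Omega> - \<Omega>)"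
      using negligible_convex_frontier[OF omega(4)] omega(2) by (simp add: frontier_def interior_open)
    show "set_integrable lebesgue \<Omega> (\<lambda>x. ?A x \<bullet> ?A x)"
      by (intro set_integrable_omega continuous_intros)
  qed
  ultimately have z: "L2_ip lebesgue (closure \<Omega>) ?A ?A = 0" by (simp add: L2_inner_eq_ip)
  have "?A x = 0"
    by (rule L2_ip_zero[OF full_support_on_closure _ z])
      (use x closure_subset in \<open>auto intro!: continuous_intros\<close>)
  then show ?thesis using A[OF x] by simp
qed

end

section \<open>Gluing affine pieces\<close>

lemma negligible_low_dim:
  fixes S :: "'a::euclidean_space set"
  assumes "aff_dim S < int DIM('a)"
  shows "negligible S"
proof -
  obtain a b where "a \<noteq> 0" "S \<subseteq> {x. a \<bullet> x = b}" using aff_lowdim_subset_hyperplane[OF assms] by blast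
  then show ?thesis using negligible_hyperplane negligible_subset by blast
qed

lemma affine_zero_on:
  fixes S :: "(real^'d::finite) set"
  assumes "\<And>x. x \<in> S \<Longrightarrow> b + g \<bullet> x = 0" "interior S \<noteq> {}"
  shows "g = 0"
proof -
  have "(\<lambda>x. b + g \<bullet> x) = 0"
    by (rule poly_space_identity[OF affine_in_poly_space[OF order_refl] _ assms(2)]) (rule assms(1))
  then have "b + g \<bullet> 0 = 0" "b + g \<bullet> g = 0" by (simp_all only: fun_eq_iff) simp_all
  then show ?thesis by simp
qed

context mesh
begin

text \<open>A proper face has smaller dimension, which leaves codimension one as the only possibility.\<close>

lemma mesh_intersection:
  assumes T: "T \<in> \<T>" "T' \<in> \<T>" and ne: "T \<noteq> T'"
    and dim: "aff_dim (T \<inter> T') > int CARD('d) - 2" and x: "x \<in> T \<inter> T'"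
  shows "(T \<inter> T') facet_of T" "(T \<inter> T') facet_of T'"
proof -
  have f: "T \<inter> T' face_of T" "T \<inter> T' face_of T'"
    using cells(4)[OF T] cells(4)[OF T(2,1)] by (auto simp: Int_commute)
  note p = full_simplex_props[OF cells(2)[OF T(1)]] full_simplex_props[OF cells(2)[OF T(2)]]
  have "T \<inter> T' \<noteq> T \<or> T \<inter> T' \<noteq> T'" using ne by blast
  then have "aff_dim (T \<inter> T') < int CARD('d)"
    using face_of_aff_dim_lt[OF p(2) f(1)] face_of_aff_dim_lt[OF p(9) f(2)] p(5) p(12) by auto
  then have "aff_dim (T \<inter> T') = int CARD('d) - 1" using dim by simp
  then show "(T \<inter> T') facet_of T" "(T \<inter> T') facet_of T'"
    using f x p(5) p(12) unfolding facet_of_def by auto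
qed

text \<open>Distinct cells meet in sets of codimension at least two unless they share a facet; a generic
  segment avoids these sets, and along it the affine piece is locally constant.\<close>

lemma affine_gluing:
  assumes v: "continuous_on (closure \<Omega>) v"
    and aff: "\<And>T x. T \<in> \<T> \<Longrightarrow> x \<in> T \<Longrightarrow> v x = \<beta> T + \<gamma> T \<bullet> x"
    and match: "\<And>T T'. T \<in> \<T> \<Longrightarrow> T' \<in> \<T> \<Longrightarrow> (T \<inter> T') facet_of T \<Longrightarrow> (T \<inter> T') facet_of T' \<Longrightarrow> \<gamma> T = \<gamma> T'"
  shows "\<exists>b a. \<forall>x\<in>\<Omega>. v x = b + a \<bullet> x"
proof -
  \<comment> \<open>The intersections of codimension at least two, which the segments must avoid.\<close>
  define \<G> where "\<G> = {C \<in> (\<lambda>(T, T'). T \<inter> T') ` (\<T> \<times> \<T>). aff_dim C \<le> int CARD('d) - 2}"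
  have finG: "finite \<G>" using cells(1) by (simp add: \<G>_def)
  have piece: "(\<beta> T, \<gamma> T) = (\<beta> T', \<gamma> T')"
    if T: "T \<in> \<T>" "T' \<in> \<T>" and x: "x \<in> T \<inter> T'" "x \<notin> \<Union>\<G>" for T T' x
  proof (cases "T = T'")
    case False
    have "T \<inter> T' \<notin> \<G>" using x by blast
    then have "aff_dim (T \<inter> T') > int CARD('d) - 2" using T by (auto simp: \<G>_def)
    then have "\<gamma> T = \<gamma> T'" using mesh_intersection[OF T False _ x(1)] match[OF T] by blast
    then show ?thesis using aff[OF T(1), of x] aff[OF T(2), of x] x by simp
  qed simp
  define pick where "pick x = (SOME T. T \<in> \<T> \<and> x \<in> T)" for x
  have pick: "pick x \<in> \<T> \<and> x \<in> pick x" if "x \<in> closure \<Omega>" for x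
    unfolding pick_def by (rule someI_ex) (use that cells(3) in auto)
  define \<phi> where "\<phi> x = (\<beta> (pick x), \<gamma> (pick x))" for x
  have phi: "\<phi> x = (\<beta> T, \<gamma> T)" if "T \<in> \<T>" "x \<in> T" "x \<notin> \<Union>\<G>" for x T
  proof -
    have "x \<in> closure \<Omega>" using that cells(3) by blast
    then show ?thesis unfolding \<phi>_def using piece[of "pick x" T x] pick that by blast
  qed
  \<comment> \<open>Near \<open>x\<close> only the finitely many cells through \<open>x\<close> occur.\<close>
  have nhd: "\<exists>U. open U \<and> x \<in> U \<and> (\<forall>x'\<in>U. \<forall>T\<in>\<T>. x' \<in> T \<longrightarrow> x \<in> T)" for x
  proof (intro exI conjI)
    let ?U = "- \<Union>{T \<in> \<T>. x \<notin> T}"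
    have "closed (\<Union>{T \<in> \<T>. x \<notin> T})"
      using cells(1,2) full_simplex_props(1) by (intro closed_Union) (auto intro: compact_imp_closed)
    then show "open ?U" by (rule open_Compl)
  qed auto
  have seg: "\<phi> x = \<phi> y" if S: "closed_segment x y \<subseteq> closure \<Omega> - \<Union>\<G>" for x y
  proof -
    have "\<phi> constant_on closed_segment x y"
    proof (rule locally_constant_imp_constant)
      show "connected (closed_segment x y)" by simp
      fix z assume z: "z \<in> closed_segment x y"
      obtain U where U: "open U" "z \<in> U" "\<And>x' T. x' \<in> U \<Longrightarrow> T \<in> \<T> \<Longrightarrow> x' \<in> T \<Longrightarrow> z \<in> T"
        using nhd[of z] by blast
      have "\<phi> z' = \<phi> z" if "z' \<in> closed_segment x y \<inter> U" for z'
      proof -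
        have m: "z' \<in> closure \<Omega>" "z' \<notin> \<Union>\<G>" "z \<notin> \<Union>\<G>" using S z that by auto
        obtain T where T: "T \<in> \<T>" "z' \<in> T" using pick[OF m(1)] by blast
        then have "z \<in> T" using U(3) that by blast
        then show ?thesis using phi[OF T m(2)] phi[OF T(1) _ m(3)] by simp
      qed
      then show "\<exists>V. openin (top_of_set (closed_segment x y)) V \<and> z \<in> V \<and> (\<forall>z'\<in>V. \<phi> z' = \<phi> z)"
        using U(2) z openin_open_Int[OF U(1), of "closed_segment x y"]
        by (intro exI[of _ "closed_segment x y \<inter> U"] conjI) blast+
    qed
    then obtain c where "\<And>z. z \<in> closed_segment x y \<Longrightarrow> \<phi> z = c"
      unfolding constant_on_def by blast
    then show ?thesis by simp
  qed
  have nG: "negligible (\<Union>\<G>)"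
    using finG by (intro negligible_Union) (auto simp: \<G>_def intro: negligible_low_dim)
  obtain x0 where x0: "x0 \<in> \<Omega>" "x0 \<notin> \<Union>\<G>"
    using negligible_subset[OF nG, of \<Omega>] open_not_negligible[OF omega(2,1)] by blast
  \<comment> \<open>If the segment from \<open>x0\<close> to \<open>y\<close> meets \<open>C\<close>, then \<open>y\<close> lies in the affine span of \<open>x0\<close> and \<open>C\<close>.\<close>
  define N where "N = (\<Union>C\<in>\<G>. affine hull (insert x0 C))"
  have nN: "negligible N"
    unfolding N_def
  proof (rule negligible_Union)
    show "negligible S" if "S \<in> (\<lambda>C. affine hull (insert x0 C)) ` \<G>" for S
      using that by (intro negligible_low_dim) (auto simp: \<G>_def aff_dim_insert)
  qed (use finG in simp)
  define b a where "b = \<beta> (pick x0)" and "a = \<gamma> (pick x0)"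
  have generic: "v y = b + a \<bullet> y" if y: "y \<in> \<Omega>" "y \<notin> N" for y
  proof -
    have "closed_segment x0 y \<subseteq> closure \<Omega> - \<Union>\<G>"
    proof
      fix z assume z: "z \<in> closed_segment x0 y"
      have "z \<in> \<Omega>" using z x0(1) y(1) omega(4) by (meson closed_segment_subset subsetD)
      moreover have "z \<notin> \<Union>\<G>"
      proof
        assume "z \<in> \<Union>\<G>"
        then obtain C where C: "C \<in> \<G>" "z \<in> C" by blast
        obtain t where t: "z = (1 - t) *\<^sub>R x0 + t *\<^sub>R y" using z by (auto simp: in_segment)
        have "t \<noteq> 0" using t x0(2) C by auto
        then have "y = (1 - 1 / t) *\<^sub>R x0 + (1 / t) *\<^sub>R z"
          by (simp add: t scaleR_add_right scaleR_diff_left algebra_simps)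
        moreover have "x0 \<in> affine hull (insert x0 C)" "z \<in> affine hull (insert x0 C)"
          using C(2) by (auto intro: hull_inc)
        ultimately have "y \<in> affine hull (insert x0 C)"
          using affine_affine_hull[of "insert x0 C"] by (simp add: affine_alt)
        then show False using y(2) C(1) by (auto simp: N_def)
      qed
      ultimately show "z \<in> closure \<Omega> - \<Union>\<G>" using closure_subset by blast
    qed
    from seg[OF this] have "\<phi> y = (b, a)" by (simp add: \<phi>_def b_def a_def)
    moreover have "y \<in> closure \<Omega>" using y closure_subset by blast
    ultimately show ?thesis using aff[of "pick y" y] pick[of y] by (simp add: \<phi>_def)
  qed
  have "v y = b + a \<bullet> y" if "y \<in> \<Omega>" for y
  proof (rule ccontr)
    assume "v y \<noteq> b + a \<bullet> y"
    define W where "W = \<Omega> \<inter> (\<lambda>x. v x - (b + a \<bullet> x)) -` (- {0})"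
    have "continuous_on \<Omega> (\<lambda>x. v x - (b + a \<bullet> x))"
      using continuous_on_subset[OF v closure_subset] by (intro continuous_intros)
    then have "open W" unfolding W_def by (intro continuous_open_preimage omega(2)) auto
    moreover have "y \<in> W" using that \<open>v y \<noteq> _\<close> by (simp add: W_def)
    moreover have "W \<subseteq> N" using generic by (auto simp: W_def)
    ultimately show False using nN negligible_subset open_not_negligible by blast
  qed
  then show ?thesis by blast
qed

lemma PW_eq_zero:
  assumes v: "v \<in> PW l" and zero: "\<And>x. x \<in> \<Omega> \<Longrightarrow> v x = 0"
  shows "v = 0"
proof
  fix x
  have "v x = 0" if "x \<in> closure \<Omega>"
    by (rule continuous_constant_on_closure[OF PW_continuous[OF v] zero that])
  moreover have "v x = 0" if "x \<notin> closure \<Omega>"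
    using v that cells(3) by (simp add: cont_pw_poly_space_def)
  ultimately show "v x = 0 x" by auto
qed

lemma PW_H1_zero_affine:
  assumes v: "v \<in> PW l" "v \<in> H1_zero \<Omega>"
    and aff: "\<And>T x. T \<in> \<T> \<Longrightarrow> x \<in> T \<Longrightarrow> v x = \<beta> T + \<gamma> T \<bullet> x"
    and match: "\<And>T T'. T \<in> \<T> \<Longrightarrow> T' \<in> \<T> \<Longrightarrow> (T \<inter> T') facet_of T \<Longrightarrow> (T \<inter> T') facet_of T' \<Longrightarrow> \<gamma> T = \<gamma> T'"
  shows "v = 0"
proof -
  have "\<exists>b a. \<forall>x\<in>\<Omega>. v x = b + a \<bullet> x"
    by (rule affine_gluing[OF PW_continuous[OF v(1)], where \<beta>=\<beta> and \<gamma>=\<gamma>]) (fact aff, fact match)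
  then obtain b a where "\<And>x. x \<in> \<Omega> \<Longrightarrow> v x = b + a \<bullet> x" by blast
  then show ?thesis using H1_zero_affine[OF v(2)] PW_eq_zero[OF v(1)] by blast
qed

section \<open>Well-posedness\<close>

lemma V_space_subset: "V_space \<Omega> \<T> k \<subseteq> pair_space k"
  by (auto simp: V_space_def)

text \<open>The normal component of the gradient on a facet is read off from the face unknown, and the
  tangential part from the continuity of \<open>v\<close>; together they make the gradients of neighbouring
  cells equal. Once \<open>v = 0\<close>, the face unknowns are normal derivatives of zero.\<close>

lemma a_form_definite:
  assumes \<nu>: "\<And>F. F \<in> mesh_faces \<T> \<Longrightarrow> unit_normal F (\<nu> F)"
    and s: "s \<in> V_space \<Omega> \<T> k" "a_form \<nu> \<T> k s s = 0"
  shows "s = 0"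
proof -
  obtain v \<eta> where veta: "s = (v, \<eta>)" by (cases s)
  have sp: "s \<in> pair_space k" using s(1) V_space_subset by blast
  let ?P = "\<lambda>T b g. (\<forall>x\<in>T. v x = b + g \<bullet> x) \<and>
      (\<forall>F x. F facet_of T \<longrightarrow> x \<in> F \<longrightarrow> (\<nu> F \<bullet> outward_normal T F) * \<eta> F x = g \<bullet> outward_normal T F)"
  have ex: "\<exists>b g. ?P T b g" if T: "T \<in> \<T>" for T
  proof -
    obtain b g where "\<And>x. x \<in> T \<Longrightarrow> fst s x = b + g \<bullet> x"
      "\<And>F x. F facet_of T \<Longrightarrow> x \<in> F \<Longrightarrow> (\<nu> F \<bullet> outward_normal T F) * snd s F x = g \<bullet> outward_normal T F"
      using a_form_zero[OF sp s(2) T] by metis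
    then have "?P T b g" by (simp add: veta)
    then show ?thesis by (intro exI)
  qed
  then have "\<forall>T\<in>\<T>. \<exists>b g. ?P T b g" by blast
  from bchoice[OF this] obtain \<beta> where "\<forall>T\<in>\<T>. \<exists>g. ?P T (\<beta> T) g" ..
  from bchoice[OF this] obtain \<gamma> where P: "\<forall>T\<in>\<T>. ?P T (\<beta> T) (\<gamma> T)" ..
  have aff: "v x = \<beta> T + \<gamma> T \<bullet> x" if "T \<in> \<T>" "x \<in> T" for T x
    using P that by blast
  have flux: "(\<nu> F \<bullet> outward_normal T F) * \<eta> F x = \<gamma> T \<bullet> outward_normal T F"
    if "T \<in> \<T>" "F facet_of T" "x \<in> F" for T F x
    using P that by blast
  \<comment> \<open>The two possible orientations of the unit normal cancel.\<close>
  have eta: "\<eta> F x = \<gamma> T \<bullet> \<nu> F" if T: "T \<in> \<T>" and F: "F facet_of T" "x \<in> F" for T F x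
  proof -
    let ?n = "outward_normal T F"
    have "unit_normal F (\<nu> F)" using \<nu> T F(1) by (auto simp: mesh_faces_def)
    from normal_sign[OF full_simplex_facet(5,3)[OF cells(2)[OF T] F(1)] this
        outward_normal_unit[OF cells(2)[OF T] F(1)]]
    have n: "?n = (?n \<bullet> \<nu> F) *\<^sub>R \<nu> F" "(?n \<bullet> \<nu> F)\<^sup>2 = 1" .
    have "(?n \<bullet> \<nu> F) * \<eta> F x = \<gamma> T \<bullet> ?n" using flux[OF T F] by (simp add: inner_commute)
    also have "\<dots> = (?n \<bullet> \<nu> F) * (\<gamma> T \<bullet> \<nu> F)" by (subst n(1)) simp
    finally show ?thesis using n(2) by auto
  qed
  have "v = 0"
  proof (rule PW_H1_zero_affine[OF _ _ aff])
    show "v \<in> PW (k + 2)" "v \<in> H1_zero \<Omega>" using s(1) by (auto simp: veta V_space_def)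
    fix T T' assume T: "T \<in> \<T>" "T' \<in> \<T>" "(T \<inter> T') facet_of T" "(T \<inter> T') facet_of T'"
    let ?F = "T \<inter> T'" and ?g = "\<gamma> T - \<gamma> T'"
    note Fp = full_simplex_facet[OF cells(2)[OF T(1)] T(3)]
    obtain x where x: "x \<in> ?F" using Fp(3) by blast
    have un: "unit_normal ?F (\<nu> ?F)" using \<nu> T by (auto simp: mesh_faces_def)
    have "?g \<bullet> (y - z) = 0" if "z \<in> ?F" "y \<in> ?F" for y z
      using aff[OF T(1), of y] aff[OF T(1), of z] aff[OF T(2), of y] aff[OF T(2), of z] that
      by (simp add: inner_diff_right inner_diff_left)
    then have "?g = (?g \<bullet> \<nu> ?F) *\<^sub>R \<nu> ?F" by (rule normal_unique[OF Fp(5) x un])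
    moreover have "?g \<bullet> \<nu> ?F = 0"
      using eta[OF T(1,3) x] eta[OF T(2,4) x] by (simp add: inner_diff_left)
    ultimately show "\<gamma> T = \<gamma> T'" by simp
  qed
  moreover have "\<eta> = 0"
  proof (intro ext)
    fix F x
    have fw: "\<eta> \<in> facewise_poly_space k (mesh_faces \<T>)" using s(1) by (simp add: veta V_space_def)
    show "\<eta> F x = 0 F x"
    proof (cases "F \<in> mesh_faces \<T> \<and> x \<in> F")
      case True
      then obtain T where T: "T \<in> \<T>" "F facet_of T" by (auto simp: mesh_faces_def)
      have "\<gamma> T = 0"
        by (rule affine_zero_on[of T "\<beta> T"])
          (use aff[OF T(1)] \<open>v = 0\<close> full_simplex_props(4)[OF cells(2)[OF T(1)]] in auto)
      then show ?thesis using eta[OF T] True by simp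
    next
      case False
      then show ?thesis using fw
        by (cases "F \<in> mesh_faces \<T>") (auto simp: facewise_poly_space_def face_poly_space_def)
    qed
  qed
  ultimately show ?thesis by (simp add: veta zero_prod_def)
qed

lemma grad_definite:
  assumes z: "z \<in> U_space \<Omega> \<T> k" "L2_inner \<Omega> (grad z) (grad z) = 0"
  shows "z = 0"
proof -
  have zU: "z \<in> PW (k + 1)" "z \<in> H1_zero \<Omega>" using z(1) by (auto simp: U_space_def)
  obtain c where c: "\<And>T x. T \<in> \<T> \<Longrightarrow> x \<in> T \<Longrightarrow> z x = c T"
    using L2_grad_zero[OF zU(1) z(2)] by metis
  show ?thesis
    by (rule PW_H1_zero_affine[OF zU, where \<beta>=c and \<gamma>="\<lambda>_. 0"]) (simp_all add: c)
qed

text \<open>Trial and test spaces coincide, which is why uniqueness entails existence.\<close>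

abbreviation solution_space where
  "solution_space k \<equiv> V_space \<Omega> \<T> k \<times> U_space \<Omega> \<T> k"

lemma subspace_solution_space: "subspace (solution_space k)"
  unfolding V_space_def U_space_def
  by (intro subspace_Times subspace_inter subspace_PW subspace_H1_zero subspace_facewise_poly_space)

lemma fin_dim_solution_space: "fin_dim (solution_space k)"
proof (rule fin_dim_subset)
  show "fin_dim (pair_space k \<times> PW (k + 1))"
    by (intro fin_dim_Times fin_dim_PW fin_dim_facewise_poly_space finite_mesh_faces)
qed (auto simp: V_space_def U_space_def)

text \<open>The left-hand side of the discrete problem. The two coupling terms have opposite signs, so they
  cancel on the diagonal.\<close>

definition problem_form where
  "problem_form \<kappa> \<nu> k s t = a_form \<nu> \<T> k (fst s) (fst t) - L2_inner \<Omega> (snd s) (fst (fst t))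
     + L2_inner \<Omega> (fst (fst s)) (snd t) + \<kappa> * L2_inner \<Omega> (grad (snd s)) (grad (snd t))"

lemma bilin_on_problem_form: "bilin_on (solution_space k) (problem_form \<kappa> \<nu> k)"
proof -
  let ?X = "solution_space k"
  have l1: "lin_on ?X (\<lambda>s. fst (fst s))" and l2: "lin_on ?X snd" and l3: "lin_on ?X fst"
    by (auto simp: lin_on_def)
  have m1: "fst (fst s) \<in> L2_space \<Omega>" and m2: "snd s \<in> L2_space \<Omega>" and m3: "fst s \<in> pair_space k"
    and m4: "snd s \<in> PW (k + 1)" if "s \<in> ?X" for s
    using that PW_L2_space by (auto simp: V_space_def U_space_def)
  note B = bilin_on_L2_omega
  show ?thesis
    unfolding problem_form_def[abs_def]
    by (intro bilin_on_ops bilin_on_compose[OF bilin_on_a_form l3 m3] bilin_on_compose[OF bilin_on_grad l2 m4]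
        bilin_on_compose2[OF B l2 l1 m2 m1] bilin_on_compose2[OF B l1 l2 m1 m2])
qed

lemma problem_form_definite:
  assumes \<nu>: "\<And>F. F \<in> mesh_faces \<T> \<Longrightarrow> unit_normal F (\<nu> F)" and \<kappa>: "\<kappa> > 0"
    and s: "s \<in> solution_space k" "problem_form \<kappa> \<nu> k s s = 0"
  shows "s = 0"
proof -
  have "a_form \<nu> \<T> k (fst s) (fst s) + \<kappa> * L2_inner \<Omega> (grad (snd s)) (grad (snd s)) = 0"
    using s(2) L2_inner_sym[of \<Omega> "snd s"] by (simp add: problem_form_def)
  moreover have "a_form \<nu> \<T> k (fst s) (fst s) \<ge> 0" by (rule a_form_nonneg)
  moreover have "\<kappa> * L2_inner \<Omega> (grad (snd s)) (grad (snd s)) \<ge> 0"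
    using \<kappa> by (intro mult_nonneg_nonneg L2_inner_nonneg) simp
  ultimately have "a_form \<nu> \<T> k (fst s) (fst s) = 0" "L2_inner \<Omega> (grad (snd s)) (grad (snd s)) = 0"
    using \<kappa> by (auto simp: add_nonneg_eq_0_iff)
  then have "fst s = 0" "snd s = 0"
    using a_form_definite[OF \<nu>] grad_definite s(1) by auto
  then show ?thesis by (simp add: prod_eq_iff)
qed

lemma discrete_solution_iff:
  "discrete_solution \<Omega> \<kappa> \<T> \<nu> k f (fst s) (snd s) \<longleftrightarrow>
    s \<in> solution_space k \<and> (\<forall>t\<in>solution_space k. problem_form \<kappa> \<nu> k s t = L2_inner \<Omega> f (snd t))"
  by (auto simp: discrete_solution_def problem_form_def mem_Times_iff)

lemma well_posed:
  assumes \<nu>: "\<And>F. F \<in> mesh_faces \<T> \<Longrightarrow> unit_normal F (\<nu> F)" and \<kappa>: "\<kappa> > 0"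
    and f: "f \<in> L2_space \<Omega>"
  shows "\<exists>!s. discrete_solution \<Omega> \<kappa> \<T> \<nu> k f (fst s) (snd s)"
proof -
  let ?X = "solution_space k" and ?B = "problem_form \<kappa> \<nu> k" and ?L = "\<lambda>t. L2_inner \<Omega> f (snd t)"
  note X = subspace_solution_space[of k] and B = bilin_on_problem_form[of k \<kappa> \<nu>]
  have definite: "s = 0" if "s \<in> ?X" "?B s s = 0" for s
    by (rule problem_form_definite[OF _ \<kappa> that]) (fact \<nu>)
  have L: "lin_on ?X ?L"
    by (rule lin_on_compose[OF lin_on_snd lin_on_L2_space_omega[OF f]])
      (auto simp: U_space_def intro: PW_L2_space)
  have "\<exists>s\<in>?X. \<forall>t\<in>?X. ?B s t = ?L t"
  proof (rule finite_lax_milgram[OF X fin_dim_solution_space B _ L])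
    fix s assume s: "s \<in> ?X" "?B s s = 0"
    then have "s = 0" by (rule definite)
    then show "?L s = 0" using lin_on_zero[OF L s(1)] by simp
    fix t assume t: "t \<in> ?X"
    show "?B s t = 0 \<and> ?B t s = 0"
      using lin_on_zero[OF bilin_onD(1)[OF B t] t] lin_on_zero[OF bilin_onD(2)[OF B t] t] \<open>s = 0\<close> by simp
  qed
  then obtain s where s: "s \<in> ?X" "\<And>t. t \<in> ?X \<Longrightarrow> ?B s t = ?L t" by blast
  show ?thesis
  proof (rule ex1I[of _ s])
    show "discrete_solution \<Omega> \<kappa> \<T> \<nu> k f (fst s) (snd s)" using s by (simp add: discrete_solution_iff)
    fix r assume "discrete_solution \<Omega> \<kappa> \<T> \<nu> k f (fst r) (snd r)"
    then have r: "r \<in> ?X" "\<And>t. t \<in> ?X \<Longrightarrow> ?B r t = ?L t" unfolding discrete_solution_iff by blast+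
    have d: "r - s \<in> ?X" using r(1) s(1) by (rule subspace_diff[OF X])
    have "?B (r - s) (r - s) = ?B r (r - s) - ?B s (r - s)"
      by (rule lin_on_diff[OF bilin_onD(2)[OF B d] X r(1) s(1)])
    also have "\<dots> = 0" using r(2)[OF d] s(2)[OF d] by simp
    finally have "r - s = 0" by (rule definite[OF d])
    then show "r = s" by simp
  qed
qed

end

theorem mainTheorem6:
  fixes \<Omega> :: "(real^'d::finite) set" and \<kappa> :: real
    and \<T>s :: "nat \<Rightarrow> (real^'d) set set" and m :: nat
    and \<nu> :: "(real^'d) set \<Rightarrow> real^'d" and k :: nat
  assumes "CARD('d) \<in> {2, 3}"
    and "polytopal_domain \<Omega>"
    and "\<kappa> > 0"
    and "shape_regular_mesh_sequence \<Omega> \<T>s"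
    and "\<forall>F\<in>mesh_faces (\<T>s m). unit_normal F (\<nu> F)"
  shows "\<forall>f\<in>L2_space \<Omega>. \<exists>!s. discrete_solution \<Omega> \<kappa> (\<T>s m) \<nu> k f (fst s) (snd s)"
proof -
  interpret mesh \<Omega> "\<T>s m"
    using assms(2,4) by unfold_locales (simp_all add: shape_regular_mesh_sequence_def)
  show ?thesis using well_posed assms(3,5) by blast
qed

end
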